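(* Let $A$ be a (possibly unbounded) self-adjoint operator in a Hilbert space $H$. Let $\lambda_0\in\mathbb R$ be a point which, together with some neighborhood $\Delta\subset\mathbb R$ of it, belongs to the resolvent set of $A$. Then the following two statements are equivalent. (i) The spectrum of $A$ to the left of the point $\lambda_0$ is purely singular. (ii) There exists a non-constant bounded outer scalar function $\gamma(\lambda)$ in the upper half-plane $\mathbb C_+$, whose boundary values $\gamma(k+i0)$ are real for almost every $k\in(\lambda_0,+\infty)$ and non-real for almost every $k\in(-\infty,\lambda_0)$, which weakly annihilates $A$ in the sense that $$ w\text{-}\lim_{\varepsilon\downarrow 0}\bigl(\gamma(A+i\varepsilon)-\gamma_*(A-i\varepsilon)\bigr)=0, $$ where $\gamma_*(\lambda):=\overline{\gamma(\overline{\lambda})}$ is the corresponding bounded outer function in the lower half-plane $\mathbb C_-$.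
   Context: $E_A(\cdot)$ denotes the projection-valued spectral measure of $A$; $H=H_{ac}\oplus H_s$ is the decomposition of $H$ into the absolutely continuous and singular spectral subspaces of $A$ ($u\in H_{ac}$, resp. $u\in H_s$, iff the measure $\langle E_A(\cdot)u,u\rangle$ is absolutely continuous, resp. singular, with respect to Lebesgue measure). "The spectrum of $A$ to the left of $\lambda_0$ is purely singular" means that $E_A((-\infty,\lambda_0))H\cap H_{ac}=\{0\}$. A bounded analytic function $\gamma$ in $\mathbb C_+$ is outer if it is not identically zero and $$\gamma(\lambda)=e^{ic}\exp\Bigl\{\frac{i}{\pi}\int_{\mathbb R}\Bigl(\frac{1}{\lambda-t}+\frac{t}{1+t^2}\Bigr)\log|\gamma(t+i0)|\,dt\Bigr\},\qquad \lambda\in\mathbb C_+,$$ for some real constant $c$, where $\gamma(t+i0)$ are the non-tangential boundary values (which exist for almost every $t\in\mathbb R$). A function on $\mathbb C_-$ is outer if it becomes outer in $\mathbb C_+$ after the transformation $f(\lambda)\mapsto\overline{f(\overline\lambda)}$. For $\varepsilon>0$, the bounded operators $\gamma(A+i\varepsilon)$ and $\gamma_*(A-i\varepsilon)$ are given by the functional calculus of $A$: they are the functions $k\mapsto\gamma(k+i\varepsilon)$ and $k\mapsto\gamma_*(k-i\varepsilon)=\overline{\gamma(k+i\varepsilon)}$, $k\in\mathbb R$, of the operator $A$. The symbol $w\text{-}\lim$ denotes the limit in the weak operator topology.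
   Formalization: The Hilbert space H is assumed separable; without this the claim fails, e.g. for multiplication by k on the non-separable space l^2((-∞, λ0-1]), where (i) holds but (ii) cannot. *)

theory Defs
  imports "HOL-Analysis.Analysis"
begin

text \<open>Complex Hilbert spaces, over the library's real ones: the complex inner product is linear in
  its first argument, and its real part is the inner product that induces norm and topology.\<close>

class complex_hilbert = real_inner + complete_space +
  fixes scaleC :: "complex \<Rightarrow> 'a \<Rightarrow> 'a" (infixr "*\<^sub>C" 75)
    and cinner :: "'a \<Rightarrow> 'a \<Rightarrow> complex"
  assumes scaleC_add_right: "c *\<^sub>C (x + y) = c *\<^sub>C x + c *\<^sub>C y"
    and scaleC_add_left: "(c + d) *\<^sub>C x = c *\<^sub>C x + d *\<^sub>C x"
    and scaleC_scaleC: "c *\<^sub>C d *\<^sub>C x = (c * d) *\<^sub>C x"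
    and scaleC_of_real: "complex_of_real r *\<^sub>C x = scaleR r x"
    and cinner_commute: "cinner x y = cnj (cinner y x)"
    and cinner_add_left: "cinner (x + y) z = cinner x z + cinner y z"
    and cinner_scaleC_left: "cinner (c *\<^sub>C x) y = c * cinner x y"
    and Re_cinner: "Re (cinner x y) = inner x y"

instantiation complex :: complex_hilbert
begin
definition scaleC_complex :: "complex \<Rightarrow> complex \<Rightarrow> complex" where
  "scaleC_complex c x = c * x"
definition cinner_complex :: "complex \<Rightarrow> complex \<Rightarrow> complex" where
  "cinner_complex x y = x * cnj y"
instance
  by standard
    (simp_all add: scaleC_complex_def cinner_complex_def algebra_simps inner_complex_def
      scaleR_conv_of_real)
end

definition bounded_clinear :: "('h::complex_hilbert \<Rightarrow> 'h) \<Rightarrow> bool" where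
  "bounded_clinear T \<longleftrightarrow> bounded_linear T \<and> (\<forall>c u. T (c *\<^sub>C u) = c *\<^sub>C T u)"

text \<open>An unbounded operator is a pair of a domain \<open>D\<close> and a map \<open>A\<close>; the values of \<open>A\<close>
  outside \<open>D\<close> are irrelevant.\<close>

definition densely_defined_op :: "'h::complex_hilbert set \<Rightarrow> ('h \<Rightarrow> 'h) \<Rightarrow> bool" where
  "densely_defined_op D A \<longleftrightarrow>
     0 \<in> D \<and> (\<forall>u\<in>D. \<forall>v\<in>D. u + v \<in> D \<and> A (u + v) = A u + A v) \<and>
     (\<forall>c. \<forall>u\<in>D. c *\<^sub>C u \<in> D \<and> A (c *\<^sub>C u) = c *\<^sub>C A u) \<and>
     closure D = UNIV"

definition adjoint_graph :: "'h::complex_hilbert set \<Rightarrow> ('h \<Rightarrow> 'h) \<Rightarrow> ('h \<times> 'h) set" where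
  "adjoint_graph D A = {(v, w). \<forall>u\<in>D. cinner (A u) v = cinner u w}"

definition self_adjoint_op :: "'h::complex_hilbert set \<Rightarrow> ('h \<Rightarrow> 'h) \<Rightarrow> bool" where
  "self_adjoint_op D A \<longleftrightarrow>
     densely_defined_op D A \<and> adjoint_graph D A = {(v, A v) |v. v \<in> D}"

definition resolvent_set :: "'h::complex_hilbert set \<Rightarrow> ('h \<Rightarrow> 'h) \<Rightarrow> complex set" where
  "resolvent_set D A = {z. \<exists>R. bounded_clinear R \<and>
     (\<forall>v. R v \<in> D \<and> A (R v) - z *\<^sub>C R v = v) \<and> (\<forall>u\<in>D. R (A u - z *\<^sub>C u) = u)}"

definition orthogonal_projection :: "('h::complex_hilbert \<Rightarrow> 'h) \<Rightarrow> bool" where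
  "orthogonal_projection P \<longleftrightarrow> bounded_clinear P \<and>
     (\<forall>u. P (P u) = P u) \<and> (\<forall>u v. cinner (P u) v = cinner u (P v))"

definition projection_valued_measure :: "(real set \<Rightarrow> 'h::complex_hilbert \<Rightarrow> 'h) \<Rightarrow> bool" where
  "projection_valued_measure E \<longleftrightarrow>
     (\<forall>S\<in>sets borel. orthogonal_projection (E S)) \<and> (\<forall>u. E UNIV u = u) \<and>
     (\<forall>S :: nat \<Rightarrow> real set. range S \<subseteq> sets borel \<longrightarrow> disjoint_family S \<longrightarrow>
        (\<forall>u. (\<lambda>n. E (S n) u) sums E (\<Union>n. S n) u))"

text \<open>The measure \<open>\<langle>E(\<cdot>)u, u\<rangle>\<close>. These inner products are real and nonnegative for a
  projection-valued measure, so taking the real part is only a change of type.\<close>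

definition spectral_distr ::
    "(real set \<Rightarrow> 'h::complex_hilbert \<Rightarrow> 'h) \<Rightarrow> 'h \<Rightarrow> real measure" where
  "spectral_distr E u = measure_of UNIV (sets borel) (\<lambda>S. ennreal (Re (cinner (E S u) u)))"

text \<open>\<open>E\<close> is the spectral measure of \<open>A\<close>, i.e. \<open>A = \<integral> t dE(t)\<close>; the spectral theorem says that a
  self-adjoint operator has exactly one (on Borel sets). By polarization the quadratic form
  determines \<open>A\<close> on \<open>D\<close>.\<close>

definition is_spectral_measure ::
    "'h::complex_hilbert set \<Rightarrow> ('h \<Rightarrow> 'h) \<Rightarrow> (real set \<Rightarrow> 'h \<Rightarrow> 'h) \<Rightarrow> bool" where
  "is_spectral_measure D A E \<longleftrightarrow> projection_valued_measure E \<and>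
     D = {u. integrable (spectral_distr E u) (\<lambda>t. t\<^sup>2)} \<and>
     (\<forall>u\<in>D. cinner (A u) u = complex_of_real (\<integral>t. t \<partial>spectral_distr E u))"

text \<open>The operator \<open>\<integral> f dE\<close> for bounded Borel \<open>f\<close>, which is determined by its quadratic form.\<close>

definition fun_calc ::
    "(real set \<Rightarrow> 'h::complex_hilbert \<Rightarrow> 'h) \<Rightarrow> (real \<Rightarrow> complex) \<Rightarrow> 'h \<Rightarrow> 'h" where
  "fun_calc E f = (THE T. bounded_clinear T \<and>
     (\<forall>u. cinner (T u) u = (\<integral>k. f k \<partial>spectral_distr E u)))"

definition ac_subspace :: "(real set \<Rightarrow> 'h::complex_hilbert \<Rightarrow> 'h) \<Rightarrow> 'h set" where
  "ac_subspace E = {u. absolutely_continuous lborel (spectral_distr E u)}"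

definition purely_singular_left ::
    "(real set \<Rightarrow> 'h::complex_hilbert \<Rightarrow> 'h) \<Rightarrow> real \<Rightarrow> bool" where
  "purely_singular_left E l0 \<longleftrightarrow> range (E {..<l0}) \<inter> ac_subspace E = {0}"

definition upper_half_plane :: "complex set" where
  "upper_half_plane = {z. Im z > 0}"

definition nontangential_limit :: "(complex \<Rightarrow> complex) \<Rightarrow> real \<Rightarrow> complex \<Rightarrow> bool" where
  "nontangential_limit \<gamma> t w \<longleftrightarrow>
     (\<forall>a>0. (\<gamma> \<longlongrightarrow> w)
        (at (complex_of_real t) within {z. Im z > 0 \<and> \<bar>Re z - t\<bar> < a * Im z}))"

definition boundary_value :: "(complex \<Rightarrow> complex) \<Rightarrow> real \<Rightarrow> complex" where
  "boundary_value \<gamma> t = (THE w. nontangential_limit \<gamma> t w)"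

text \<open>Only the values of \<open>\<gamma>\<close> in the upper half-plane matter. For bounded analytic \<open>\<gamma> \<noteq> 0\<close> the
  boundary values exist and are nonzero almost everywhere and the integral converges.\<close>

definition bounded_outer :: "(complex \<Rightarrow> complex) \<Rightarrow> bool" where
  "bounded_outer \<gamma> \<longleftrightarrow>
     \<gamma> holomorphic_on upper_half_plane \<and> bounded (\<gamma> ` upper_half_plane) \<and>
     (\<exists>z\<in>upper_half_plane. \<gamma> z \<noteq> 0) \<and>
     (\<exists>c::real. \<forall>z\<in>upper_half_plane.
        \<gamma> z = exp (\<i> * complex_of_real c) *
          exp (\<i> / complex_of_real pi *
            (\<integral>t. (1 / (z - complex_of_real t) + complex_of_real (t / (1 + t\<^sup>2))) *
                 complex_of_real (ln (cmod (boundary_value \<gamma> t))) \<partial>lebesgue)))"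

definition conj_reflect :: "(complex \<Rightarrow> complex) \<Rightarrow> complex \<Rightarrow> complex" where
  "conj_reflect \<gamma> z = cnj (\<gamma> (cnj z))"

definition bounded_outer_lower :: "(complex \<Rightarrow> complex) \<Rightarrow> bool" where
  "bounded_outer_lower f \<longleftrightarrow> bounded_outer (conj_reflect f)"

lemma bounded_outer_lower_conj_reflect: "bounded_outer_lower (conj_reflect \<gamma>) \<longleftrightarrow> bounded_outer \<gamma>"
  by (simp add: bounded_outer_lower_def conj_reflect_def[abs_def])

definition weakly_annihilates ::
    "(complex \<Rightarrow> complex) \<Rightarrow> (real set \<Rightarrow> 'h::complex_hilbert \<Rightarrow> 'h) \<Rightarrow> bool" where
  "weakly_annihilates \<gamma> E \<longleftrightarrow>
     (\<forall>u v. ((\<lambda>\<epsilon>. cinner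
          (fun_calc E (\<lambda>k. \<gamma> (Complex k \<epsilon>)) u - fun_calc E (\<lambda>k. conj_reflect \<gamma> (Complex k (- \<epsilon>))) u) v)
        \<longlongrightarrow> 0) (at_right (0::real)))"

end

theory Submission
  imports Defs "HOL-Complex_Analysis.Complex_Analysis" "HOL-Probability.Sinc_Integral"
begin

text \<open>By polarization, weak annihilation means that \<open>\<integral> Im \<gamma>(k + i\<epsilon>) d\<mu>\<^sub>u(k) \<rightarrow> 0\<close> for every spectral
  distribution \<open>\<mu>\<^sub>u\<close>. If \<open>u\<close> is absolutely continuous and lives to the left of \<open>l0\<close>, Fatou's theorem and
  dominated convergence, applied to all \<open>E(S)u\<close>, give \<open>Im \<gamma>(k + i0) = 0\<close> almost everywhere for \<open>\<mu>\<^sub>u\<close>,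
  so \<open>\<mu>\<^sub>u = 0\<close>.

  Conversely, if the spectrum to the left of \<open>l0\<close> is singular, separability yields one Lebesgue null set
  \<open>N\<close> that carries it. Choose a finite measure \<open>\<nu> = f dt\<close> on \<open>(-\<infinity>, l0)\<close> with \<open>f > 0\<close> and \<open>f\<close> tending to
  infinity at each point of \<open>N \<union> {l0}\<close>, namely \<open>f = \<Sum> 1\<^bsub>U\<^esub> + 1/(1 + t\<^sup>2)\<close> over open sets \<open>U \<supseteq> N \<union> {l0}\<close> of
  summable measure. Its Cauchy transform \<open>\<Phi>(z) = \<integral> d\<nu>(t)/(z - t)\<close> maps the upper half-plane to the lower
  one and is positive on \<open>(l0, \<infinity>)\<close>, and the function wanted is \<open>\<gamma> = 1 + 1/(1 + \<surd>\<Phi>)\<close>: it is real on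
  \<open>(l0, \<infinity>)\<close>, tends to \<open>1\<close> on \<open>N \<union> {l0}\<close> where \<open>\<Phi>\<close> explodes, and satisfies \<open>1 \<le> Re \<gamma>\<close> and \<open>\<bar>\<gamma>\<bar> \<le> 2\<close>, so
  that \<open>log \<gamma>\<close> is bounded and \<open>\<gamma>\<close> is outer by the Schwarz formula. To the left of \<open>l0\<close> its boundary
  values are non-real because \<open>Im \<Phi>\<close> stays away from \<open>0\<close> and, by a uniform bound for
  \<open>\<integral> \<bar>\<surd>\<Phi>(t + i\<epsilon>)\<bar>/(1 + t\<^sup>2) dt\<close>, \<open>\<Phi>\<close> does not explode almost everywhere.\<close>

section \<open>Differentiability of Lipschitz functions\<close>

text \<open>Singular spectral measures charge Lebesgue null sets, so boundary behaviour known only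
  almost everywhere says nothing about them: \<open>Im \<gamma>\<close> has to tend to 0 at every
  single point of \<open>N\<close> and of \<open>[l0, \<infinity>)\<close>. This is why the density
  is forced up pointwise on \<open>N\<close>. The square root is the second device. \<Phi> has a
  real part of either sign, and its boundary values need not be locally integrable. The root moves
  the lower half-plane into the fourth quadrant, where 1 plus the value stays away from 0 and where
  multiplication by \<open>1 + \<i>\<close> makes the real part dominate the modulus, so that one
  Poisson integral controls the modulus.

  Fatou's theorem is reduced to differentiability of Lipschitz functions of a real variable: a
  primitive of a bounded holomorphic function is Lipschitz up to the real axis, its trace there is
  differentiable almost everywhere, and a maximum principle on squares carries the derivative into
  the cones. The Schwarz formula comes from Cauchy's formula on growing rectangles, applied to
  functions shifted slightly upwards.\<close>

lemma bilipschitz_real_AE_differentiable: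
  fixes G :: "real \<Rightarrow> real"
  assumes lo: "\<And>x y. x \<le> y \<Longrightarrow> y - x \<le> G y - G x"
    and up: "\<And>x y. x \<le> y \<Longrightarrow> G y - G x \<le> K * (y - x)"
  obtains N where "negligible N" "\<And>x. x \<notin> N \<Longrightarrow> G differentiable (at x)"
proof -
  have dist_up: "\<bar>G y - G x\<bar> \<le> K * \<bar>y - x\<bar>" for x y
    using lo[of x y] lo[of y x] up[of x y] up[of y x] by (cases "x \<le> y") auto
  have cont: "continuous_on UNIV G"
  proof (rule lipschitz_on_continuous_on)
    show "\<bar>K\<bar>-lipschitz_on UNIV G"
    proof (rule lipschitz_onI)
      fix x y show "dist (G x) (G y) \<le> \<bar>K\<bar> * dist x y"
        using dist_up[of x y] order_trans[OF _ mult_right_mono[of K "\<bar>K\<bar>" "\<bar>y - x\<bar>"]]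
        by (auto simp: dist_real_def abs_minus_commute)
    qed auto
  qed
  have sm: "G x < G y" if "x < y" for x y using lo[of x y] that by auto
  have inj: "inj G"
    by (metis injI linorder_less_linear order_less_irrefl sm)
  have surj: "\<exists>x. G x = y" for y
  proof -
    define r where "r = \<bar>y\<bar> + \<bar>G 0\<bar>"
    have "G (- r) \<le> y" "y \<le> G r"
      using lo[of "-r" 0] lo[of 0 r] unfolding r_def by linarith+
    then have "\<exists>x\<ge>-r. x \<le> r \<and> G x = y"
      by (intro IVT') (auto simp: r_def intro: continuous_on_subset[OF cont])
    then show ?thesis by blast
  qed
  define H where "H = inv G"
  have GH: "G (H y) = y" for y using surj[of y] unfolding H_def by (metis f_inv_into_f rangeI)
  have HG: "H (G x) = x" for x unfolding H_def by (simp add: inj)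
  have vim: "H -` S = G ` S" for S
  proof (rule set_eqI)
    show "y \<in> H -` S \<longleftrightarrow> y \<in> G ` S" for y
      using GH[of y] HG by (force simp: image_iff)
  qed
  have mono: "mono H"
    by (rule monoI) (metis GH linorder_not_less sm)
  have H_meas[measurable]: "H \<in> borel_measurable borel"
    using mono by (rule borel_measurable_mono)
  define \<nu> where "\<nu> = distr lborel borel H"
  have em: "emeasure \<nu> S = emeasure lborel (G ` S)" if "S \<in> sets borel" for S
    unfolding \<nu>_def using that by (simp add: emeasure_distr vim)
  have img: "G ` {a..b} = {G a..G b}" for a b
  proof (rule set_eqI)
    fix y
    have iff: "G x \<le> G x' \<longleftrightarrow> x \<le> x'" for x x'
      using sm[of x x'] sm[of x' x] by (cases x x' rule: linorder_cases) auto
    have "y \<in> G ` {a..b} \<longleftrightarrow> H y \<in> {a..b}"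
      using vim[of "{a..b}"] by blast
    also have "\<dots> \<longleftrightarrow> y \<in> {G a..G b}"
      using iff[of a "H y"] iff[of "H y" b] by (simp add: GH)
    finally show "y \<in> G ` {a..b} \<longleftrightarrow> y \<in> {G a..G b}" .
  qed
  have ac: "absolutely_continuous lborel \<nu>"
    unfolding absolutely_continuous_def
  proof
    fix S :: "real set" assume S: "S \<in> null_sets lborel"
    then have Sb: "S \<in> sets borel" by auto
    have "negligible S" using S by (simp add: negligible_iff_null_sets null_sets_completionI)
    then have "negligible (G ` S)"
    proof (rule negligible_locally_Lipschitz_image[rotated])
      fix x show "\<exists>T B. open T \<and> x \<in> T \<and> (\<forall>y\<in>S \<inter> T. norm (G y - G x) \<le> B * norm (y - x))"
        by (rule exI[of _ UNIV], rule exI[of _ K]) (use dist_up in auto)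
    qed auto
    moreover have "G ` S \<in> sets borel"
      using measurable_sets[OF H_meas Sb] by (simp add: vim)
    ultimately have "emeasure lborel (G ` S) = 0"
      using emeasure_completion[of "G ` S" lborel] by (auto simp: negligible_iff_null_sets)
    then show "S \<in> null_sets \<nu>" using em[OF Sb] Sb by (auto simp: null_sets_def \<nu>_def)
  qed
  have "sets \<nu> = sets lborel" by (simp add: \<nu>_def)
  from sigma_finite_measure.Radon_Nikodym[OF sigma_finite_lborel ac this] obtain g :: "real \<Rightarrow> ennreal"
    where g[measurable]: "g \<in> borel_measurable lborel" and dens: "density lborel g = \<nu>" by blast
  define f where "f x = enn2real (g x)" for x
  have f_meas[measurable]: "f \<in> borel_measurable borel"
    using g unfolding f_def by (auto intro!: borel_measurable_enn2real)
  have hi: "(f has_integral (G b - G a)) {a..b}" if "a \<le> b" for a b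
  proof -
    have eq: "(\<integral>\<^sup>+x. g x * indicator {a..b} x \<partial>lborel) = ennreal (G b - G a)"
    proof -
      have "(\<integral>\<^sup>+x. g x * indicator {a..b} x \<partial>lborel) = emeasure (density lborel g) {a..b}"
        by (subst emeasure_density) auto
      also have "\<dots> = emeasure lborel {G a..G b}" by (simp add: dens em img)
      also have "\<dots> = ennreal (G b - G a)" using lo[of a b] that by auto
      finally show ?thesis .
    qed
    have "AE x in lborel. g x * indicator {a..b} x \<noteq> \<infinity>"
      by (rule nn_integral_PInf_AE) (use eq in auto)
    then have "AE x in lborel. g x * indicator {a..b} x = ennreal (f x * indicator {a..b} x)"
    proof eventually_elim
      case (elim x)
      then show ?case by (cases "x \<in> {a..b}") (auto simp: f_def less_top)
    qed
    then have eq2: "(\<integral>\<^sup>+x. ennreal (f x * indicator {a..b} x) \<partial>lborel) = ennreal (G b - G a)"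
      using eq nn_integral_cong_AE by metis
    have nn: "0 \<le> f x * indicator {a..b} x" for x
      by (auto simp: f_def)
    have int: "integrable lborel (\<lambda>x. f x * indicator {a..b} x)"
      by (rule integrableI_nn_integral_finite[OF _ _ eq2]) (use nn in auto)
    have "integral\<^sup>L lborel (\<lambda>x. f x * indicator {a..b} x) = G b - G a"
      by (subst integral_eq_nn_integral) (use nn eq2 lo[of a b] that in auto)
    with has_integral_integral_lborel[OF int]
    have "((\<lambda>x. f x * indicator {a..b} x) has_integral (G b - G a)) UNIV" by simp
    also have "(\<lambda>x. f x * indicator {a..b} x) = (\<lambda>x. if x \<in> {a..b} then f x else 0)"
      by (auto simp: indicator_def)
    finally show ?thesis by (simp only: has_integral_restrict_UNIV)
  qed
  have i1: "f integrable_on cbox a b" for a b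
    using hi[of a b] by (cases "a \<le> b") (auto simp: integrable_on_def)
  \<comment> \<open>The differentiation theorem used below averages over intervals to the right of
    \<open>x\<close>. Applied to the reflected density it yields the left difference
    quotients.\<close>
  have hi2: "((\<lambda>x. f (- x)) has_integral (G b - G a)) {-b..-a}" if "a \<le> b" for a b
    using hi[OF that] by simp
  have i2: "(\<lambda>x. f (- x)) integrable_on cbox a b" for a b
    using hi2[of "-b" "-a"] by (cases "a \<le> b") (auto simp: integrable_on_def)
  obtain N1 where N1: "negligible N1" and D1: "\<And>x e. \<lbrakk>x \<notin> N1; 0 < e\<rbrakk> \<Longrightarrow>
        \<exists>d>0. \<forall>h. 0 < h \<and> h < d \<longrightarrow>
          norm (integral (cbox x (x + h *\<^sub>R One)) f /\<^sub>R h ^ DIM(real) - f x) < e"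
    using integrable_ccontinuous_explicit[OF i1] by blast
  obtain N2 where N2: "negligible N2" and D2: "\<And>x e. \<lbrakk>x \<notin> N2; 0 < e\<rbrakk> \<Longrightarrow>
        \<exists>d>0. \<forall>h. 0 < h \<and> h < d \<longrightarrow>
          norm (integral (cbox x (x + h *\<^sub>R One)) (\<lambda>x. f (- x)) /\<^sub>R h ^ DIM(real) - f (- x)) < e"
    using integrable_ccontinuous_explicit[OF i2] by blast
  have D: "(G has_real_derivative f x) (at x)" if x: "x \<notin> N1 \<union> uminus ` N2" for x
    unfolding DERIV_def LIM_def
  proof (intro allI impI)
    fix e :: real assume e: "e > 0"
    obtain d1 where d1: "d1 > 0" "\<And>h. 0 < h \<Longrightarrow> h < d1 \<Longrightarrow>
          norm (integral (cbox x (x + h *\<^sub>R One)) f /\<^sub>R h ^ DIM(real) - f x) < e"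
      using D1[of x e] x e by auto
    have "- x \<notin> N2" using x by force
    then obtain d2 where d2: "d2 > 0" "\<And>h. 0 < h \<Longrightarrow> h < d2 \<Longrightarrow>
          norm (integral (cbox (-x) (-x + h *\<^sub>R One)) (\<lambda>x. f (- x)) /\<^sub>R h ^ DIM(real) - f (-(-x))) < e"
      using D2[of "-x" e] e by metis
    show "\<exists>s>0. \<forall>h. h \<noteq> 0 \<and> dist h 0 < s \<longrightarrow> dist ((G (x + h) - G x) / h) (f x) < e"
    proof (intro exI[of _ "min d1 d2"] conjI allI impI)
      fix h :: real assume h: "h \<noteq> 0 \<and> dist h 0 < min d1 d2"
      show "dist ((G (x + h) - G x) / h) (f x) < e"
      proof (cases "h > 0")
        case True
        have "integral {x..x + h} f = G (x + h) - G x"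
          using hi[of x "x + h"] True by (intro integral_unique) auto
        then show ?thesis using d1(2)[of h] h True by (auto simp: dist_real_def divide_inverse mult.commute)
      next
        case False
        define k where "k = - h"
        have k: "k > 0" "k < d2" using False h by (auto simp: k_def)
        have "integral {-x..-x + k} (\<lambda>x. f (- x)) = G x - G (x - k)"
          using hi2[of "x - k" x] k by (intro integral_unique) auto
        then have "\<bar>(G x - G (x - k)) / k - f x\<bar> < e"
          using d2(2)[of k] k by (simp add: divide_inverse mult.commute)
        moreover have "(G (x + h) - G x) / h = (G x - G (x - k)) / k"
          using k by (simp add: k_def field_simps)
        ultimately show ?thesis by (simp add: dist_real_def)
      qed
    qed (use d1 d2 in auto)
  qed
  have "negligible (uminus ` N2)"
    using N2 negligible_differentiable_image_negligible[of N2 uminus]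
    by (auto simp: differentiable_on_def)
  with N1 have "negligible (N1 \<union> uminus ` N2)" by auto
  then show ?thesis
    by (rule that) (use D in \<open>auto simp: differentiable_def has_field_derivative_def\<close>)
qed

text \<open>Adding the linear term \<open>(C + 1) * x\<close> makes the function expanding, hence
  invertible, without changing where it is differentiable.\<close>

lemma lipschitz_real_AE_differentiable:
  fixes F :: "real \<Rightarrow> real"
  assumes "C-lipschitz_on UNIV F"
  obtains N where "negligible N" "\<And>x. x \<notin> N \<Longrightarrow> F differentiable (at x)"
proof -
  define G where "G x = F x + (C + 1) * x" for x
  have F: "\<bar>F y - F x\<bar> \<le> C * \<bar>y - x\<bar>" for x y
    using lipschitz_onD[OF assms, of y x] by (auto simp: dist_real_def)
  have lo: "y - x \<le> G y - G x" and up: "G y - G x \<le> (2 * C + 1) * (y - x)" if "x \<le> y" for x y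
    using F[of y x] that by (auto simp: G_def algebra_simps abs_le_iff)
  obtain N where N: "negligible N" "\<And>x. x \<notin> N \<Longrightarrow> G differentiable (at x)"
    using bilipschitz_real_AE_differentiable[OF lo up] by blast
  have "F = (\<lambda>x. G x - (C + 1) * x)" by (auto simp: G_def)
  then have "F differentiable (at x)" if "x \<notin> N" for x
    using N(2)[OF that] by auto
  with N(1) that show ?thesis by blast
qed

lemma lipschitz_complex_AE_differentiable:
  fixes F :: "real \<Rightarrow> complex"
  assumes "C-lipschitz_on UNIV F"
  obtains N where "negligible N" "\<And>x. x \<notin> N \<Longrightarrow> \<exists>a. (F has_vector_derivative a) (at x)"
proof -
  have "C-lipschitz_on UNIV (\<lambda>x. Re (F x))" "C-lipschitz_on UNIV (\<lambda>x. Im (F x))"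
  proof -
    have "\<bar>Re (F x) - Re (F y)\<bar> \<le> C * \<bar>x - y\<bar>" "\<bar>Im (F x) - Im (F y)\<bar> \<le> C * \<bar>x - y\<bar>" for x y
      using lipschitz_onD[OF assms, of x y] abs_Re_le_cmod[of "F x - F y"] abs_Im_le_cmod[of "F x - F y"]
      by (auto simp: dist_norm)
    then show "C-lipschitz_on UNIV (\<lambda>x. Re (F x))" "C-lipschitz_on UNIV (\<lambda>x. Im (F x))"
      using lipschitz_on_nonneg[OF assms] by (auto simp: lipschitz_on_def dist_real_def)
  qed
  then obtain N M where N: "negligible N" "\<And>x. x \<notin> N \<Longrightarrow> (\<lambda>x. Re (F x)) differentiable (at x)"
    and M: "negligible M" "\<And>x. x \<notin> M \<Longrightarrow> (\<lambda>x. Im (F x)) differentiable (at x)"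
    by (metis lipschitz_real_AE_differentiable)
  have "\<exists>a. (F has_vector_derivative a) (at x)" if "x \<notin> N \<union> M" for x
  proof -
    have "((\<lambda>x. Re (F x)) has_vector_derivative deriv (\<lambda>x. Re (F x)) x) (at x)"
      "((\<lambda>x. Im (F x)) has_vector_derivative deriv (\<lambda>x. Im (F x)) x) (at x)"
      using N(2) M(2) that
      by (auto simp: DERIV_deriv_iff_real_differentiable[symmetric] has_real_derivative_iff_has_vector_derivative)
    then have "(F has_vector_derivative Complex (deriv (\<lambda>x. Re (F x)) x) (deriv (\<lambda>x. Im (F x)) x)) (at x)"
      by (subst has_vector_derivative_complex_iff) (auto simp: has_real_derivative_iff_has_vector_derivative)
    then show ?thesis by blast
  qed
  with that[of "N \<union> M"] N(1) M(1) show ?thesis by auto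
qed

section \<open>Fatou's theorem for the half-plane\<close>

lemma open_upper_half_plane: "open upper_half_plane"
  unfolding upper_half_plane_def by (rule open_halfspace_Im_gt)

lemma convex_upper_half_plane: "convex upper_half_plane"
  unfolding upper_half_plane_def by (rule convex_halfspace_Im_gt)

lemma closure_upper_half_plane: "closure upper_half_plane = {z. Im z \<ge> 0}"
proof -
  have "upper_half_plane = {z. \<i> \<bullet> z > 0}"
    by (auto simp: upper_half_plane_def inner_complex_def)
  then show ?thesis
    using closure_halfspace_gt[of "\<i>" 0] by (simp add: inner_complex_def)
qed

text \<open>The product over the four rotations about \<open>w\<close> is small on all four sides of the square as soon
  as \<open>G\<close> is small on the side that lies on the real axis.\<close>

lemma square_four_rotations_bound:
  fixes G :: "complex \<Rightarrow> complex"
  assumes holo: "G holomorphic_on upper_half_plane"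
    and cont: "continuous_on {z. Im z \<ge> 0} G"
    and w: "Im w > 0"
    and bd: "\<And>z. Im z \<ge> 0 \<Longrightarrow> cmod (z - w) \<le> 2 * Im w \<Longrightarrow> cmod (G z) \<le> B"
    and bd0: "\<And>t::real. cmod (of_real t - w) \<le> 2 * Im w \<Longrightarrow> cmod (G (of_real t)) \<le> b"
  shows "cmod (G w) ^ 4 \<le> b * B ^ 3"
proof -
  define q where "q = Im w"
  have q: "q > 0" using w by (simp add: q_def)
  \<comment> \<open>In the coordinate centred at \<open>w\<close>: half side \<open>Im w\<close>
    puts the bottom side exactly on the real axis, and no point is farther from the centre than
    \<open>2 * Im w\<close>, where both bounds are assumed.\<close>
  define S where "S = cbox (Complex (-q) (-q)) (Complex q q)"
  have S_iff: "z \<in> S \<longleftrightarrow> \<bar>Re z\<bar> \<le> q \<and> \<bar>Im z\<bar> \<le> q" for z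
    by (auto simp: S_def in_cbox_complex_iff)
  have int_iff: "z \<in> interior S \<longleftrightarrow> \<bar>Re z\<bar> < q \<and> \<bar>Im z\<bar> < q" for z
    by (auto simp: S_def interior_cbox in_box_complex_iff)
  define g where "g c z = G (w + c * z)" for c z
  define P where "P z = g 1 z * g \<i> z * g (-1) z * g (-\<i>) z" for z
  define R where "R = {1, \<i>, -1, -\<i>}"
  have cS: "c * z \<in> S" if "c \<in> R" "z \<in> S" for c z
    using that by (auto simp: R_def S_iff)
  have cI: "c * z \<in> interior S" if "c \<in> R" "z \<in> interior S" for c z
    using that by (auto simp: R_def int_iff)
  have g_bd: "cmod (g c z) \<le> B" if "c \<in> R" "z \<in> S" for c z
  proof -
    have "\<bar>Re (c * z)\<bar> \<le> q" "\<bar>Im (c * z)\<bar> \<le> q" using cS[OF that] by (auto simp: S_iff)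
    moreover from this have "cmod (c * z) \<le> 2 * q" using cmod_le[of "c * z"] by linarith
    ultimately show ?thesis unfolding g_def
      by (intro bd) (auto simp: q_def)
  qed
  have holP: "P holomorphic_on interior S"
  proof -
    have "g c holomorphic_on interior S" if "c \<in> R" for c
      unfolding g_def
    proof (rule holomorphic_on_compose_gen[of "\<lambda>z. w + c * z" _ G upper_half_plane, unfolded comp_def])
      show "(\<lambda>z. w + c * z) ` interior S \<subseteq> upper_half_plane"
        using cI[OF that] by (force simp: int_iff upper_half_plane_def q_def)
    qed (auto intro!: holomorphic_intros holo)
    then show ?thesis unfolding P_def by (intro holomorphic_intros) (auto simp: R_def)
  qed
  have contP: "continuous_on (closure S) P"
  proof -
    have "continuous_on S (g c)" if "c \<in> R" for c
      unfolding g_def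
    proof (rule continuous_on_compose2[OF cont])
      show "(\<lambda>z. w + c * z) ` S \<subseteq> {z. 0 \<le> Im z}"
        using cS[OF that] by (force simp: S_iff q_def)
    qed (auto intro!: continuous_intros)
    then show ?thesis unfolding P_def S_def closure_cbox
      unfolding S_def[symmetric] by (intro continuous_intros) (auto simp: R_def)
  qed
  have B0: "0 \<le> B"
    by (rule order_trans[OF norm_ge_zero g_bd[of 1 0]]) (use q in \<open>auto simp: R_def S_iff\<close>)
  have Pz: "cmod (P z) \<le> b * B ^ 3" if "z \<in> frontier S" for z
  proof -
    have zS: "z \<in> S" using that by (auto simp: frontier_def S_def)
    have "\<bar>Re z\<bar> = q \<or> \<bar>Im z\<bar> = q"
      using that zS[unfolded S_iff] int_iff[of z] by (auto simp: frontier_def)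
    then have "\<exists>c\<in>R. Im (c * z) = - q" unfolding R_def by auto
    then obtain c where c: "c \<in> R" "Im (c * z) = - q" by blast
    have small: "cmod (g c z) \<le> b"
    proof -
      have eq: "w + c * z = of_real (Re (w + c * z))"
        using c(2) by (simp add: complex_eq_iff q_def)
      have "\<bar>Re (c * z)\<bar> \<le> q" "\<bar>Im (c * z)\<bar> \<le> q" using cS[OF c(1) zS] by (auto simp: S_iff)
      then have "cmod (c * z) \<le> 2 * q" using cmod_le[of "c * z"] by linarith
      then have "cmod (of_real (Re (w + c * z)) - w) \<le> 2 * Im w"
        by (subst eq[symmetric]) (simp add: q_def)
      then show ?thesis unfolding g_def by (subst eq) (rule bd0)
    qed
    have b0: "0 \<le> b" using small norm_ge_zero order_trans by blast
    have R4: "finite R" "\<And>f. prod f R = f 1 * f \<i> * f (-1) * f (-\<i>)" for f :: "complex \<Rightarrow> real"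
      by (auto simp: R_def complex_eq_iff mult.assoc)
    have "cmod (P z) = (\<Prod>d\<in>R. cmod (g d z))"
      by (simp add: R4 P_def norm_mult)
    also have "\<dots> = cmod (g c z) * (\<Prod>d\<in>R - {c}. cmod (g d z))"
      using c(1) by (simp add: prod.remove R_def)
    also have "\<dots> \<le> b * (\<Prod>d\<in>R - {c}. B)"
      using g_bd[OF _ zS] small b0 by (intro mult_mono prod_mono prod_nonneg) auto
    also have "(\<Prod>d\<in>R - {c}. B) = B ^ 3"
    proof -
      have "card R = 4" by (simp add: R_def complex_eq_iff)
      then have "card (R - {c}) = 3" using c(1) by (simp add: R_def)
      then show ?thesis by simp
    qed
    finally show ?thesis .
  qed
  have "cmod (P 0) \<le> b * B ^ 3"
    by (rule maximum_modulus_frontier[OF holP contP _ Pz]) (use q in \<open>auto simp: S_iff\<close>, simp add: S_def)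
  moreover have "cmod (P 0) = cmod (G w) ^ 4"
    by (simp add: P_def g_def norm_mult power4_eq_xxxx)
  ultimately show ?thesis by simp
qed

text \<open>Subtract from \<open>F\<close> its first-order expansion at \<open>t0\<close>. The
  remainder \<open>G\<close> is of order \<open>o(\<bar>t - t0\<bar>)\<close> on the axis by
  differentiability and of order \<open>\<bar>z - t0\<bar>\<close> in the half-plane by the
  Lipschitz bound. The square argument interpolates between the two: \<open>G\<close> is
  \<open>o(y)\<close> at height \<open>y\<close> inside a cone, and Cauchy's estimate turns this
  into \<open>deriv G\<close> tending to 0.\<close>

lemma nontangential_limit_derivative:
  assumes holo: "F holomorphic_on upper_half_plane"
    and lip: "M-lipschitz_on {z. Im z \<ge> 0} F"
    and der: "((\<lambda>t. F (complex_of_real t)) has_vector_derivative a) (at t0)"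
  shows "nontangential_limit (deriv F) t0 a"
proof -
  define G where "G z = F z - F (of_real t0) - a * (z - of_real t0)" for z
  define M' where "M' = M + cmod a"
  have M: "0 \<le> M" using lipschitz_on_nonneg[OF lip] .
  have holG: "G holomorphic_on upper_half_plane"
    unfolding G_def by (intro holomorphic_intros holo)
  have contG: "continuous_on {z. Im z \<ge> 0} G"
    unfolding G_def by (intro continuous_intros lipschitz_on_continuous_on[OF lip])
  have G_le: "cmod (G z) \<le> M' * cmod (z - of_real t0)" if "Im z \<ge> 0" for z
  proof -
    have "cmod (G z) \<le> cmod (F z - F (of_real t0)) + cmod (a * (z - of_real t0))"
      unfolding G_def by (rule norm_triangle_ineq4)
    also have "cmod (F z - F (of_real t0)) \<le> M * cmod (z - of_real t0)"
      using lipschitz_onD[OF lip, of z "of_real t0"] that by (simp add: dist_norm)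
    finally show ?thesis by (simp add: M'_def norm_mult distrib_right)
  qed
  have M': "0 \<le> M'" using M by (simp add: M'_def)
  show ?thesis unfolding nontangential_limit_def
  proof (intro allI impI)
    fix c :: real assume c: "c > 0"
    \<comment> \<open>A point \<open>w\<close> within \<open>y / 2\<close> of \<open>z\<close> is
      within \<open>(c + 2) * y\<close> of \<open>t0\<close>, and the square argument at
      \<open>w\<close> looks a further \<open>2 * Im w \<le> 3 * y\<close> away.\<close>
    define C where "C = c + 5"
    have C: "C > 0" using c by (simp add: C_def)
    show "(deriv F \<longlongrightarrow> a) (at (complex_of_real t0) within {z. 0 < Im z \<and> \<bar>Re z - t0\<bar> < c * Im z})"
      unfolding Lim_within
    proof (intro allI impI)
      fix e :: real assume e: "e > 0"
      \<comment> \<open>so that the bound \<open>\<eta> M'\<^sup>3 (C y)\<^sup>4\<close> of the rotation argument is at most \<open>(e y / 4)\<^sup>4\<close>\<close>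
      define \<eta> where "\<eta> = (e / (4 * C)) ^ 4 / (M' ^ 3 + 1)"
      have \<eta>: "\<eta> > 0" using e C M' by (auto simp: \<eta>_def intro!: divide_pos_pos add_nonneg_pos)
      have \<eta>M: "\<eta> * M' ^ 3 \<le> (e / (4 * C)) ^ 4"
      proof -
        have "\<eta> * M' ^ 3 \<le> \<eta> * (M' ^ 3 + 1)" using \<eta> by simp
        also have "\<dots> = (e / (4 * C)) ^ 4"
          using M' zero_le_power[of M' 3] unfolding \<eta>_def by (simp add: add_nonneg_eq_0_iff)
        finally show ?thesis .
      qed
      obtain \<delta> where \<delta>: "\<delta> > 0" and small: "\<And>t::real. \<bar>t - t0\<bar> < \<delta> \<Longrightarrow> cmod (G (of_real t)) \<le> \<eta> * \<bar>t - t0\<bar>"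
      proof -
        have "\<exists>d>0. \<forall>y. norm (y - t0) < d \<longrightarrow>
             norm (F (of_real y) - F (of_real t0) - (y - t0) *\<^sub>R a) \<le> \<eta> * norm (y - t0)"
          using der \<eta> unfolding has_vector_derivative_def has_derivative_at_alt by blast
        then show ?thesis using that
          by (auto simp: G_def scaleR_conv_of_real mult.commute)
      qed
      show "\<exists>d>0. \<forall>z\<in>{z. 0 < Im z \<and> \<bar>Re z - t0\<bar> < c * Im z}. 0 < dist z (of_real t0) \<and> dist z (of_real t0) < d \<longrightarrow> dist (deriv F z) a < e"
      proof (intro exI[of _ "\<delta> / C"] conjI ballI impI)
        fix z assume z: "z \<in> {z. 0 < Im z \<and> \<bar>Re z - t0\<bar> < c * Im z}"
          and dz: "0 < dist z (of_real t0) \<and> dist z (of_real t0) < \<delta> / C"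
        define y where "y = Im z"
        have y: "y > 0" and rez: "\<bar>Re z - t0\<bar> < c * y" using z by (auto simp: y_def)
        have "y \<le> dist z (of_real t0)"
          using abs_Im_le_cmod[of "z - of_real t0"] y by (simp add: dist_norm y_def)
        then have "C * y < \<delta>" using dz C order.strict_trans1[OF mult_left_mono[of y _ C]]
          by (auto simp: field_simps)
        have G4: "cmod (G w) \<le> e * y / 4" if w: "cmod (w - z) \<le> y / 2" for w
        proof -
          have imw: "y / 2 \<le> Im w" "Im w \<le> 3 * y / 2"
            using abs_Im_le_cmod[of "w - z"] w by (auto simp: y_def abs_le_iff)
          have rew: "\<bar>Re w - Re z\<bar> \<le> y / 2"
            using abs_Re_le_cmod[of "w - z"] w by simp
          have near: "cmod (v - of_real t0) \<le> C * y" if "cmod (v - w) \<le> 2 * Im w" for v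
          proof -
            have "cmod (w - of_real t0) \<le> \<bar>Re w - t0\<bar> + \<bar>Im w\<bar>"
              using cmod_le[of "w - of_real t0"] by simp
            also have "\<dots> \<le> (c + 2) * y" using imw rew rez unfolding distrib_right by linarith
            finally have "cmod (v - of_real t0) \<le> 3 * y + (c + 2) * y"
              using norm_triangle_ineq[of "v - w" "w - of_real t0"] that imw by simp
            then show ?thesis by (simp add: C_def algebra_simps)
          qed
          have "cmod (G w) ^ 4 \<le> (\<eta> * (C * y)) * (M' * (C * y)) ^ 3"
          proof (rule square_four_rotations_bound[OF holG contG])
            show "0 < Im w" using imw y by linarith
            fix v assume "0 \<le> Im v" "cmod (v - w) \<le> 2 * Im w"
            then show "cmod (G v) \<le> M' * (C * y)"
              using G_le[of v] near[of v] M' mult_left_mono order_trans by blast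
          next
            fix t :: real assume t: "cmod (of_real t - w) \<le> 2 * Im w"
            have "\<bar>t - t0\<bar> \<le> C * y" using near[OF t] by (metis norm_of_real of_real_diff)
            then show "cmod (G (of_real t)) \<le> \<eta> * (C * y)"
              using small[of t] \<open>C * y < \<delta>\<close> \<eta> by (smt (verit) mult_left_mono)
          qed
          also have "\<dots> = \<eta> * M' ^ 3 * (C * y) ^ 4"
            by (simp add: power_mult_distrib eval_nat_numeral)
          also have "\<dots> \<le> (e / (4 * C)) ^ 4 * (C * y) ^ 4"
            by (rule mult_right_mono[OF \<eta>M]) simp
          also have "\<dots> = (e * y / 4) ^ 4" using C by (simp add: power_mult_distrib[symmetric])
          finally have "cmod (G w) ^ Suc 3 \<le> (e * y / 4) ^ Suc 3" by simp
          then show ?thesis by (rule power_le_imp_le_base) (use e y in auto)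
        qed
        have sub: "cball z (y / 2) \<subseteq> upper_half_plane"
        proof
          fix w assume "w \<in> cball z (y / 2)"
          then have "\<bar>Im (w - z)\<bar> \<le> y / 2"
            using abs_Im_le_cmod[of "w - z"] by (simp add: dist_norm norm_minus_commute)
          then show "w \<in> upper_half_plane"
            using y unfolding upper_half_plane_def y_def mem_Collect_eq minus_complex.sel by linarith
        qed
        \<comment> \<open>The disc of radius \<open>y / 2\<close> still lies in the half-plane, and
          the estimate comes out as \<open>e / 2\<close>, strictly below the required
          \<open>e\<close>.\<close>
        have "norm ((deriv ^^ 1) G z) \<le> fact 1 * (e * y / 4) / (y / 2) ^ 1"
        proof (rule Cauchy_inequality)
          show "G holomorphic_on ball z (y / 2)"
            using holG by (rule holomorphic_on_subset) (use sub ball_subset_cball in blast)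
          show "continuous_on (cball z (y / 2)) G"
            using holomorphic_on_imp_continuous_on[OF holG] sub continuous_on_subset by blast
          show "cmod (G w) \<le> e * y / 4" if "cmod (z - w) = y / 2" for w
            using that by (intro G4) (simp add: norm_minus_commute)
        qed (use y in auto)
        then have "cmod (deriv G z) \<le> e / 2" using y by (simp add: field_simps)
        moreover have "deriv G z = deriv F z - a"
        proof -
          have "F field_differentiable at z"
            using holo open_upper_half_plane z holomorphic_on_imp_differentiable_at
            by (auto simp: upper_half_plane_def)
          then have "(F has_field_derivative deriv F z) (at z)" by (simp add: field_differentiable_derivI)
          then have "(G has_field_derivative deriv F z - a) (at z)"
            unfolding G_def by (auto intro!: derivative_eq_intros)
          then show ?thesis by (rule DERIV_imp_deriv)
        qed
        ultimately show "dist (deriv F z) a < e" using e by (simp add: dist_norm)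
      qed (use \<delta> C in auto)
    qed
  qed
qed

text \<open>A primitive of a function bounded by \<open>M\<close> on a convex domain is
  \<open>M\<close>-Lipschitz and therefore extends to the closed half-plane. Where its trace on the
  axis is differentiable, the derivative of the extension, which is \<gamma>, has a nontangential
  limit.\<close>

lemma Fatou_nontangential:
  assumes holo: "\<gamma> holomorphic_on upper_half_plane" and bdd: "bounded (\<gamma> ` upper_half_plane)"
  obtains N where "negligible N" "\<And>t. t \<notin> N \<Longrightarrow> \<exists>w. nontangential_limit \<gamma> t w"
proof -
  obtain M where M: "\<And>z. z \<in> upper_half_plane \<Longrightarrow> cmod (\<gamma> z) \<le> M"
    using bdd by (auto simp: bounded_iff)
  then have M0: "0 \<le> M"
    using order_trans[OF norm_ge_zero M[of "\<i>"]] by (simp add: upper_half_plane_def)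
  obtain F where F: "\<And>z. z \<in> upper_half_plane \<Longrightarrow> (F has_field_derivative \<gamma> z) (at z within upper_half_plane)"
    using holomorphic_convex_primitive'[OF convex_upper_half_plane open_upper_half_plane holo] by blast
  have lipF: "M-lipschitz_on upper_half_plane F"
    by (rule lipschitz_onI)
      (use field_differentiable_bound[OF convex_upper_half_plane F M] M0 in \<open>auto simp: dist_norm\<close>)
  from lipschitz_extend_closure[OF lipF]
  obtain g where g: "M-lipschitz_on (closure upper_half_plane) g \<and> (\<forall>z\<in>upper_half_plane. g z = F z)"
    by (rule exE)
  have lip: "M-lipschitz_on {z. Im z \<ge> 0} g"
    using conjunct1[OF g] by (simp only: closure_upper_half_plane)
  have dg: "(g has_field_derivative \<gamma> z) (at z)" if "z \<in> upper_half_plane" for z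
  proof -
    have "(F has_field_derivative \<gamma> z) (at z)"
      using F[OF that] unfolding at_within_open[OF that open_upper_half_plane] .
    then show ?thesis
      by (rule has_field_derivative_transform_within_open[OF _ open_upper_half_plane that]) (use g in simp)
  qed
  have holg: "g holomorphic_on upper_half_plane"
    using dg by (auto simp: holomorphic_on_def field_differentiable_def intro: has_field_derivative_at_within)
  have "M-lipschitz_on UNIV (\<lambda>t. g (complex_of_real t))"
    by (rule lipschitz_onI) (use lipschitz_onD[OF lip, of "of_real _" "of_real _"] M0 in \<open>auto simp: dist_of_real\<close>)
  then obtain N where N: "negligible N"
      "\<And>t. t \<notin> N \<Longrightarrow> \<exists>a. ((\<lambda>t. g (complex_of_real t)) has_vector_derivative a) (at t)"
    using lipschitz_complex_AE_differentiable by blast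
  show ?thesis
  proof (rule that[OF N(1)])
    fix t assume "t \<notin> N"
    then obtain a where "((\<lambda>t. g (complex_of_real t)) has_vector_derivative a) (at t)" using N(2) by blast
    from nontangential_limit_derivative[OF holg lip this]
    have *: "nontangential_limit (deriv g) t a" .
    have "nontangential_limit \<gamma> t a" unfolding nontangential_limit_def
    proof (intro allI impI)
      fix c :: real assume "c > 0"
      then have "(deriv g \<longlongrightarrow> a) (at (of_real t) within {z. 0 < Im z \<and> \<bar>Re z - t\<bar> < c * Im z})"
        using * by (auto simp: nontangential_limit_def)
      then show "(\<gamma> \<longlongrightarrow> a) (at (of_real t) within {z. 0 < Im z \<and> \<bar>Re z - t\<bar> < c * Im z})"
        by (rule Lim_transform_eventually)
          (auto simp: eventually_at_filter DERIV_imp_deriv[OF dg] upper_half_plane_def)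
    qed
    then show "\<exists>w. nontangential_limit \<gamma> t w" by blast
  qed
qed

lemma nontangential_limit_vertical:
  assumes "nontangential_limit \<gamma> t w"
  shows "((\<lambda>e. \<gamma> (Complex t e)) \<longlongrightarrow> w) (at_right 0)"
proof -
  have "(\<gamma> \<longlongrightarrow> w) (at (complex_of_real t) within {z. Im z > 0 \<and> \<bar>Re z - t\<bar> < 1 * Im z})"
    using assms zero_less_one unfolding nontangential_limit_def by blast
  moreover have "filterlim (\<lambda>e. Complex t e) (at (complex_of_real t) within {z. Im z > 0 \<and> \<bar>Re z - t\<bar> < 1 * Im z}) (at_right 0)"
    unfolding filterlim_at
  proof
    have "((\<lambda>e. Complex t e) \<longlongrightarrow> Complex t 0) (at_right 0)"
      by (intro tendsto_intros)
    then show "((\<lambda>e. Complex t e) \<longlongrightarrow> complex_of_real t) (at_right 0)"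
      by (simp add: complex_of_real_def)
    show "\<forall>\<^sub>F e in at_right 0. Complex t e \<in> {z. Im z > 0 \<and> \<bar>Re z - t\<bar> < 1 * Im z} \<and> Complex t e \<noteq> complex_of_real t"
      using eventually_at_right_less[of "0::real"] by eventually_elim (auto simp: complex_eq_iff)
  qed
  ultimately show ?thesis by (rule filterlim_compose)
qed

lemma boundary_value_eqI:
  assumes "nontangential_limit \<gamma> t w"
  shows "boundary_value \<gamma> t = w"
  unfolding boundary_value_def
proof (rule the_equality)
  show "nontangential_limit \<gamma> t w" by fact
  fix v assume "nontangential_limit \<gamma> t v"
  from tendsto_unique[OF _ nontangential_limit_vertical[OF this] nontangential_limit_vertical[OF assms]]
  show "v = w" by simp
qed

lemma AE_boundary_value:
  assumes "\<gamma> holomorphic_on upper_half_plane" and "bounded (\<gamma> ` upper_half_plane)"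
  shows "AE t in lebesgue. nontangential_limit \<gamma> t (boundary_value \<gamma> t)"
proof -
  obtain N where "negligible N" "\<And>t. t \<notin> N \<Longrightarrow> \<exists>w. nontangential_limit \<gamma> t w"
    using Fatou_nontangential[OF assms] by blast
  then show ?thesis
    by (intro AE_I'[of N]) (auto simp: negligible_iff_null_sets dest: boundary_value_eqI)
qed

section \<open>Cauchy and Schwarz integrals over the real line\<close>

lemma integrable_inverse_1_plus_square_lborel: "integrable lborel (\<lambda>t::real. inverse (1 + t\<^sup>2))"
  using integrable_inverse_1_plus_square by (simp add: set_integrable_def einterval_eq)

lemma resolvent_kernel_bound:
  fixes \<zeta> w :: complex
  assumes "0 < y" "y \<le> cmod (\<zeta> - w)"
  shows "1 + cmod \<zeta> \<le> ((1 + cmod w) / y + 1) * cmod (\<zeta> - w)"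
proof -
  have "cmod \<zeta> \<le> cmod w + cmod (\<zeta> - w)" by (metis norm_triangle_sub)
  moreover have "1 + cmod w \<le> (1 + cmod w) / y * cmod (\<zeta> - w)"
    using assms mult_left_mono[OF assms(2), of "1 + cmod w"] by (simp add: field_simps)
  ultimately show ?thesis by (simp add: distrib_right)
qed

lemma resolvent_kernel_bound_inverse:
  fixes \<zeta> w :: complex
  assumes "0 < y" "y \<le> cmod (\<zeta> - w)"
  shows "1 / cmod (\<zeta> - w) \<le> ((1 + cmod w) / y + 1) / (1 + cmod \<zeta>)"
proof -
  have "0 < cmod (\<zeta> - w)" using assms by linarith
  then show ?thesis
    using resolvent_kernel_bound[OF assms] add_pos_nonneg[OF zero_less_one norm_ge_zero[of \<zeta>]]
    by (simp add: pos_le_divide_eq pos_divide_le_eq)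
qed

text \<open>Cauchy's formula on the rectangle of height \<open>R\<close> over
  \<open>[-R, R]\<close>. Holomorphy slightly below the axis allows the bottom side to run on the
  axis itself, and the decay of \<open>k\<close> makes the other three sides negligible.\<close>

lemma Cauchy_upper_half_plane:
  assumes e: "e > 0" and holo: "k holomorphic_on {z. Im z > - e}"
    and bd: "\<And>z. Im z \<ge> 0 \<Longrightarrow> cmod (k z) \<le> C / (1 + cmod z)"
    and z: "Im z > 0"
  shows "integrable lborel (\<lambda>t. k (of_real t) / (of_real t - z))"
    and "(\<integral>t. k (of_real t) / (of_real t - z) \<partial>lborel) = 2 * pi * \<i> * k z"
proof -
  define f where "f w = k w / (w - z)" for w
  have C: "0 \<le> C" using order_trans[OF norm_ge_zero bd[of 0]] by simp
  have contk: "continuous_on {z. Im z > - e} k"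
    using holo by (rule holomorphic_on_imp_continuous_on)
  have contf: "continuous_on ({w. Im w \<ge> 0} - {z}) f"
    unfolding f_def by (intro continuous_intros continuous_on_subset[OF contk]) (use e in auto)
  have contR: "continuous_on UNIV (\<lambda>t. f (complex_of_real t))"
    by (rule continuous_on_compose2[OF contf]) (use z in \<open>auto intro!: continuous_intros\<close>)
  have meas[measurable]: "(\<lambda>t. f (complex_of_real t)) \<in> borel_measurable borel"
    using contR by (rule borel_measurable_continuous_onI)
  define K where "K = C * ((1 + cmod z) / Im z + 1)"
  have fbd: "cmod (f (of_real t)) \<le> K * inverse (1 + t\<^sup>2)" for t
  proof -
    have "Im z \<le> cmod (complex_of_real t - z)"
      using abs_Im_le_cmod[of "complex_of_real t - z"] by simp
    from resolvent_kernel_bound_inverse[OF z this]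
    have "cmod (k (of_real t)) * (1 / cmod (of_real t - z))
        \<le> C / (1 + \<bar>t\<bar>) * (((1 + cmod z) / Im z + 1) / (1 + \<bar>t\<bar>))"
      using bd[of "of_real t"] C z by (intro mult_mono) auto
    then have "cmod (f (of_real t)) \<le> K / (1 + \<bar>t\<bar>)\<^sup>2"
      by (simp add: f_def norm_divide K_def power2_eq_square)
    also have "\<dots> \<le> K / (1 + t\<^sup>2)"
    proof (rule divide_left_mono)
      show "1 + t\<^sup>2 \<le> (1 + \<bar>t\<bar>)\<^sup>2" by (simp add: power2_sum)
      show "0 \<le> K" unfolding K_def using C z by (intro mult_nonneg_nonneg add_nonneg_nonneg) auto
    qed (intro mult_pos_pos zero_less_power; simp add: add_pos_nonneg)
    finally show ?thesis by (simp add: divide_inverse)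
  qed
  have intg: "integrable lborel (\<lambda>t. f (complex_of_real t))"
    by (rule Bochner_Integration.integrable_bound[of _ "\<lambda>t. K * inverse (1 + t\<^sup>2)"])
       (use fbd in \<open>auto intro!: integrable_inverse_1_plus_square_lborel AE_I2 order_trans[OF fbd]\<close>)
  then show "integrable lborel (\<lambda>t. k (of_real t) / (of_real t - z))"
    unfolding f_def .
  \<comment> \<open>Three sides of length at most \<open>2 * R\<close> each. There \<open>k\<close>
    is at most \<open>C / R\<close>, and \<open>R > 2 * cmod z\<close> keeps the distance to
    \<open>z\<close> at least \<open>R / 2\<close>.\<close>
  have rect: "cmod (integral {-R..R} (\<lambda>t. f (complex_of_real t)) - 2 * pi * \<i> * k z) \<le> 12 * C / R"
    if R: "R > 2 * cmod z" for R
  proof -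
    have R0: "R > 0" using R norm_ge_zero[of z] by linarith
    define a1 a2 a3 a4 where "a1 = Complex (-R) 0" and "a2 = Complex R 0"
      and "a3 = Complex R R" and "a4 = Complex (-R) R"
    let ?l1 = "linepath a1 a2" and ?l2 = "linepath a2 a3" and ?l3 = "linepath a3 a4" and ?l4 = "linepath a4 a1"
    have rp: "rectpath a1 a3 = ?l1 +++ ?l2 +++ ?l3 +++ ?l4"
      by (simp add: rectpath_def Let_def a1_def a2_def a3_def a4_def)
    have zb: "z \<in> box a1 a3"
      using z R abs_Re_le_cmod[of z] abs_Im_le_cmod[of z] by (auto simp: a1_def a3_def in_box_complex_iff)
    have pim: "path_image (rectpath a1 a3) \<subseteq> {z. Im z \<ge> 0} - {z}"
    proof -
      have "path_image (rectpath a1 a3) = cbox a1 a3 - box a1 a3"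
        by (rule path_image_rectpath_cbox_minus_box) (use R0 in \<open>simp_all add: a1_def a3_def\<close>)
      moreover have "cbox a1 a3 \<subseteq> {z. Im z \<ge> 0}"
        by (auto simp: in_cbox_complex_iff a1_def a3_def)
      ultimately show ?thesis using zb by blast
    qed
    have "(f has_contour_integral (2*pi * \<i> * winding_number (rectpath a1 a3) z * k z)) (rectpath a1 a3)"
      unfolding f_def
    proof (rule Cauchy_integral_formula_convex_simple[OF _ holo])
      show "convex {z. - e < Im z}" by (rule convex_halfspace_Im_gt)
      have "open {z. - e < Im z}" by (rule open_halfspace_Im_gt)
      then show "z \<in> interior {z. - e < Im z}" using z e by (simp add: interior_open)
      show "path_image (rectpath a1 a3) \<subseteq> {z. - e < Im z} - {z}" using pim e by auto
    qed auto
    then have ci: "(f has_contour_integral (2*pi * \<i> * k z)) (rectpath a1 a3)"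
      using winding_number_rectpath[OF zb] by simp
    then have "f contour_integrable_on (rectpath a1 a3)" by (rule has_contour_integral_integrable)
    then have ints: "f contour_integrable_on ?l1" "f contour_integrable_on ?l2"
      "f contour_integrable_on ?l3" "f contour_integrable_on ?l4"
      by (auto simp: rp)
    have "contour_integral (rectpath a1 a3) f = 2*pi * \<i> * k z"
      using ci by (rule contour_integral_unique)
    then have sum: "contour_integral ?l1 f + (contour_integral ?l2 f + (contour_integral ?l3 f + contour_integral ?l4 f))
        = 2*pi * \<i> * k z"
      using ints by (simp add: rp)
    have far: "cmod (f w) \<le> 2 * C / R\<^sup>2" if "cmod w \<ge> R" "Im w \<ge> 0" for w
    proof -
      have "cmod (k w) \<le> C / R"
        using bd[OF that(2)] C R0 that(1) by (smt (verit) divide_left_mono mult_pos_pos)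
      moreover have d: "R / 2 \<le> cmod (w - z)"
        using norm_triangle_ineq2[of w z] that(1) R by linarith
      ultimately have "cmod (k w) / cmod (w - z) \<le> (C / R) / (R / 2)"
        using R0 C by (intro frac_le) auto
      then show ?thesis by (simp add: f_def norm_divide power2_eq_square mult.commute)
    qed
    have sides: "cmod w \<ge> R \<and> Im w \<ge> 0"
      if "w \<in> closed_segment a2 a3 \<union> closed_segment a3 a4 \<union> closed_segment a4 a1" for w
    proof -
      have "(\<bar>Re w\<bar> = R \<or> \<bar>Im w\<bar> = R) \<and> Im w \<ge> 0"
        using that R0 by (auto simp: a1_def a2_def a3_def a4_def
             closed_segment_same_Re closed_segment_same_Im closed_segment_eq_real_ivl split: if_splits)
      then show ?thesis using abs_Re_le_cmod[of w] abs_Im_le_cmod[of w] by auto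
    qed
    have l: "cmod (contour_integral (linepath p q) f) \<le> 2 * C / R\<^sup>2 * (2 * R)"
      if "f contour_integrable_on linepath p q" "closed_segment p q \<subseteq> closed_segment a2 a3 \<union> closed_segment a3 a4 \<union> closed_segment a4 a1"
        "cmod (q - p) \<le> 2 * R" for p q
    proof -
      have "cmod (contour_integral (linepath p q) f) \<le> 2 * C / R\<^sup>2 * cmod (q - p)"
        by (rule contour_integral_bound_linepath[OF that(1)]) (use C far sides that(2) in auto)
      also have "\<dots> \<le> 2 * C / R\<^sup>2 * (2 * R)"
        using that(3) C by (intro mult_left_mono) auto
      finally show ?thesis .
    qed
    have seg: "a3 - a2 = Complex 0 R" "a4 - a3 = Complex (-2 * R) 0" "a1 - a4 = Complex 0 (- R)"
      by (auto simp: a1_def a2_def a3_def a4_def complex_eq_iff)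
    have "cmod (a3 - a2) \<le> 2 * R" "cmod (a4 - a3) \<le> 2 * R" "cmod (a1 - a4) \<le> 2 * R"
      unfolding seg using R0 cmod_le[of "Complex 0 R"] cmod_le[of "Complex (-2 * R) 0"] cmod_le[of "Complex 0 (- R)"]
      by auto
    with l[OF ints(2) Un_upper1[THEN order_trans[OF _ Un_upper1]]]
      l[OF ints(3) Un_upper2[THEN order_trans[OF _ Un_upper1]]] l[OF ints(4) Un_upper2]
    have "cmod (contour_integral ?l2 f) + (cmod (contour_integral ?l3 f) + cmod (contour_integral ?l4 f)) \<le> 3 * (2 * C / R\<^sup>2 * (2 * R))"
      by linarith
    moreover have "3 * (2 * C / R\<^sup>2 * (2 * R)) = 12 * C / R"
      using R0 by (simp add: power2_eq_square)
    moreover have l1: "contour_integral ?l1 f = integral {-R..R} (\<lambda>t. f (complex_of_real t))"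
      using R0 by (subst contour_integral_linepath_Reals_eq) (auto simp: a1_def a2_def complex_is_Real_iff)
    moreover have eq: "integral {-R..R} (\<lambda>t. f (complex_of_real t)) - 2 * pi * \<i> * k z
        = - (contour_integral ?l2 f + (contour_integral ?l3 f + contour_integral ?l4 f))"
      unfolding l1[symmetric] using sum by (simp add: algebra_simps)
    ultimately show ?thesis
      unfolding eq norm_minus_cancel
      using norm_triangle_ineq[of "contour_integral ?l2 f" "contour_integral ?l3 f + contour_integral ?l4 f"]
        norm_triangle_ineq[of "contour_integral ?l3 f" "contour_integral ?l4 f"]
      by linarith
  qed
  have "(\<lambda>n. \<integral>t. indicator {-real n..real n} t *\<^sub>R f (complex_of_real t) \<partial>lborel)
      \<longlonglongrightarrow> (\<integral>t. f (complex_of_real t) \<partial>lborel)"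
  proof (rule integral_dominated_convergence[where w = "\<lambda>t. cmod (f (complex_of_real t))"])
    show "AE t in lborel. (\<lambda>n. indicator {- real n..real n} t *\<^sub>R f (complex_of_real t))
        \<longlonglongrightarrow> f (complex_of_real t)"
    proof (rule AE_I2)
      fix t :: real
      have "\<forall>\<^sub>F n in sequentially. \<bar>t\<bar> \<le> real n"
        using filterlim_real_sequentially by (simp add: filterlim_at_top)
      then show "(\<lambda>n. indicator {- real n..real n} t *\<^sub>R f (complex_of_real t)) \<longlonglongrightarrow> f (complex_of_real t)"
      proof (intro tendsto_eventually, eventually_elim)
        case (elim n)
        then show ?case by (auto simp: indicator_def abs_le_iff)
      qed
    qed
  qed (use intg in \<open>auto simp: indicator_def intro!: AE_I2 integrable_norm\<close>)
  moreover have "(\<integral>t. indicator {-real n..real n} t *\<^sub>R f (complex_of_real t) \<partial>lborel)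
      = integral {-real n..real n} (\<lambda>t. f (complex_of_real t))" for n
  proof -
    have "set_integrable lborel {-real n..real n} (\<lambda>t. f (complex_of_real t))"
      unfolding set_integrable_def using integrable_mult_indicator[OF _ intg] by auto
    from set_borel_integral_eq_integral(2)[OF this] show ?thesis
      by (simp add: set_lebesgue_integral_def)
  qed
  ultimately have lim1: "(\<lambda>n. integral {-real n..real n} (\<lambda>t. f (complex_of_real t)))
      \<longlonglongrightarrow> (\<integral>t. f (complex_of_real t) \<partial>lborel)" by simp
  have lim2: "(\<lambda>n. integral {-real n..real n} (\<lambda>t. f (complex_of_real t))) \<longlonglongrightarrow> 2 * pi * \<i> * k z"
  proof (rule LIM_zero_cancel, rule Lim_null_comparison)
    show "\<forall>\<^sub>F n in sequentially. cmod (integral {- real n..real n} (\<lambda>t. f (complex_of_real t))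
        - 2 * pi * \<i> * k z) \<le> 12 * C / real n"
      using eventually_compose_filterlim[OF eventually_gt_at_top[of "2 * cmod z"] filterlim_real_sequentially]
      by eventually_elim (rule rect)
    show "(\<lambda>n. 12 * C / real n) \<longlonglongrightarrow> 0" by (rule lim_const_over_n)
  qed
  from LIMSEQ_unique[OF lim1 lim2]
  show "(\<integral>t. k (of_real t) / (of_real t - z) \<partial>lborel) = 2 * pi * \<i> * k z"
    unfolding f_def .
qed

section \<open>The Schwarz formula and a criterion for outer functions\<close>

definition Schwarz_kernel :: "complex \<Rightarrow> real \<Rightarrow> complex" where
  "Schwarz_kernel w t = 1 / (w - of_real t) + of_real (t / (1 + t\<^sup>2))"

text \<open>Partial fractions: a term with simple poles at \<open>w\<close> and
  \<open>- \<i>\<close>, plus the Poisson kernel of \<i>. Both decay quadratically, which suffices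
  against a bounded function, and each is accessible to Cauchy's formula. Times
  \<open>\<i> / pi\<close> the kernel has the Poisson kernel of \<open>w\<close> as its real
  part.\<close>

lemma Schwarz_kernel_eq:
  assumes "Im w \<noteq> 0"
  shows "Schwarz_kernel w t * a = - (w + \<i>) * (a / ((of_real t - w) * (of_real t - (-\<i>))))
      + \<i> * (a / of_real (1 + t\<^sup>2))"
proof -
  have ne: "complex_of_real t - w \<noteq> 0" "w - of_real t \<noteq> 0" "complex_of_real t + \<i> \<noteq> 0" "complex_of_real t - \<i> \<noteq> 0"
    using assms by (auto simp: complex_eq_iff)
  have f: "complex_of_real (1 + t\<^sup>2) = (of_real t + \<i>) * (of_real t - \<i>)"
    by (simp add: complex_eq_iff power2_eq_square)
  have "Schwarz_kernel w t = - (w + \<i>) * (1 / ((of_real t - w) * (of_real t + \<i>))) + \<i> * (1 / of_real (1 + t\<^sup>2))"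
    unfolding Schwarz_kernel_def of_real_divide f using ne
    by (simp add: divide_simps) (simp add: algebra_simps)
  then show ?thesis by (simp add: algebra_simps)
qed

context
  fixes h :: "complex \<Rightarrow> complex" and e B :: real
  assumes e: "e > 0" and holo: "h holomorphic_on {z. Im z > - e}"
    and bd: "\<And>z. Im z \<ge> 0 \<Longrightarrow> cmod (h z) \<le> B"
begin

lemma B_nonneg: "0 \<le> B"
  using order_trans[OF norm_ge_zero bd[of 0]] by simp

text \<open>The function \<open>h\<close> is only bounded. The factor with its pole below the axis
  is absorbed into it and supplies the decay that Cauchy's formula at \<open>z\<close>
  requires.\<close>

lemma Cauchy_kernel_opposite:
  assumes z: "Im z > 0" and w: "Im w < 0"
  shows "integrable lborel (\<lambda>t. h (of_real t) / ((of_real t - z) * (of_real t - w)))"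
    and "(\<integral>t. h (of_real t) / ((of_real t - z) * (of_real t - w)) \<partial>lborel) = 2 * pi * \<i> * h z / (z - w)"
proof -
  define k where "k \<zeta> = h \<zeta> / (\<zeta> - w)" for \<zeta>
  have e': "min e (- Im w) > 0" using e w by simp
  have hol: "k holomorphic_on {z. Im z > - min e (- Im w)}"
    unfolding k_def by (intro holomorphic_intros holomorphic_on_subset[OF holo]) auto
  have kb: "cmod (k \<zeta>) \<le> B * ((1 + cmod w) / (- Im w) + 1) / (1 + cmod \<zeta>)" if "Im \<zeta> \<ge> 0" for \<zeta>
  proof -
    have "- Im w \<le> cmod (\<zeta> - w)" using abs_Im_le_cmod[of "\<zeta> - w"] that by simp
    from mult_mono[OF bd[OF that] resolvent_kernel_bound_inverse[OF _ this]] w B_nonneg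
    show ?thesis by (simp add: k_def norm_divide)
  qed
  have eq: "h (of_real t) / ((of_real t - z) * (of_real t - w)) = k (of_real t) / (of_real t - z)" for t
    by (simp add: k_def mult.commute)
  show "integrable lborel (\<lambda>t. h (of_real t) / ((of_real t - z) * (of_real t - w)))"
    "(\<integral>t. h (of_real t) / ((of_real t - z) * (of_real t - w)) \<partial>lborel) = 2 * pi * \<i> * h z / (z - w)"
    unfolding eq using Cauchy_upper_half_plane[OF e' hol kb z] by (simp_all add: k_def)
qed

text \<open>No pole lies in the upper half-plane, so an artificial one is introduced: inserting
  \<open>\<zeta> - \<i>\<close> into numerator and denominator gives a Cauchy integral at \<i> of a
  function that vanishes there.\<close>

lemma Cauchy_kernel_below:
  assumes a: "Im a < 0" and b: "Im b < 0"
  shows "integrable lborel (\<lambda>t. h (of_real t) / ((of_real t - a) * (of_real t - b)))"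
    and "(\<integral>t. h (of_real t) / ((of_real t - a) * (of_real t - b)) \<partial>lborel) = 0"
proof -
  define k where "k \<zeta> = h \<zeta> * (\<zeta> - \<i>) / ((\<zeta> - a) * (\<zeta> - b))" for \<zeta>
  define e' where "e' = min e (min (- Im a) (- Im b))"
  have e': "e' > 0" using e a b by (simp add: e'_def)
  have hol: "k holomorphic_on {z. Im z > - e'}"
    unfolding k_def by (intro holomorphic_intros holomorphic_on_subset[OF holo]) (auto simp: e'_def)
  define c where "c p = (1 + cmod p) / (- Im p) + 1" for p :: complex
  have c0: "0 \<le> c p" if "Im p < 0" for p
    unfolding c_def using that by (intro add_nonneg_nonneg divide_nonneg_pos) auto
  have kb: "cmod (k \<zeta>) \<le> B * c a * c b / (1 + cmod \<zeta>)" if "Im \<zeta> \<ge> 0" for \<zeta>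
  proof -
    have p: "1 + cmod \<zeta> > 0" by (rule add_pos_nonneg) auto
    have 1: "1 / cmod (\<zeta> - a) \<le> c a / (1 + cmod \<zeta>)" "1 / cmod (\<zeta> - b) \<le> c b / (1 + cmod \<zeta>)"
      using abs_Im_le_cmod[of "\<zeta> - a"] abs_Im_le_cmod[of "\<zeta> - b"] that a b
      unfolding c_def by (intro resolvent_kernel_bound_inverse; simp)+
    have "cmod (\<zeta> - \<i>) \<le> 1 + cmod \<zeta>" using norm_triangle_ineq4[of \<zeta> \<i>] by simp
    then have "cmod (h \<zeta>) * cmod (\<zeta> - \<i>) * (1 / cmod (\<zeta> - a) * (1 / cmod (\<zeta> - b)))
      \<le> B * (1 + cmod \<zeta>) * (c a / (1 + cmod \<zeta>) * (c b / (1 + cmod \<zeta>)))"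
      using c0[OF a] c0[OF b] B_nonneg p
      by (intro mult_mono bd that 1 mult_nonneg_nonneg divide_nonneg_nonneg) auto
    then show ?thesis using p by (simp add: k_def norm_divide norm_mult)
  qed
  have eq: "h (of_real t) / ((of_real t - a) * (of_real t - b)) = k (of_real t) / (of_real t - \<i>)" for t
  proof -
    have "complex_of_real t - \<i> \<noteq> 0" by (simp add: complex_eq_iff)
    then show ?thesis by (simp add: k_def)
  qed
  show "integrable lborel (\<lambda>t. h (of_real t) / ((of_real t - a) * (of_real t - b)))"
    "(\<integral>t. h (of_real t) / ((of_real t - a) * (of_real t - b)) \<partial>lborel) = 0"
    unfolding eq using Cauchy_upper_half_plane[OF e' hol kb, of \<i>] by (simp_all add: k_def)
qed

lemma Poisson_at_i:
  shows "integrable lborel (\<lambda>t. h (of_real t) / of_real (1 + t\<^sup>2))"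
    and "(\<integral>t. h (of_real t) / of_real (1 + t\<^sup>2) \<partial>lborel) = pi * h \<i>"
proof -
  have eq: "of_real (1 + t\<^sup>2) = (complex_of_real t - \<i>) * (of_real t - (-\<i>))" for t
    by (simp add: complex_eq_iff power2_eq_square)
  have "2 * pi * \<i> * h \<i> / (\<i> - (-\<i>)) = pi * h \<i>"
    by (simp add: complex_eq_iff)
  then show "integrable lborel (\<lambda>t. h (of_real t) / of_real (1 + t\<^sup>2))"
    "(\<integral>t. h (of_real t) / of_real (1 + t\<^sup>2) \<partial>lborel) = pi * h \<i>"
    unfolding eq using Cauchy_kernel_opposite[of \<i> "-\<i>"] by simp_all
qed

text \<open>Write \<open>Re h\<close> as half of \<open>h + cnj h\<close>. The integral against
  \<open>cnj h\<close> is the conjugate of the one against \<open>h\<close> with \<open>z\<close>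
  replaced by \<open>cnj z\<close>; there both poles lie below the axis, so only the Poisson term at
  \<i> survives.\<close>

lemma Schwarz_formula_closed:
  assumes z: "Im z > 0"
  shows "integrable lborel (\<lambda>t. Schwarz_kernel z t * h (of_real t))"
    and "(\<integral>t. Schwarz_kernel z t * of_real (Re (h (of_real t))) \<partial>lborel)
    = - pi * \<i> * h z - pi * of_real (Im (h \<i>))"
proof -
  define S where "S = Schwarz_kernel"
  note S = Schwarz_kernel_eq[folded S_def]
  have zc: "Im (cnj z) < 0" using z by simp
  have hbi: "has_bochner_integral lborel (\<lambda>t. S w t * h (of_real t)) (- (w + \<i>) * v + \<i> * (pi * h \<i>))"
    if "Im w \<noteq> 0" "has_bochner_integral lborel (\<lambda>t. h (of_real t) / ((of_real t - w) * (of_real t - (-\<i>)))) v" for w v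
    unfolding S[OF that(1)]
    by (intro has_bochner_integral_add has_bochner_integral_mult_right that)
       (use Poisson_at_i in \<open>simp add: has_bochner_integral_iff\<close>)
  have "z + \<i> \<noteq> 0" using z by (auto simp: complex_eq_iff)
  have "- (z + \<i>) * (2 * pi * \<i> * h z / (z - (-\<i>))) + \<i> * (pi * h \<i>) = - 2 * pi * \<i> * h z + pi * \<i> * h \<i>"
    using \<open>z + \<i> \<noteq> 0\<close> by (simp add: field_simps)
  with hbi[of z] Cauchy_kernel_opposite[OF z, of "-\<i>"] z
  have i1: "integrable lborel (\<lambda>t. S z t * h (of_real t))"
    and v1: "(\<integral>t. S z t * h (of_real t) \<partial>lborel) = - 2 * pi * \<i> * h z + pi * \<i> * h \<i>"
    by (simp_all add: has_bochner_integral_iff)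
  from hbi[of "cnj z" 0] Cauchy_kernel_below[OF zc, of "-\<i>"] z
  have i2: "integrable lborel (\<lambda>t. S (cnj z) t * h (of_real t))"
    and v2: "(\<integral>t. S (cnj z) t * h (of_real t) \<partial>lborel) = pi * \<i> * h \<i>"
    by (simp_all add: has_bochner_integral_iff)
  have S_cnj: "cnj (S (cnj z) t) = S z t" for t by (simp add: S_def Schwarz_kernel_def)
  have v3: "(\<integral>t. S z t * cnj (h (of_real t)) \<partial>lborel) = cnj (pi * \<i> * h \<i>)"
    unfolding v2[symmetric] Bochner_Integration.integral_cnj[symmetric] by (simp add: S_cnj)
  have i3: "integrable lborel (\<lambda>t. S z t * cnj (h (of_real t)))"
    using integrable_cnj[OF i2] by (simp add: S_cnj)
  have "(\<integral>t. S z t * of_real (Re (h (of_real t))) \<partial>lborel)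
     = (\<integral>t. (1/2) * (S z t * h (of_real t) + S z t * cnj (h (of_real t))) \<partial>lborel)"
    by (intro Bochner_Integration.integral_cong refl)
       (simp add: complex_add_cnj distrib_left[symmetric])
  also have "\<dots> = (1/2) * ((- 2 * pi * \<i> * h z + pi * \<i> * h \<i>) + cnj (pi * \<i> * h \<i>))"
    using i1 i3 v1 v3 by simp
  also have "\<dots> = - pi * \<i> * h z - pi * of_real (Im (h \<i>))"
    by (simp add: complex_eq_iff)
  finally show "(\<integral>t. Schwarz_kernel z t * of_real (Re (h (of_real t))) \<partial>lborel)
    = - pi * \<i> * h z - pi * of_real (Im (h \<i>))" by (simp add: S_def)
  show "integrable lborel (\<lambda>t. Schwarz_kernel z t * h (of_real t))"
    using i1 by (simp add: S_def)
qed

end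

text \<open>Boundary values are given by a description and identified only almost everywhere as
  limits. Completeness of \<open>lebesgue\<close> makes such a function measurable all the
  same.\<close>

lemma borel_measurable_lebesgue_AE_limit:
  fixes f :: "nat \<Rightarrow> real \<Rightarrow> 'b::{banach,second_countable_topology}"
  assumes f: "\<And>n. f n \<in> borel_measurable borel"
    and lim: "AE t in lebesgue. (\<lambda>n. f n t) \<longlonglongrightarrow> r t"
  shows "r \<in> borel_measurable lebesgue"
proof (rule measurableI)
  have "(\<lambda>t. lim (\<lambda>n. f n t)) \<in> borel_measurable borel"
    by (rule borel_measurable_lim_metric) (use f in auto)
  then have meas: "(\<lambda>t. lim (\<lambda>n. f n t)) \<in> borel_measurable lebesgue"
    by (intro measurable_completion) simp
  fix A :: "'b set" assume "A \<in> sets borel"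
  then have A: "(\<lambda>t. lim (\<lambda>n. f n t)) -` A \<in> sets lebesgue"
    using measurable_sets[OF meas] by simp
  have "AE t in lebesgue. t \<in> (\<lambda>t. lim (\<lambda>n. f n t)) -` A \<longleftrightarrow> t \<in> r -` A"
    using lim by eventually_elim (auto dest: limI)
  from completion.in_sets_AE[OF this A] show "r -` A \<inter> space lebesgue \<in> sets lebesgue" by simp
qed auto

text \<open>The shifts of \<open>L\<close> by \<open>\<i> / (n + 1)\<close> are holomorphic across
  the axis and share the bound \<open>B\<close>. Dominated convergence takes their Schwarz formulas
  to the boundary values.\<close>

lemma Schwarz_formula_bounded:
  assumes holo: "L holomorphic_on upper_half_plane"
    and bd: "\<And>z. z \<in> upper_half_plane \<Longrightarrow> cmod (L z) \<le> B"
    and lim: "AE t in lebesgue. ((\<lambda>e. Re (L (Complex t e))) \<longlongrightarrow> r t) (at_right 0)"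
    and z: "z \<in> upper_half_plane"
  shows "(\<integral>t. Schwarz_kernel z t * of_real (r t) \<partial>lebesgue) = - pi * \<i> * L z - pi * of_real (Im (L \<i>))"
proof -
  have z': "Im z > 0" using z by (simp add: upper_half_plane_def)
  define e where "e n = inverse (real (Suc n))" for n
  have e: "e n > 0" for n by (simp add: e_def)
  have e_lim: "e \<longlonglongrightarrow> 0" unfolding e_def by (rule LIMSEQ_inverse_real_of_nat)
  have e_right: "filterlim e (at_right 0) sequentially"
    unfolding filterlim_at using e_lim less_imp_neq[OF e, symmetric] e by auto
  define h where "h n \<zeta> = L (\<zeta> + \<i> * e n)" for n \<zeta>
  have hol: "h n holomorphic_on {z. Im z > - e n}" for n
    unfolding h_def
    by (rule holomorphic_on_compose_gen[of "\<lambda>\<zeta>. \<zeta> + \<i> * e n" _ L upper_half_plane, unfolded comp_def])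
       (use holo in \<open>auto intro!: holomorphic_intros simp: upper_half_plane_def\<close>)
  have hb: "cmod (h n \<zeta>) \<le> B" if "Im \<zeta> \<ge> 0" for n \<zeta>
    unfolding h_def using that e[of n] by (intro bd) (simp add: upper_half_plane_def add_nonneg_pos)
  have ht: "h n (of_real t) = L (Complex t (e n))" for n t
    by (simp add: h_def Complex_eq)
  have hmeas: "(\<lambda>t. Re (h n (of_real t))) \<in> borel_measurable borel" for n
  proof (rule borel_measurable_continuous_onI)
    show "continuous_on UNIV (\<lambda>t. Re (h n (of_real t)))"
      by (intro continuous_intros continuous_on_compose2[OF holomorphic_on_imp_continuous_on[OF hol[of n]]])
         (use e in auto)
  qed
  have hmeas': "(\<lambda>t. Schwarz_kernel z t * complex_of_real (Re (h n (of_real t)))) \<in> borel_measurable borel"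
    if "Schwarz_kernel z \<in> borel_measurable borel" for n
    using that measurable_compose[OF hmeas[of n] borel_measurable_of_real] by (rule borel_measurable_times)
  have lim': "AE t in lebesgue. (\<lambda>n. Re (h n (of_real t))) \<longlonglongrightarrow> r t"
    using lim by eventually_elim (auto simp: ht intro: filterlim_compose[OF _ e_right])
  have r_meas: "r \<in> borel_measurable lebesgue"
    by (rule borel_measurable_lebesgue_AE_limit[OF hmeas lim'])
  \<comment> \<open>The formula for the constant function 1 contains the integrability of the
    kernel, the source of the dominating function below.\<close>
  have K_int: "integrable lborel (Schwarz_kernel z)"
    using Schwarz_formula_closed(1)[of 1 "\<lambda>_. 1" 1, OF _ _ _ z'] by auto
  then have K_meas: "Schwarz_kernel z \<in> borel_measurable borel" by auto
  then have K_meas': "Schwarz_kernel z \<in> borel_measurable lebesgue"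
    by (intro measurable_completion) simp
  have K_int': "integrable lebesgue (Schwarz_kernel z)"
    using K_int K_meas by (subst integrable_completion) auto
  have "(\<lambda>n. \<integral>t. Schwarz_kernel z t * of_real (Re (h n (of_real t))) \<partial>lebesgue)
     \<longlonglongrightarrow> (\<integral>t. Schwarz_kernel z t * of_real (r t) \<partial>lebesgue)"
  proof (rule integral_dominated_convergence[where w = "\<lambda>t. cmod (Schwarz_kernel z t) * B"])
    show "(\<lambda>t. Schwarz_kernel z t * complex_of_real (r t)) \<in> borel_measurable lebesgue"
      using K_meas' measurable_compose[OF r_meas borel_measurable_of_real] by (rule borel_measurable_times)
    show "(\<lambda>t. Schwarz_kernel z t * of_real (Re (h n (of_real t)))) \<in> borel_measurable lebesgue" for n
      using hmeas'[OF K_meas] by (intro measurable_completion) simp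
    show "integrable lebesgue (\<lambda>t. cmod (Schwarz_kernel z t) * B)"
      using K_int' by (intro integrable_mult_left integrable_norm)
    show "AE t in lebesgue. (\<lambda>n. Schwarz_kernel z t * of_real (Re (h n (of_real t))))
        \<longlonglongrightarrow> Schwarz_kernel z t * of_real (r t)"
      using lim' by eventually_elim (intro tendsto_intros)
    show "AE t in lebesgue. cmod (Schwarz_kernel z t * of_real (Re (h n (of_real t)))) \<le> cmod (Schwarz_kernel z t) * B" for n
      by (intro AE_I2) (auto simp: norm_mult intro!: mult_left_mono order_trans[OF abs_Re_le_cmod hb])
  qed
  also have "(\<lambda>n. \<integral>t. Schwarz_kernel z t * of_real (Re (h n (of_real t))) \<partial>lebesgue)
      = (\<lambda>n. - pi * \<i> * h n z - pi * of_real (Im (h n \<i>)))"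
  proof
    fix n
    have "(\<integral>t. Schwarz_kernel z t * of_real (Re (h n (of_real t))) \<partial>lebesgue)
        = (\<integral>t. Schwarz_kernel z t * of_real (Re (h n (of_real t))) \<partial>lborel)"
      using hmeas'[OF K_meas] by (intro integral_completion) simp
    also have "\<dots> = - pi * \<i> * h n z - pi * of_real (Im (h n \<i>))"
      by (rule Schwarz_formula_closed(2)[OF e hol hb z'])
    finally show "(\<integral>t. Schwarz_kernel z t * of_real (Re (h n (of_real t))) \<partial>lebesgue) = \<dots>" .
  qed
  finally have lim1: "(\<lambda>n. - pi * \<i> * h n z - pi * of_real (Im (h n \<i>)))
      \<longlonglongrightarrow> (\<integral>t. Schwarz_kernel z t * of_real (r t) \<partial>lebesgue)" .
  have hl: "(\<lambda>n. h n w) \<longlonglongrightarrow> L w" if "w \<in> upper_half_plane" for w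
  proof -
    have "isCont L w"
      using holomorphic_on_imp_continuous_on[OF holo] open_upper_half_plane that continuous_on_eq_continuous_at by blast
    moreover have "(\<lambda>n. w + \<i> * e n) \<longlonglongrightarrow> w"
      using tendsto_add[OF tendsto_const tendsto_mult[OF tendsto_const tendsto_of_real[OF e_lim]], of w "\<i>"] by simp
    ultimately show ?thesis unfolding h_def by (rule isCont_tendsto_compose)
  qed
  have "(\<lambda>n. - pi * \<i> * h n z - pi * of_real (Im (h n \<i>)))
      \<longlonglongrightarrow> - pi * \<i> * L z - pi * of_real (Im (L \<i>))"
    by (intro tendsto_intros hl z) (simp add: upper_half_plane_def)
  from LIMSEQ_unique[OF lim1 this] show ?thesis .
qed

text \<open>Values in the half-plane \<open>Re \<ge> 1\<close> admit the principal logarithm, whose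
  real part lies between 0 and \<open>ln B\<close> and whose imaginary part is at most \<pi> in
  modulus. A bounded holomorphic logarithm is recovered from its real part on the axis, and
  exponentiating gives the outer representation.\<close>

lemma bounded_outer_if_Re_ge_1:
  assumes holo: "\<gamma> holomorphic_on upper_half_plane"
    and re: "\<And>z. z \<in> upper_half_plane \<Longrightarrow> 1 \<le> Re (\<gamma> z)"
    and bd: "\<And>z. z \<in> upper_half_plane \<Longrightarrow> cmod (\<gamma> z) \<le> B"
  shows "bounded_outer \<gamma>"
proof -
  define L where "L z = Ln (\<gamma> z)" for z
  have bounded: "bounded (\<gamma> ` upper_half_plane)"
    using bd by (auto simp: bounded_iff)
  have i: "\<i> \<in> upper_half_plane" by (simp add: upper_half_plane_def)
  have nonpos: "w \<notin> \<real>\<^sub>\<le>\<^sub>0" if "1 \<le> Re w" for w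
    using that by (auto simp: complex_nonpos_Reals_iff)
  have nz: "\<gamma> z \<noteq> 0" if "z \<in> upper_half_plane" for z using re[OF that] by auto
  have ge1: "1 \<le> cmod (\<gamma> z)" if "z \<in> upper_half_plane" for z
    using re[OF that] complex_Re_le_cmod[of "\<gamma> z"] by linarith
  have holL: "L holomorphic_on upper_half_plane"
    unfolding L_def by (intro holomorphic_intros holo nonpos re)
  have Lb: "cmod (L z) \<le> ln B + pi" if z: "z \<in> upper_half_plane" for z
  proof -
    have "\<bar>Re (L z)\<bar> \<le> ln B"
      using ge1[OF z] bd[OF z] by (simp add: L_def nz[OF z] abs_of_nonneg ln_mono)
    moreover have "\<bar>Im (L z)\<bar> \<le> pi"
      using mpi_less_Im_Ln[OF nz[OF z]] Im_Ln_le_pi[OF nz[OF z]] by (simp add: L_def abs_le_iff)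
    ultimately show ?thesis using cmod_le[of "L z"] by linarith
  qed
  have lim: "AE t in lebesgue. ((\<lambda>e. Re (L (Complex t e))) \<longlongrightarrow> ln (cmod (boundary_value \<gamma> t))) (at_right 0)"
    using AE_boundary_value[OF holo bounded]
  proof eventually_elim
    case (elim t)
    have l: "((\<lambda>e. \<gamma> (Complex t e)) \<longlongrightarrow> boundary_value \<gamma> t) (at_right 0)"
      by (rule nontangential_limit_vertical[OF elim])
    have "1 \<le> Re (boundary_value \<gamma> t)"
    proof (rule tendsto_lowerbound[OF tendsto_Re[OF l]])
      show "\<forall>\<^sub>F e in at_right 0. 1 \<le> Re (\<gamma> (Complex t e))"
        using eventually_at_right_less[of "0::real"]
        by eventually_elim (rule re, simp add: upper_half_plane_def)
    qed simp
    then have "boundary_value \<gamma> t \<notin> \<real>\<^sub>\<le>\<^sub>0" "boundary_value \<gamma> t \<noteq> 0" using nonpos by auto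
    from tendsto_Re[OF tendsto_Ln[OF l this(1)]] this(2) show ?case by (simp add: L_def)
  qed
  have "\<gamma> z = exp (\<i> * of_real (Im (L \<i>))) *
          exp (\<i> / of_real pi * (\<integral>t. (1 / (z - of_real t) + of_real (t / (1 + t\<^sup>2))) *
                 of_real (ln (cmod (boundary_value \<gamma> t))) \<partial>lebesgue))"
    if z: "z \<in> upper_half_plane" for z
  proof -
    \<comment> \<open>The Schwarz integral loses the imaginary constant \<open>Im (L \<i>)\<close>,
      which becomes the phase of the outer representation.\<close>
    have "\<i> / of_real pi * (- pi * \<i> * L z - pi * of_real (Im (L \<i>))) = L z - \<i> * of_real (Im (L \<i>))"
      by (simp add: field_simps)
    then show ?thesis
      using Schwarz_formula_bounded[OF holL Lb lim z] nz[OF z]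
      by (simp add: Schwarz_kernel_def L_def flip: exp_add)
  qed
  then show ?thesis
    unfolding bounded_outer_def using holo bounded i nz by blast
qed

section \<open>Cauchy transforms of finite measures\<close>

definition cauchy_transform :: "real measure \<Rightarrow> complex \<Rightarrow> complex" where
  "cauchy_transform \<nu> z = (\<integral>t. 1 / (z - of_real t) \<partial>\<nu>)"

locale finite_borel_measure = finite_measure \<nu> for \<nu> :: "real measure" +
  assumes sets_eq [simp, measurable_cong]: "sets \<nu> = sets borel"
begin

lemma space_eq [simp]: "space \<nu> = UNIV"
  using sets_eq_imp_space_eq[OF sets_eq] by simp

lemma Im_le_dist: "\<bar>Im z\<bar> \<le> cmod (z - of_real t)"
  using abs_Im_le_cmod[of "z - of_real t"] by simp

lemma shift_nonzero: "Im z \<noteq> 0 \<Longrightarrow> z - of_real t \<noteq> 0"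
  by (auto simp: complex_eq_iff)

lemma integrable_kernel:
  assumes "Im z \<noteq> 0" shows "integrable \<nu> (\<lambda>t. 1 / (z - of_real t) ^ n)"
proof (rule integrable_const_bound[of _ "1 / \<bar>Im z\<bar> ^ n"])
  have "continuous_on UNIV (\<lambda>t. 1 / (z - of_real t) ^ n)"
    by (intro continuous_intros ballI power_not_zero shift_nonzero assms)
  then show "(\<lambda>t. 1 / (z - of_real t) ^ n) \<in> borel_measurable \<nu>"
    using borel_measurable_continuous_onI by (simp add: measurable_cong_sets[OF sets_eq refl])
  show "AE t in \<nu>. cmod (1 / (z - of_real t) ^ n) \<le> 1 / \<bar>Im z\<bar> ^ n"
  proof (rule AE_I2)
    fix t
    have "1 / cmod (z - of_real t) ^ n \<le> 1 / \<bar>Im z\<bar> ^ n"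
      using Im_le_dist[of z t] assms by (intro frac_le power_mono zero_less_power) auto
    then show "cmod (1 / (z - of_real t) ^ n) \<le> 1 / \<bar>Im z\<bar> ^ n"
      by (simp add: norm_divide norm_power)
  qed
qed

lemma integrable_kernel1: "Im z \<noteq> 0 \<Longrightarrow> integrable \<nu> (\<lambda>t. 1 / (z - of_real t))"
  using integrable_kernel[of z 1] by simp

lemma cauchy_transform_bound:
  assumes "Im z \<noteq> 0" shows "cmod (cauchy_transform \<nu> z) \<le> measure \<nu> UNIV / \<bar>Im z\<bar>"
proof -
  have "cmod (cauchy_transform \<nu> z) \<le> (\<integral>t. 1 / \<bar>Im z\<bar> \<partial>\<nu>)"
    unfolding cauchy_transform_def
  proof (rule order_trans[OF integral_norm_bound], rule integral_mono)
    show "integrable \<nu> (\<lambda>t. cmod (1 / (z - of_real t)))"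
      by (intro integrable_norm integrable_kernel1 assms)
    show "cmod (1 / (z - of_real t)) \<le> 1 / \<bar>Im z\<bar>" for t
      using Im_le_dist[of z t] assms by (simp add: norm_divide frac_le)
  qed simp
  then show ?thesis by simp
qed

lemma cauchy_transform_DERIV:
  assumes z: "Im z > 0"
  shows "(cauchy_transform \<nu> has_field_derivative - (\<integral>t. 1 / (z - of_real t) ^ 2 \<partial>\<nu>)) (at z)"
proof -
  let ?D = "\<integral>t. 1 / (z - of_real t) ^ 2 \<partial>\<nu>"
  let ?\<Phi> = "cauchy_transform \<nu>"
  \<comment> \<open>The remainder of the difference quotient has kernel
    \<open>1 / ((w - t) * (z - t)\<^sup>2)\<close>. For \<open>w\<close> within
    \<open>Im z / 2\<close> of \<open>z\<close> one has \<open>Im w \<ge> Im z / 2\<close>, hence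
    the bound \<open>2 / Im z ^ 3\<close>.\<close>
  define K where "K = measure \<nu> UNIV * (2 / Im z ^ 3)"
  have bound: "cmod ((?\<Phi> w - ?\<Phi> z) / (w - z) - (- ?D)) \<le> K * cmod (w - z)"
    if w: "w \<noteq> z" "cmod (w - z) < Im z / 2" for w
  proof -
    have imw: "Im w \<ge> Im z / 2" using abs_Im_le_cmod[of "w - z"] w(2) by simp
    then have w0: "Im w > 0" using z by linarith
    have ne: "w - of_real t \<noteq> 0" "z - of_real t \<noteq> 0" for t using z w0 by (auto simp: complex_eq_iff)
    have alg: "1 / (w - of_real t) - 1 / (z - of_real t) + (w - z) * (1 / (z - of_real t) ^ 2)
        = (w - z)\<^sup>2 * (1 / ((w - of_real t) * (z - of_real t)\<^sup>2))" for t
      using ne[of t] by (simp add: divide_simps power2_eq_square) (simp add: algebra_simps)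
    have int: "integrable \<nu> (\<lambda>t. 1 / (w - of_real t))" "integrable \<nu> (\<lambda>t. 1 / (z - of_real t))"
      "integrable \<nu> (\<lambda>t. (w - z) * (1 / (z - of_real t) ^ 2))"
      using z w0 by (auto intro!: integrable_kernel1 integrable_kernel integrable_mult_right simp del: times_divide_eq_right)
    have "?\<Phi> w - ?\<Phi> z + (w - z) * ?D
       = (\<integral>t. 1 / (w - of_real t) - 1 / (z - of_real t) + (w - z) * (1 / (z - of_real t) ^ 2) \<partial>\<nu>)"
      unfolding cauchy_transform_def
      by (subst Bochner_Integration.integral_add[OF Bochner_Integration.integrable_diff[OF int(1,2)] int(3)],
          subst Bochner_Integration.integral_diff[OF int(1,2)], subst integral_mult_right_zero, rule refl)
    then have eq: "?\<Phi> w - ?\<Phi> z + (w - z) * ?D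
       = (\<integral>t. (w - z)\<^sup>2 * (1 / ((w - of_real t) * (z - of_real t)\<^sup>2)) \<partial>\<nu>)"
      by (simp only: alg)
    have int2: "integrable \<nu> (\<lambda>t. (w - z)\<^sup>2 * (1 / ((w - of_real t) * (z - of_real t)\<^sup>2)))"
      unfolding alg[symmetric] by (intro Bochner_Integration.integrable_add Bochner_Integration.integrable_diff int)
    have "cmod (?\<Phi> w - ?\<Phi> z + (w - z) * ?D) \<le> (\<integral>t. (cmod (w - z))\<^sup>2 * (2 / Im z ^ 3) \<partial>\<nu>)"
      unfolding eq
    proof (rule order_trans[OF integral_norm_bound], rule integral_mono)
      show "integrable \<nu> (\<lambda>t. cmod ((w - z)\<^sup>2 * (1 / ((w - of_real t) * (z - of_real t)\<^sup>2))))"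
        by (rule integrable_norm[OF int2])
      fix t
      have "Im z / 2 * (Im z)\<^sup>2 \<le> cmod (w - of_real t) * (cmod (z - of_real t))\<^sup>2"
        using Im_le_dist[of w t] Im_le_dist[of z t] imw z w0 by (intro mult_mono power_mono) auto
      then have "1 / (cmod (w - of_real t) * (cmod (z - of_real t))\<^sup>2) \<le> 1 / (Im z / 2 * (Im z)\<^sup>2)"
        using z ne[of t, folded zero_less_norm_iff] by (intro divide_left_mono mult_pos_pos zero_less_power) auto
      also have "\<dots> = 2 / Im z ^ 3" using z by (simp add: power2_eq_square power3_eq_cube)
      finally show "cmod ((w - z)\<^sup>2 * (1 / ((w - of_real t) * (z - of_real t)\<^sup>2))) \<le> (cmod (w - z))\<^sup>2 * (2 / Im z ^ 3)"
        unfolding norm_mult norm_divide norm_power norm_one by (intro mult_left_mono) auto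
    qed simp
    then have "cmod (?\<Phi> w - ?\<Phi> z + (w - z) * ?D) \<le> K * (cmod (w - z))\<^sup>2"
      by (simp add: K_def mult_ac)
    moreover have "(?\<Phi> w - ?\<Phi> z) / (w - z) - (- ?D) = (?\<Phi> w - ?\<Phi> z + (w - z) * ?D) / (w - z)"
      using w by (simp add: field_simps)
    ultimately show ?thesis using w by (simp add: norm_divide divide_le_eq power2_eq_square mult_ac)
  qed
  have "((\<lambda>w. (?\<Phi> w - ?\<Phi> z) / (w - z)) \<longlongrightarrow> - ?D) (at z)"
  proof (rule LIM_zero_cancel, rule Lim_null_comparison)
    show "\<forall>\<^sub>F w in at z. cmod ((?\<Phi> w - ?\<Phi> z) / (w - z) - (- ?D)) \<le> K * cmod (w - z)"
      unfolding eventually_at using z bound by (intro exI[of _ "Im z / 2"]) (auto simp: dist_norm)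
    have "((\<lambda>w. K * cmod (w - z)) \<longlongrightarrow> K * cmod (z - z)) (at z)" by (intro tendsto_intros)
    then show "((\<lambda>w. K * cmod (w - z)) \<longlongrightarrow> 0) (at z)" by simp
  qed
  then show ?thesis by (simp add: has_field_derivative_iff)
qed

lemma cauchy_transform_holomorphic: "cauchy_transform \<nu> holomorphic_on upper_half_plane"
  using cauchy_transform_DERIV unfolding holomorphic_on_def upper_half_plane_def field_differentiable_def
  by (blast intro: has_field_derivative_at_within)

lemma Im_kernel: "- Im (1 / (z - of_real t)) = Im z / (cmod (z - of_real t))\<^sup>2"
  by (simp add: Im_divide cmod_power2)

lemma Im_cauchy_transform:
  assumes "Im z \<noteq> 0"
  shows "integrable \<nu> (\<lambda>t. Im z / (cmod (z - of_real t))\<^sup>2)"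
    and "- Im (cauchy_transform \<nu> z) = (\<integral>t. Im z / (cmod (z - of_real t))\<^sup>2 \<partial>\<nu>)"
proof -
  have "integrable \<nu> (\<lambda>t. - Im (1 / (z - of_real t)))"
    by (intro Bochner_Integration.integrable_minus integrable_Im integrable_kernel1 assms)
  then show "integrable \<nu> (\<lambda>t. Im z / (cmod (z - of_real t))\<^sup>2)"
    by (simp only: Im_kernel)
  show "- Im (cauchy_transform \<nu> z) = (\<integral>t. Im z / (cmod (z - of_real t))\<^sup>2 \<partial>\<nu>)"
    unfolding Im_kernel[symmetric] cauchy_transform_def
    by (subst Bochner_Integration.integral_minus, subst integral_Im[OF integrable_kernel1[OF assms]], rule refl)
qed

text \<open>The Poisson kernel \<open>e / ((k - t)\<^sup>2 + e\<^sup>2)\<close> is at least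
  \<open>1 / (2 * e)\<close> for \<open>t\<close> within \<open>e\<close> of \<open>k\<close>. Only
  the left half of that interval is kept, so that the estimate remains useful at
  \<open>k = l0\<close> for a measure living to the left of \<open>l0\<close>.\<close>

lemma Im_cauchy_transform_lower:
  assumes e: "e > 0"
  shows "measure \<nu> {k - e<..<k} / (2 * e) \<le> - Im (cauchy_transform \<nu> (Complex k e))"
proof -
  have "measure \<nu> {k - e<..<k} / (2 * e) = (\<integral>t. indicator {k - e<..<k} t * (1 / (2 * e)) \<partial>\<nu>)"
    by simp
  also have "\<dots> \<le> (\<integral>t. e / (cmod (Complex k e - of_real t))\<^sup>2 \<partial>\<nu>)"
  proof (rule integral_mono)
    show "integrable \<nu> (\<lambda>t. e / (cmod (Complex k e - of_real t))\<^sup>2)"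
      using Im_cauchy_transform(1)[of "Complex k e"] e by simp
    show "integrable \<nu> (\<lambda>t. indicator {k - e<..<k} t * (1 / (2 * e)))"
      by (intro integrable_mult_left integrable_real_indicator) (auto simp: emeasure_eq_measure)
    fix t
    show "indicator {k - e<..<k} t * (1 / (2 * e)) \<le> e / (cmod (Complex k e - of_real t))\<^sup>2"
    proof (cases "t \<in> {k - e<..<k}")
      case True
      have "(k - t)\<^sup>2 \<le> e\<^sup>2" using True by (intro power_mono) auto
      then have "(cmod (Complex k e - of_real t))\<^sup>2 \<le> 2 * e\<^sup>2" by (simp add: cmod_power2)
      moreover have "(cmod (Complex k e - of_real t))\<^sup>2 > 0" using e by (simp add: complex_eq_iff)
      ultimately have "e / (2 * e\<^sup>2) \<le> e / (cmod (Complex k e - of_real t))\<^sup>2"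
        using e by (intro divide_left_mono) auto
      with True e show ?thesis by (simp add: power2_eq_square)
    qed (use e in simp)
  qed
  also have "\<dots> = - Im (cauchy_transform \<nu> (Complex k e))"
    using Im_cauchy_transform(2)[of "Complex k e"] e by simp
  finally show ?thesis .
qed

context
  assumes nonzero: "measure \<nu> UNIV > 0"
begin

lemma Im_cauchy_transform_neg:
  assumes z: "Im z > 0" shows "Im (cauchy_transform \<nu> z) < 0"
proof (rule ccontr)
  have ne: "Im z \<noteq> 0" using z by simp
  have pos: "Im z / (cmod (z - of_real t))\<^sup>2 > 0" for t
    using z by (auto intro!: divide_pos_pos simp: complex_eq_iff)
  assume "\<not> Im (cauchy_transform \<nu> z) < 0"
  then have "(\<integral>t. Im z / (cmod (z - of_real t))\<^sup>2 \<partial>\<nu>) \<le> 0"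
    unfolding Im_cauchy_transform(2)[OF ne, symmetric] by simp
  moreover have "0 \<le> (\<integral>t. Im z / (cmod (z - of_real t))\<^sup>2 \<partial>\<nu>)"
    using pos by (intro integral_nonneg_AE AE_I2 less_imp_le)
  ultimately have "(\<integral>t. Im z / (cmod (z - of_real t))\<^sup>2 \<partial>\<nu>) = 0" by simp
  then have "AE t in \<nu>. Im z / (cmod (z - of_real t))\<^sup>2 = 0"
    using pos by (subst (asm) integral_nonneg_eq_0_iff_AE[OF Im_cauchy_transform(1)[OF ne]]) (auto intro!: less_imp_le)
  then have "AE t in \<nu>. False" by eventually_elim (use pos in \<open>metis less_irrefl\<close>)
  then have "emeasure \<nu> UNIV = 0" by (auto simp: AE_iff_measurable[of UNIV])
  then show False using nonzero by (simp add: measure_def)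
qed

text \<open>All mass lies at distance at least \<open>k - l0\<close> from \<open>k\<close>, so the
  kernels stay bounded and the limit is the integral of a positive function.\<close>

lemma cauchy_transform_right:
  assumes supp: "AE t in \<nu>. t < l0" and k: "l0 < k"
  obtains p where "p > 0" "((\<lambda>e. cauchy_transform \<nu> (Complex k e)) \<longlongrightarrow> complex_of_real p) (at_right 0)"
proof -
  define p where "p = (\<integral>t. 1 / (k - t) \<partial>\<nu>)"
  have bd: "AE t in \<nu>. \<bar>1 / (k - t)\<bar> \<le> 1 / (k - l0)"
    using supp by eventually_elim (use k in \<open>simp add: frac_le\<close>)
  have [measurable]: "(\<lambda>t. t) \<in> borel_measurable \<nu>" by (simp add: measurable_cong_sets[OF sets_eq refl])
  have int: "integrable \<nu> (\<lambda>t. 1 / (k - t))"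
    by (rule integrable_const_bound[OF _]) (use bd in auto)
  have nn: "AE t in \<nu>. 0 \<le> 1 / (k - t)" using supp by eventually_elim (use k in simp)
  have "p \<noteq> 0"
  proof
    assume "p = 0"
    then have "AE t in \<nu>. 1 / (k - t) = 0"
      using integral_nonneg_eq_0_iff_AE[OF int nn] by (simp add: p_def)
    with supp have "AE t in \<nu>. False" by eventually_elim (use k in simp)
    then have "emeasure \<nu> UNIV = 0" by (auto simp: AE_iff_measurable[of UNIV])
    then show False using nonzero by (simp add: measure_def)
  qed
  moreover have "0 \<le> p" unfolding p_def by (rule integral_nonneg_AE[OF nn])
  ultimately have "p > 0" by simp
  moreover have "((\<lambda>e. cauchy_transform \<nu> (Complex k e)) \<longlongrightarrow> complex_of_real p) (at_right 0)"
  proof (rule tendsto_at_right_sequentially[of 0 1])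
    fix S :: "nat \<Rightarrow> real" assume S: "\<And>n. 0 < S n" "S \<longlonglongrightarrow> 0"
    have "(\<lambda>n. \<integral>t. 1 / (Complex k (S n) - of_real t) \<partial>\<nu>) \<longlonglongrightarrow> (\<integral>t. complex_of_real (1 / (k - t)) \<partial>\<nu>)"
    proof (rule integral_dominated_convergence[where w = "\<lambda>_. 1 / (k - l0)"])
      show "(\<lambda>t. complex_of_real (1 / (k - t))) \<in> borel_measurable \<nu>" by measurable
      show "(\<lambda>t. 1 / (Complex k (S n) - of_real t)) \<in> borel_measurable \<nu>" for n
        using integrable_kernel1[of "Complex k (S n)"] S(1)[of n] by auto
      show "AE t in \<nu>. (\<lambda>n. 1 / (Complex k (S n) - of_real t)) \<longlonglongrightarrow> complex_of_real (1 / (k - t))"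
        using supp
      proof eventually_elim
        case (elim t)
        have "(\<lambda>n. 1 / (Complex k (S n) - of_real t)) \<longlonglongrightarrow> 1 / (Complex k 0 - of_real t)"
          using elim k by (intro tendsto_intros S(2)) (auto simp: complex_eq_iff)
        moreover have "Complex k 0 - of_real t = of_real (k - t)" by (simp add: complex_eq_iff)
        ultimately show ?case by simp
      qed
      show "AE t in \<nu>. cmod (1 / (Complex k (S n) - of_real t)) \<le> 1 / (k - l0)" for n
        using supp
      proof eventually_elim
        case (elim t)
        have "k - l0 \<le> cmod (Complex k (S n) - of_real t)"
          using complex_Re_le_cmod[of "Complex k (S n) - of_real t"] elim by simp
        then show ?case using k by (simp add: norm_divide frac_le)
      qed
    qed simp
    then show "(\<lambda>n. cauchy_transform \<nu> (Complex k (S n))) \<longlonglongrightarrow> complex_of_real p"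
      by (simp only: cauchy_transform_def p_def integral_complex_of_real)
  qed simp
  ultimately show ?thesis by (rule that)
qed

section \<open>The square root of the Cauchy transform\<close>

definition root_transform :: "complex \<Rightarrow> complex" where
  "root_transform z = csqrt (cauchy_transform \<nu> z)"

lemma root_transform_square: "(root_transform z)\<^sup>2 = cauchy_transform \<nu> z"
  by (simp add: root_transform_def)

text \<open>The principal root halves an argument lying strictly between \<open>- \<pi>\<close> and
  0. The open quadrant is used twice: \<open>1 + \<surd>\<Phi>\<close> has real part above 1, and
  \<open>(1 + \<i>) * \<surd>\<Phi>\<close> has real part
  \<open>\<bar>Re \<surd>\<Phi>\<bar> + \<bar>Im \<surd>\<Phi>\<bar>\<close>, which dominates the
  modulus.\<close>

lemma root_transform_quadrant:
  assumes "Im z > 0"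
  shows "Re (root_transform z) > 0" "Im (root_transform z) < 0"
proof -
  have im: "2 * (Re (root_transform z) * Im (root_transform z)) < 0"
    using Im_cauchy_transform_neg[OF assms] arg_cong[OF root_transform_square[of z], of Im]
    by (simp add: power2_eq_square)
  moreover have "Re (root_transform z) \<ge> 0"
    using csqrt_principal[of "cauchy_transform \<nu> z"] by (auto simp: root_transform_def)
  ultimately show "Re (root_transform z) > 0" "Im (root_transform z) < 0"
    by (auto simp: mult_less_0_iff)
qed

lemma root_transform_norm: "cmod (root_transform z) = sqrt (cmod (cauchy_transform \<nu> z))"
  using arg_cong[OF root_transform_square[of z], of cmod] by (simp add: norm_power real_sqrt_unique)

lemma root_transform_holomorphic: "root_transform holomorphic_on upper_half_plane"
  unfolding root_transform_def
proof (rule holomorphic_on_compose_gen[of _ _ csqrt "- \<real>\<^sub>\<le>\<^sub>0", unfolded comp_def])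
  show "cauchy_transform \<nu> ` upper_half_plane \<subseteq> - \<real>\<^sub>\<le>\<^sub>0"
    using Im_cauchy_transform_neg by (force simp: upper_half_plane_def complex_nonpos_Reals_iff)
qed (auto intro: cauchy_transform_holomorphic holomorphic_on_csqrt)

text \<open>A Moebius map that sends infinity to the real number 1, so that explosion of \<Phi>
  makes the imaginary part vanish. The leading summand 1 keeps the values away from 0 and the
  logarithm bounded; being real, it does not affect which boundary values are real.\<close>

definition cayley :: "complex \<Rightarrow> complex" where
  "cayley z = 1 + 1 / (1 + root_transform z)"

lemma norm_root_transform_le:
  assumes "Im z > 0"
  shows "1 \<le> cmod (1 + root_transform z)" "cmod (root_transform z) \<le> cmod (1 + root_transform z)"
proof -
  note q = root_transform_quadrant[OF assms]
  show "1 \<le> cmod (1 + root_transform z)"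
    using complex_Re_le_cmod[of "1 + root_transform z"] q by simp
  show "cmod (root_transform z) \<le> cmod (1 + root_transform z)"
    using q unfolding cmod_def by (intro real_sqrt_le_mono add_mono) (auto intro!: power_mono)
qed

lemma cayley_holomorphic: "cayley holomorphic_on upper_half_plane"
  unfolding cayley_def
proof (intro holomorphic_intros root_transform_holomorphic)
  show "1 + root_transform z \<noteq> 0" if "z \<in> upper_half_plane" for z
    using norm_root_transform_le(1)[of z] that by (auto simp: upper_half_plane_def)
qed

lemma cayley_bounds:
  assumes "z \<in> upper_half_plane"
  shows "1 \<le> Re (cayley z)" "cmod (cayley z) \<le> 2"
proof -
  have z: "Im z > 0" using assms by (simp add: upper_half_plane_def)
  note q = root_transform_quadrant[OF z] norm_root_transform_le(1)[OF z]
  show "1 \<le> Re (cayley z)"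
    using q by (simp add: cayley_def Re_divide)
  have "cmod (1 / (1 + root_transform z)) \<le> 1" using q(3) by (auto simp: norm_divide divide_le_eq)
  then show "cmod (cayley z) \<le> 2"
    using norm_triangle_ineq[of 1 "1 / (1 + root_transform z)"] by (simp add: cayley_def)
qed

lemma bounded_outer_cayley: "bounded_outer cayley"
  by (rule bounded_outer_if_Re_ge_1[OF cayley_holomorphic cayley_bounds])

lemma cayley_limit_right:
  assumes supp: "AE t in \<nu>. t < l0" and k: "l0 < k"
  obtains r :: real where "((\<lambda>e. cayley (Complex k e)) \<longlongrightarrow> of_real r) (at_right 0)"
proof -
  obtain p where p: "p > 0" "((\<lambda>e. cauchy_transform \<nu> (Complex k e)) \<longlongrightarrow> complex_of_real p) (at_right 0)"
    using cauchy_transform_right[OF assms] .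
  have "isCont csqrt (complex_of_real p)"
    using p(1) by (intro continuous_at_csqrt) (auto simp: complex_nonpos_Reals_iff)
  from isCont_tendsto_compose[OF this p(2)] p(1)
  have "((\<lambda>e. root_transform (Complex k e)) \<longlongrightarrow> of_real (sqrt p)) (at_right 0)"
    by (simp add: root_transform_def csqrt_of_real_nonneg)
  moreover have "1 + complex_of_real (sqrt p) \<noteq> 0"
    using p(1) by (simp add: complex_eq_iff add_nonneg_eq_0_iff)
  ultimately have "((\<lambda>e. cayley (Complex k e)) \<longlongrightarrow> 1 + 1 / (1 + of_real (sqrt p))) (at_right 0)"
    unfolding cayley_def by (intro tendsto_intros)
  then show ?thesis using that[of "1 + 1 / (1 + sqrt p)"] by simp
qed

text \<open>Average density at least \<open>m\<close> on the intervals just left of \<open>k\<close>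
  gives \<open>- Im \<Phi> \<ge> m / 2\<close> above \<open>k\<close>. As \<open>m\<close> is
  arbitrary, the root tends to infinity in modulus along the vertical line.\<close>

lemma cayley_limit_dense:
  assumes dense: "\<And>m::nat. \<exists>r>0. \<forall>e. 0 < e \<and> e < r \<longrightarrow> real m * e \<le> measure \<nu> {k - e<..<k}"
  shows "((\<lambda>e. Im (cayley (Complex k e))) \<longlongrightarrow> 0) (at_right 0)"
proof (rule tendstoI)
  fix d :: real assume d: "d > 0"
  \<comment> \<open>Chosen so that \<open>sqrt (m / 2)\<close>, the lower bound for the modulus of
    the root, exceeds \<open>1 / d\<close>.\<close>
  obtain m :: nat where m: "2 / d\<^sup>2 < m" using reals_Archimedean2 by blast
  then have m0: "real m > 0" using d by (meson divide_pos_pos less_trans zero_less_numeral zero_less_power)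
  obtain r where r: "r > 0" "\<And>e. 0 < e \<Longrightarrow> e < r \<Longrightarrow> real m * e \<le> measure \<nu> {k - e<..<k}"
    using dense[of m] by blast
  have "\<bar>Im (cayley (Complex k e))\<bar> < d" if e: "0 < e" "e < r" for e
  proof -
    let ?z = "Complex k e"
    have z: "Im ?z > 0" using e by simp
    have "m / 2 = m * e / (2 * e)" using e by simp
    also have "\<dots> \<le> measure \<nu> {k - e<..<k} / (2 * e)"
      using r(2)[OF e] e by (intro divide_right_mono) auto
    also have "\<dots> \<le> - Im (cauchy_transform \<nu> ?z)" by (rule Im_cauchy_transform_lower[OF e(1)])
    also have "\<dots> \<le> cmod (cauchy_transform \<nu> ?z)" using abs_Im_le_cmod[of "cauchy_transform \<nu> ?z"] by linarith
    finally have big: "sqrt (m / 2) \<le> cmod (root_transform ?z)"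
      unfolding root_transform_norm by (rule real_sqrt_le_mono)
    have "1 / d < sqrt (m / 2)"
      using m d by (intro real_less_rsqrt) (simp add: field_simps power_divide)
    with big have big2: "1 / d < cmod (1 + root_transform ?z)"
      using norm_root_transform_le(2)[OF z] by linarith
    have "\<bar>Im (cayley ?z)\<bar> \<le> cmod (1 / (1 + root_transform ?z))"
      using abs_Im_le_cmod[of "1 / (1 + root_transform ?z)"] by (simp add: cayley_def)
    also have "\<dots> = 1 / cmod (1 + root_transform ?z)" by (simp add: norm_divide)
    also have "\<dots> < d"
      using big2 d by (smt (verit) divide_less_eq divide_pos_pos less_divide_eq mult.commute zero_less_one)
    finally show ?thesis .
  qed
  then show "\<forall>\<^sub>F e in at_right 0. dist (Im (cayley (Complex k e))) 0 < d"
    unfolding eventually_at_right_field using r(1) by (auto simp: dist_real_def)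
qed

text \<open>After multiplication by \<open>1 + \<i>\<close> the real part dominates the modulus, and
  Poisson's formula evaluates the integral of that real part as \<pi> times its value at \<i>. The
  bound does not depend on \<open>e\<close>.\<close>

lemma root_transform_integral_bound:
  assumes e: "e > 0"
  shows "(\<integral>\<^sup>+t. ennreal (cmod (root_transform (Complex t e)) / (1 + t\<^sup>2)) \<partial>lborel) \<le> ennreal (2 * pi * sqrt (measure \<nu> UNIV))"
proof -
  define h where "h \<zeta> = (1 + \<i>) * root_transform (\<zeta> + \<i> * e)" for \<zeta>
  have hol: "h holomorphic_on {z. Im z > - e}"
    unfolding h_def
    by (intro holomorphic_intros holomorphic_on_compose_gen[of "\<lambda>\<zeta>. \<zeta> + \<i> * e" _ root_transform upper_half_plane, unfolded comp_def])
       (use root_transform_holomorphic in \<open>auto intro!: holomorphic_intros simp: upper_half_plane_def\<close>)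
  have two: "cmod (1 + \<i>) \<le> 2" using norm_triangle_ineq[of 1 \<i>] by simp
  have hb: "cmod (h \<zeta>) \<le> 2 * sqrt (measure \<nu> UNIV / a)" if "Im \<zeta> + e \<ge> a" "a > 0" for \<zeta> a
  proof -
    have "cmod (cauchy_transform \<nu> (\<zeta> + \<i> * e)) \<le> measure \<nu> UNIV / \<bar>Im (\<zeta> + \<i> * e)\<bar>"
      by (rule cauchy_transform_bound) (use that in auto)
    also have "\<dots> \<le> measure \<nu> UNIV / a" using that nonzero by (intro divide_left_mono) auto
    finally have "cmod (root_transform (\<zeta> + \<i> * e)) \<le> sqrt (measure \<nu> UNIV / a)"
      unfolding root_transform_norm by (rule real_sqrt_le_mono)
    then show ?thesis unfolding h_def norm_mult using two by (intro mult_mono) auto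
  qed
  have hb': "cmod (h \<zeta>) \<le> 2 * sqrt (measure \<nu> UNIV / e)" if "Im \<zeta> \<ge> 0" for \<zeta>
    by (rule hb) (use that e in auto)
  note P = Poisson_at_i[OF e hol hb']
  have le: "cmod (root_transform (Complex t e)) / (1 + t\<^sup>2) \<le> Re (h (of_real t) / of_real (1 + t\<^sup>2))" for t
  proof -
    have z: "Complex t e = of_real t + \<i> * e" by (simp add: Complex_eq)
    note q = root_transform_quadrant[of "Complex t e"]
    have "cmod (root_transform (Complex t e)) \<le> Re (h (of_real t))"
      using cmod_le[of "root_transform (Complex t e)"] q e unfolding h_def z by simp
    then show ?thesis by (simp add: Re_divide_of_real divide_right_mono del: of_real_add of_real_power)
  qed
  have int: "integrable lborel (\<lambda>t. Re (h (of_real t) / of_real (1 + t\<^sup>2)))"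
    using P(1) by (rule integrable_Re)
  have nn: "0 \<le> Re (h (of_real t) / of_real (1 + t\<^sup>2))" for t
    using order_trans[OF _ le[of t]] by simp
  have "(\<integral>\<^sup>+t. ennreal (cmod (root_transform (Complex t e)) / (1 + t\<^sup>2)) \<partial>lborel)
      \<le> (\<integral>\<^sup>+t. ennreal (Re (h (of_real t) / of_real (1 + t\<^sup>2))) \<partial>lborel)"
    by (intro nn_integral_mono ennreal_leI le)
  also have "\<dots> = ennreal (\<integral>t. Re (h (of_real t) / of_real (1 + t\<^sup>2)) \<partial>lborel)"
    by (rule nn_integral_eq_integral[OF int]) (use nn in auto)
  also have "(\<integral>t. Re (h (of_real t) / of_real (1 + t\<^sup>2)) \<partial>lborel) = pi * Re (h \<i>)"
    using integral_Re[OF P(1)] P(2) by (simp del: of_real_add of_real_power)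
  \<comment> \<open>At \<i> the shifted argument has imaginary part \<open>1 + e\<close>, so the
    bound \<open>hb\<close> applies with \<open>a = 1\<close>, free of \<open>e\<close>.\<close>
  also have "\<dots> \<le> pi * (2 * sqrt (measure \<nu> UNIV / 1))"
    by (intro mult_left_mono order_trans[OF complex_Re_le_cmod hb]) (use e in auto)
  finally show ?thesis by (simp add: ennreal_leI mult_ac)
qed

text \<open>By the uniform integral bound and Fatou's lemma the lower limit of the moduli is finite
  almost everywhere. Excluding divergence is enough, because \<gamma> is already known to have a
  limit.\<close>

lemma AE_root_transform_not_at_top:
  "AE t in lborel. \<not> filterlim (\<lambda>n. cmod (root_transform (Complex t (inverse (real (Suc n)))))) at_top sequentially"
proof -
  define u where "u n t = ennreal (cmod (root_transform (Complex t (inverse (real (Suc n))))) / (1 + t\<^sup>2))" for n t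
  have [measurable]: "u n \<in> borel_measurable borel" for n
  proof -
    have "continuous_on UNIV (\<lambda>t. root_transform (of_real t + \<i> * of_real (inverse (real (Suc n)))))"
      by (rule continuous_on_compose2[OF holomorphic_on_imp_continuous_on[OF root_transform_holomorphic]])
         (auto intro!: continuous_intros simp: upper_half_plane_def)
    then have "continuous_on UNIV (\<lambda>t. cmod (root_transform (Complex t (inverse (real (Suc n))))) / (1 + t\<^sup>2))"
      unfolding Complex_eq by (intro continuous_intros) (auto simp: add_nonneg_eq_0_iff)
    then have "(\<lambda>t. cmod (root_transform (Complex t (inverse (real (Suc n))))) / (1 + t\<^sup>2)) \<in> borel_measurable borel"
      by (rule borel_measurable_continuous_onI)
    then show ?thesis unfolding u_def by (rule measurable_compose[OF _ measurable_ennreal])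
  qed
  have "(\<integral>\<^sup>+t. liminf (\<lambda>n. u n t) \<partial>lborel) \<le> liminf (\<lambda>n. \<integral>\<^sup>+t. u n t \<partial>lborel)"
    by (rule nn_integral_liminf) simp
  also have "\<dots> \<le> ennreal (2 * pi * sqrt (measure \<nu> UNIV))"
    unfolding u_def
    by (intro order_trans[OF Liminf_le_Limsup Limsup_bounded] always_eventually allI root_transform_integral_bound) auto
  finally have "(\<integral>\<^sup>+t. liminf (\<lambda>n. u n t) \<partial>lborel) \<noteq> \<infinity>" by (auto simp: top_unique)
  then have "AE t in lborel. liminf (\<lambda>n. u n t) \<noteq> \<infinity>"
    by (intro nn_integral_PInf_AE) auto
  then show ?thesis
  proof eventually_elim
    case (elim t)
    show ?case
    proof
      assume "filterlim (\<lambda>n. cmod (root_transform (Complex t (inverse (real (Suc n)))))) at_top sequentially"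
      then have "filterlim (\<lambda>n. cmod (root_transform (Complex t (inverse (real (Suc n))))) * (1 / (1 + t\<^sup>2))) at_top sequentially"
        by (rule filterlim_at_top_mult_tendsto_pos[rotated 2, OF _ tendsto_const]) (auto simp: add_pos_nonneg)
      then have "filterlim (\<lambda>n. cmod (root_transform (Complex t (inverse (real (Suc n))))) / (1 + t\<^sup>2)) at_top sequentially"
        by simp
      then have "(\<lambda>n. u n t) \<longlonglongrightarrow> \<infinity>"
        unfolding u_def by (simp add: ennreal_tendsto_top_eq_at_top)
      then have "liminf (\<lambda>n. u n t) = \<infinity>" by (rule lim_imp_Liminf[rotated]) simp
      with elim show False by simp
    qed
  qed
qed

text \<open>Suppose the limit \<open>w\<close> is real. If \<open>w = 1\<close>, the root tends to
  infinity, against \<open>fin\<close>. Otherwise the Moebius map can be inverted in the limit: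
  \<Phi> tends to the real number \<open>(1 / (w - 1) - 1)\<^sup>2\<close>, while the mass to the
  left of \<open>k\<close> keeps \<open>- Im \<Phi>\<close> above \<open>c / 2\<close>.\<close>

lemma cayley_limit_nonreal:
  assumes lim: "((\<lambda>e. cayley (Complex k e)) \<longlongrightarrow> w) (at_right 0)"
    and c: "c > 0" "r > 0" "\<And>e. 0 < e \<Longrightarrow> e < r \<Longrightarrow> c * e \<le> measure \<nu> {k - e<..<k}"
    and fin: "\<not> filterlim (\<lambda>n. cmod (root_transform (Complex k (inverse (real (Suc n)))))) at_top sequentially"
  shows "w \<notin> \<real>"
proof
  assume w: "w \<in> \<real>"
  define s where "s n = inverse (real (Suc n))" for n
  have s0: "s n > 0" for n by (simp add: s_def)
  have s_lim: "s \<longlonglongrightarrow> 0" unfolding s_def by (rule LIMSEQ_inverse_real_of_nat)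
  have s: "filterlim s (at_right 0) sequentially"
    unfolding filterlim_at using s_lim less_imp_neq[OF s0, symmetric] s0 by auto
  define Q where "Q n = root_transform (Complex k (s n))" for n
  have Qn: "1 \<le> cmod (1 + Q n)" for n
    unfolding Q_def by (rule norm_root_transform_le) (simp add: s0)
  have Qz: "1 + Q n \<noteq> 0" for n using Qn[of n] by auto
  have "(\<lambda>n. cayley (Complex k (s n)) - 1) \<longlonglongrightarrow> w - 1"
    by (intro tendsto_intros filterlim_compose[OF lim s])
  then have g: "(\<lambda>n. 1 / (1 + Q n)) \<longlonglongrightarrow> w - 1"
    by (simp add: cayley_def Q_def)
  show False
  proof (cases "w = 1")
    case True
    with g have "(\<lambda>n. inverse (1 + Q n)) \<longlonglongrightarrow> 0" by (simp add: inverse_eq_divide)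
    moreover have "\<forall>\<^sub>F n in sequentially. inverse (1 + Q n) \<noteq> 0" using Qz by simp
    ultimately have "filterlim (\<lambda>n. inverse (1 + Q n)) (at 0) sequentially"
      by (simp add: filterlim_at)
    then have "filterlim (\<lambda>n. inverse (inverse (1 + Q n))) at_infinity sequentially"
      by (rule filterlim_compose[OF filterlim_inverse_at_infinity])
    then have "filterlim (\<lambda>n. 1 + Q n) at_infinity sequentially" by simp
    then have "filterlim (\<lambda>n. cmod (1 + Q n)) at_top sequentially"
      by (rule filterlim_at_infinity_imp_norm_at_top)
    then have "filterlim (\<lambda>n. - 1 + cmod (1 + Q n)) at_top sequentially"
      by (rule filterlim_tendsto_add_at_top[OF tendsto_const])
    then have "filterlim (\<lambda>n. cmod (Q n)) at_top sequentially"
    proof (rule filterlim_at_top_mono)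
      have "- 1 + cmod (1 + Q n) \<le> cmod (Q n)" for n
        using norm_triangle_ineq[of 1 "Q n"] by simp
      then show "\<forall>\<^sub>F n in sequentially. - 1 + cmod (1 + Q n) \<le> cmod (Q n)" by simp
    qed
    with fin show False by (simp add: Q_def s_def)
  next
    case False
    then have ne: "w - 1 \<noteq> 0" by simp
    have "(\<lambda>n. (1 / (1 / (1 + Q n)) - 1)\<^sup>2) \<longlonglongrightarrow> (1 / (w - 1) - 1)\<^sup>2"
      by (intro tendsto_intros g ne)
    then have "(\<lambda>n. (Q n)\<^sup>2) \<longlonglongrightarrow> (1 / (w - 1) - 1)\<^sup>2" by simp
    then have "(\<lambda>n. - Im (cauchy_transform \<nu> (Complex k (s n)))) \<longlonglongrightarrow> - Im ((1 / (w - 1) - 1)\<^sup>2)"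
      unfolding Q_def root_transform_square by (intro tendsto_intros)
    moreover have "(1 / (w - 1) - 1)\<^sup>2 \<in> \<real>" using w by auto
    then have "Im ((1 / (w - 1) - 1)\<^sup>2) = 0" by (simp only: complex_is_Real_iff)
    ultimately have lim0: "(\<lambda>n. - Im (cauchy_transform \<nu> (Complex k (s n)))) \<longlonglongrightarrow> 0" by simp
    have "\<forall>\<^sub>F n in sequentially. c / 2 \<le> - Im (cauchy_transform \<nu> (Complex k (s n)))"
      using order_tendstoD(2)[OF s_lim c(2)]
    proof eventually_elim
      case (elim n)
      have "c / 2 = c * s n / (2 * s n)" using s0[of n] by simp
      also have "\<dots> \<le> measure \<nu> {k - s n<..<k} / (2 * s n)"
        using c(3)[OF s0 elim] s0[of n] by (intro divide_right_mono) auto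
      also have "\<dots> \<le> - Im (cauchy_transform \<nu> (Complex k (s n)))"
        by (rule Im_cauchy_transform_lower[OF s0])
      finally show ?case .
    qed
    from tendsto_lowerbound[OF lim0 this] c(1) show False by simp
  qed
qed

end

end

section \<open>The measure concentrated around a null set and its outer function\<close>

lemma exists_dense_measure:
  fixes N :: "real set"
  assumes N: "N \<in> null_sets lborel"
  obtains \<nu> where "finite_borel_measure \<nu>" "AE t in \<nu>. t < l0"
    "\<And>k m. k \<in> N \<Longrightarrow> k \<le> l0 \<Longrightarrow> \<exists>r>0. \<forall>e. 0 < e \<and> e < r \<longrightarrow> real m * e \<le> measure \<nu> {k - e<..<k}"
    "\<And>k. k < l0 \<Longrightarrow> \<exists>c>0. \<forall>e. 0 < e \<and> e < 1 \<longrightarrow> c * e \<le> measure \<nu> {k - e<..<k}"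
proof -
  have "\<exists>U. open U \<and> N \<subseteq> U \<and> emeasure lborel U \<le> ennreal ((1/2) ^ n)" for n :: nat
  proof -
    have "N \<in> sets lebesgue" using N by (auto intro: sets_completionI_sets)
    then obtain T where T: "open T" "N \<subseteq> T" "T - N \<in> lmeasurable" "emeasure lebesgue (T - N) < ennreal ((1/2) ^ n)"
      using sets_lebesgue_outer_open[of N "(1/2) ^ n"] by auto
    have "emeasure lborel T = emeasure lborel (T - N)"
      using N T(1) emeasure_Diff_null_set[of N lborel T] by simp
    also have "\<dots> = emeasure lebesgue (T - N)"
      using N T(1) by (subst emeasure_completion) (auto intro: sets_completionI_sets)
    finally show ?thesis using T by (intro exI[of _ T]) auto
  qed
  then obtain U where U: "\<And>n. open (U n)" "\<And>n. N \<subseteq> U n" "\<And>n. emeasure lborel (U n) \<le> ennreal ((1/2) ^ n)"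
    by metis
  have [measurable]: "U n \<in> sets borel" for n using U(1) by simp
  define g where "g t = (\<Sum>n. indicator (U n) t :: ennreal)" for t
  define f where "f t = indicator {..<l0} t * (g t + ennreal (inverse (1 + t\<^sup>2)))" for t
  have [measurable]: "g \<in> borel_measurable borel" "f \<in> borel_measurable borel"
    unfolding f_def g_def by measurable
  define \<nu> where "\<nu> = density lborel f"
  have sets: "sets \<nu> = sets borel" by (simp add: \<nu>_def)
  have em: "emeasure \<nu> S = (\<integral>\<^sup>+t. f t * indicator S t \<partial>lborel)" if "S \<in> sets borel" for S
    unfolding \<nu>_def using that by (simp add: emeasure_density)
  have "emeasure \<nu> UNIV \<le> (\<integral>\<^sup>+t. g t \<partial>lborel) + (\<integral>\<^sup>+t. ennreal (inverse (1 + t\<^sup>2)) \<partial>lborel)"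
    by (subst em, simp, subst nn_integral_add[symmetric])
       (auto intro!: nn_integral_mono simp: f_def indicator_def)
  also have "(\<integral>\<^sup>+t. g t \<partial>lborel) = (\<Sum>n. emeasure lborel (U n))"
    unfolding g_def by (subst nn_integral_suminf) auto
  also have "\<dots> \<le> (\<Sum>n. ennreal ((1/2) ^ n))"
    by (intro suminf_le U) auto
  also have "\<dots> = ennreal (\<Sum>n. (1/2) ^ n)"
    by (intro suminf_ennreal2) auto
  finally have "emeasure \<nu> UNIV \<le> ennreal (\<Sum>n. (1/2) ^ n) + (\<integral>\<^sup>+t. ennreal (inverse (1 + t\<^sup>2)) \<partial>lborel)"
    by (simp add: add_right_mono)
  also have "\<dots> < \<infinity>"
    using integrableD(2)[OF integrable_inverse_1_plus_square_lborel]
    by (simp add: less_top add_nonneg_nonneg)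
  finally have fin: "finite_measure \<nu>"
    by (intro finite_measureI) (simp add: sets_eq_imp_space_eq[OF sets])
  interpret finite_measure \<nu> by fact
  have fb: "finite_borel_measure \<nu>"
    by (intro finite_borel_measure.intro fin finite_borel_measure_axioms.intro sets)
  have "AE t in \<nu>. t < l0"
    unfolding \<nu>_def by (subst AE_density) (auto simp: f_def indicator_def)
  moreover have lower: "c * e \<le> measure \<nu> {k - e<..<k}"
    if "\<And>t. t \<in> {k - e<..<k} \<Longrightarrow> ennreal c \<le> f t" "0 < e" "0 \<le> c" for c k e
  proof -
    have "ennreal (c * e) = (\<integral>\<^sup>+t. ennreal c * indicator {k - e<..<k} t \<partial>lborel)"
      using that(2,3) by (simp add: nn_integral_cmult_indicator ennreal_mult)
    also have "\<dots> \<le> emeasure \<nu> {k - e<..<k}"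
      by (subst em, simp, rule nn_integral_mono) (use that(1) in \<open>auto simp: indicator_def\<close>)
    finally show ?thesis by (simp add: emeasure_eq_measure)
  qed
  moreover have "\<exists>r>0. \<forall>e. 0 < e \<and> e < r \<longrightarrow> real m * e \<le> measure \<nu> {k - e<..<k}" if k: "k \<in> N" "k \<le> l0" for k m
  proof -
    \<comment> \<open>On this neighbourhood of \<open>k\<close> the first \<open>m\<close>
      indicators alone give density at least \<open>m\<close>; \<open>k \<le> l0\<close> keeps the
      left interval inside the half-line where the density is switched on.\<close>
    have "open (\<Inter>n<m. U n)" using U(1) by (intro open_INT) auto
    moreover have "k \<in> (\<Inter>n<m. U n)" using U(2) k by blast
    ultimately obtain r where r: "r > 0" "\<And>t. \<bar>t - k\<bar> < r \<Longrightarrow> t \<in> (\<Inter>n<m. U n)"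
      unfolding open_dist dist_real_def by metis
    show ?thesis
    proof (intro exI[of _ r] conjI allI impI r)
      fix e assume e: "0 < e \<and> e < r"
      show "real m * e \<le> measure \<nu> {k - e<..<k}"
      proof (rule lower)
        fix t assume t: "t \<in> {k - e<..<k}"
        then have tU: "t \<in> (\<Inter>n<m. U n)" using r(2)[of t] e by auto
        have "ennreal (real m) = (\<Sum>n<m. indicator (U n) t)"
          using tU by (simp add: indicator_def ennreal_of_nat_eq_real_of_nat)
        also have "\<dots> \<le> g t" unfolding g_def by (rule sum_le_suminf) auto
        also have "\<dots> \<le> f t" using t k by (simp add: f_def)
        finally show "ennreal (real m) \<le> f t" .
      qed (use e in auto)
    qed
  qed
  moreover have "\<exists>c>0. \<forall>e. 0 < e \<and> e < 1 \<longrightarrow> c * e \<le> measure \<nu> {k - e<..<k}" if k: "k < l0" for k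
  proof -
    \<comment> \<open>A lower bound of \<open>1 / (1 + t\<^sup>2)\<close> on the whole interval
      \<open>(k - 1, k)\<close>, where \<open>\<bar>t\<bar> \<le> \<bar>k\<bar> + 1\<close>.\<close>
    define c where "c = inverse (1 + (\<bar>k\<bar> + 1)\<^sup>2)"
    have c: "c > 0" by (simp add: c_def add_pos_nonneg)
    show ?thesis
    proof (intro exI[of _ c] conjI allI impI c)
      fix e :: real assume e: "0 < e \<and> e < 1"
      show "c * e \<le> measure \<nu> {k - e<..<k}"
      proof (rule lower)
        fix t assume t: "t \<in> {k - e<..<k}"
        have "t\<^sup>2 \<le> (\<bar>k\<bar> + 1)\<^sup>2" using t e by (intro abs_le_square_iff[THEN iffD1]) auto
        then have "c \<le> inverse (1 + t\<^sup>2)" unfolding c_def by (intro le_imp_inverse_le) (auto simp: add_pos_nonneg)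
        then show "ennreal c \<le> f t" using t k by (simp add: f_def ennreal_leI add_increasing)
      qed (use e c in auto)
    qed
  qed
  ultimately show ?thesis by (intro that[OF fb]) auto
qed

text \<open>The two statements about boundary values hold almost everywhere, but the last one holds
  at every point of \<open>N\<close> and of \<open>[l0, \<infinity>)\<close>. Only such a pointwise
  statement can be integrated against a singular spectral measure.\<close>

lemma exists_outer_function:
  assumes N: "N \<in> null_sets lborel" and sub: "N \<subseteq> {..<l0}"
  obtains \<gamma> where "bounded_outer \<gamma>"
    "AE k in lebesgue. l0 < k \<longrightarrow> boundary_value \<gamma> k \<in> \<real>"
    "AE k in lebesgue. k < l0 \<longrightarrow> boundary_value \<gamma> k \<notin> \<real>"
    "\<And>k. k \<in> N \<or> l0 \<le> k \<Longrightarrow> ((\<lambda>e. Im (\<gamma> (Complex k e))) \<longlongrightarrow> 0) (at_right 0)"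
proof -
  \<comment> \<open>The limit from the Cauchy transform to the right of the support needs
    \<open>l0 < k\<close>. At \<open>l0\<close> itself the explosion of \<Phi> is used instead, so
    this point joins the null set.\<close>
  have "insert l0 N \<in> null_sets lborel"
    using null_sets.Un[OF N, of "{l0}"] by (simp add: null_sets_def)
  from exists_dense_measure[OF this, of l0]
  obtain \<nu> where fb: "finite_borel_measure \<nu>" and supp: "AE t in \<nu>. t < l0"
    and dense: "\<And>k m. k \<in> insert l0 N \<Longrightarrow> k \<le> l0 \<Longrightarrow> \<exists>r>0. \<forall>e. 0 < e \<and> e < r \<longrightarrow> real m * e \<le> measure \<nu> {k - e<..<k}"
    and pos: "\<And>k. k < l0 \<Longrightarrow> \<exists>c>0. \<forall>e. 0 < e \<and> e < 1 \<longrightarrow> c * e \<le> measure \<nu> {k - e<..<k}"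
    by blast
  interpret finite_borel_measure \<nu> by fact
  have nz: "measure \<nu> UNIV > 0"
  proof -
    obtain c where c: "c > 0" "\<forall>e. 0 < e \<and> e < 1 \<longrightarrow> c * e \<le> measure \<nu> {l0 - 1 - e<..<l0 - 1}"
      using pos[of "l0 - 1"] by auto
    from c(2)[rule_format, of "1/2"] have "c * (1/2) \<le> measure \<nu> {l0 - 1 - 1/2<..<l0 - 1}" by simp
    also have "\<dots> \<le> measure \<nu> UNIV" by (rule finite_measure_mono) auto
    finally show ?thesis using c(1) by linarith
  qed
  let ?\<gamma> = "cayley"
  note outer = bounded_outer_cayley[OF nz]
  have bv: "AE t in lebesgue. ((\<lambda>e. ?\<gamma> (Complex t e)) \<longlongrightarrow> boundary_value ?\<gamma> t) (at_right 0)"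
    using outer AE_boundary_value unfolding bounded_outer_def
    by (blast intro: eventually_mono nontangential_limit_vertical)
  show ?thesis
  proof (rule that[OF outer])
    show "AE k in lebesgue. l0 < k \<longrightarrow> boundary_value ?\<gamma> k \<in> \<real>"
      using bv
    proof eventually_elim
      case (elim k)
      show ?case
      proof
        assume "l0 < k"
        then obtain r :: real where "((\<lambda>e. ?\<gamma> (Complex k e)) \<longlongrightarrow> of_real r) (at_right 0)"
          using cayley_limit_right[OF nz supp] by blast
        from tendsto_unique[OF _ elim this] show "boundary_value ?\<gamma> k \<in> \<real>" by simp
      qed
    qed
    show "AE k in lebesgue. k < l0 \<longrightarrow> boundary_value ?\<gamma> k \<notin> \<real>"
      using bv AE_completion[OF AE_root_transform_not_at_top[OF nz]]
    proof eventually_elim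
      case (elim k)
      show ?case
      proof
        assume "k < l0"
        then obtain c where c: "c > 0" "\<forall>e. 0 < e \<and> e < 1 \<longrightarrow> c * e \<le> measure \<nu> {k - e<..<k}"
          using pos by blast
        show "boundary_value ?\<gamma> k \<notin> \<real>"
          by (rule cayley_limit_nonreal[OF nz elim(1) c(1) zero_less_one _ elim(2)]) (use c(2) in blast)
      qed
    qed
    fix k assume k: "k \<in> N \<or> l0 \<le> k"
    show "((\<lambda>e. Im (?\<gamma> (Complex k e))) \<longlongrightarrow> 0) (at_right 0)"
    proof (cases "k \<in> insert l0 N")
      case True
      with sub have "k \<le> l0" by auto
      show ?thesis by (rule cayley_limit_dense[OF nz dense[OF True \<open>k \<le> l0\<close>]])
    next
      case False
      with k have "l0 < k" by auto
      then obtain r :: real where "((\<lambda>e. ?\<gamma> (Complex k e)) \<longlongrightarrow> of_real r) (at_right 0)"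
        using cayley_limit_right[OF nz supp] by blast
      from tendsto_Im[OF this] show ?thesis by simp
    qed
  qed
qed

section \<open>Projection-valued measures and functional calculus\<close>

context complex_hilbert begin

lemma cinner_add_right: "cinner x (y + z) = cinner x y + cinner x z"
  by (metis cinner_commute cinner_add_left complex_cnj_add)

lemma cinner_scaleC_right: "cinner x (c *\<^sub>C y) = cnj c * cinner x y"
  by (metis cinner_commute cinner_scaleC_left complex_cnj_mult)

end

lemma cinner_zero_left [simp]: "cinner 0 (y::'h::complex_hilbert) = 0"
  using cinner_add_left[of 0 0 y] by simp

lemma cinner_zero_right [simp]: "cinner (y::'h::complex_hilbert) 0 = 0"
  using cinner_add_right[of y 0 0] by simp

lemma cinner_minus_left [simp]: "cinner (- x) (y::'h::complex_hilbert) = - cinner x y"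
  using cinner_add_left[of x "-x" y] by (simp add: add_eq_0_iff)

lemma cinner_minus_right [simp]: "cinner (x::'h::complex_hilbert) (- y) = - cinner x y"
  using cinner_add_right[of x y "-y"] by (simp add: add_eq_0_iff)

lemma cinner_diff_left: "cinner (x - z) (y::'h::complex_hilbert) = cinner x y - cinner z y"
  using cinner_add_left[of x "-z" y] by simp

lemma cinner_diff_right: "cinner (x::'h::complex_hilbert) (y - z) = cinner x y - cinner x z"
  using cinner_add_right[of x y "-z"] by simp

lemma cinner_self: "cinner x x = complex_of_real ((norm (x::'h::complex_hilbert))\<^sup>2)"
proof -
  have "Im (cinner x x) = 0"
    using arg_cong[OF cinner_commute[of x x], of Im] by simp
  then show ?thesis by (simp add: complex_eq_iff Re_cinner power2_norm_eq_inner)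
qed

lemma norm_scaleC: "norm (c *\<^sub>C (x::'h::complex_hilbert)) = cmod c * norm x"
proof -
  have "complex_of_real ((norm (c *\<^sub>C x))\<^sup>2) = c * cnj c * of_real ((norm x)\<^sup>2)"
    by (simp add: cinner_self[symmetric] cinner_scaleC_left cinner_scaleC_right del: of_real_power)
  also have "\<dots> = complex_of_real ((cmod c * norm x)\<^sup>2)"
    by (simp only: complex_norm_square power_mult_distrib of_real_mult)
  finally have "(norm (c *\<^sub>C x))\<^sup>2 = (cmod c * norm x)\<^sup>2" by (simp only: of_real_eq_iff)
  then show ?thesis by (simp add: power2_eq_iff_nonneg)
qed

lemma scaleC_diff_right: "c *\<^sub>C (x - y) = c *\<^sub>C x - c *\<^sub>C (y::'h::complex_hilbert)"
  using scaleC_add_right[of c "x - y" y] by (simp add: algebra_simps)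

lemma cmod_cinner_le: "cmod (cinner x y) \<le> norm x * norm (y::'h::complex_hilbert)"
proof -
  \<comment> \<open>A unimodular factor makes the inner product real and nonnegative, which reduces
    the claim to the real Cauchy-Schwarz inequality.\<close>
  obtain c where c: "cmod c = 1" "c * cinner x y = of_real (cmod (cinner x y))"
  proof (cases "cinner x y = 0")
    case False
    let ?c = "cnj (cinner x y) / of_real (cmod (cinner x y))"
    have "?c * cinner x y = of_real (cmod (cinner x y))"
      using False complex_norm_square[of "cinner x y"]
      by (simp add: field_simps power2_eq_square)
    with False show ?thesis by (intro that[of ?c]) (auto simp: norm_divide)
  qed (use that[of 1] in auto)
  have "cmod (cinner x y) = Re (cinner (c *\<^sub>C x) y)"
    by (simp add: cinner_scaleC_left c)
  also have "\<dots> \<le> norm (c *\<^sub>C x) * norm y" by (simp add: Re_cinner norm_cauchy_schwarz)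
  finally show ?thesis by (simp add: norm_scaleC c)
qed

lemma bounded_clinearD:
  assumes "bounded_clinear T"
  shows "bounded_linear T" "T (x + y) = T x + T y" "T (c *\<^sub>C x) = c *\<^sub>C T x" "T (x - y) = T x - T y" "T 0 = 0" "T (- x) = - T x"
proof -
  interpret bounded_linear T using assms by (simp add: bounded_clinear_def)
  show "bounded_linear T" by (rule bounded_linear_axioms)
  show "T (x + y) = T x + T y" "T (x - y) = T x - T y" "T 0 = 0" "T (- x) = - T x"
    by (rule add diff zero neg)+
  show "T (c *\<^sub>C x) = c *\<^sub>C T x" using assms by (simp add: bounded_clinear_def)
qed

lemma polarization:
  assumes T: "bounded_clinear T"
  shows "4 * cinner (T u) v = cinner (T (u + v)) (u + v) - cinner (T (u - v)) (u - v)
    + \<i> * cinner (T (u + \<i> *\<^sub>C v)) (u + \<i> *\<^sub>C v) - \<i> * cinner (T (u - \<i> *\<^sub>C v)) (u - \<i> *\<^sub>C v)"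
  by (simp add: bounded_clinearD(2-)[OF T] cinner_add_left cinner_add_right cinner_diff_left
      cinner_diff_right cinner_scaleC_left cinner_scaleC_right algebra_simps)

text \<open>Polarization and the parallelogram law bound the sesquilinear form by the quadratic one.
  With \<open>M = 0\<close> this shows that an operator is determined by its quadratic form, and in
  general it turns bounds on integrals into operator bounds.\<close>

lemma norm_le_numerical_radius:
  fixes T :: "'h::complex_hilbert \<Rightarrow> 'h"
  assumes T: "bounded_clinear T" and M: "\<And>u. cmod (cinner (T u) u) \<le> M * (norm u)\<^sup>2"
  shows "norm (T u) \<le> 2 * M * norm u"
proof (cases "T u = 0 \<or> u = 0")
  case True
  have "0 \<le> M * (norm u)\<^sup>2" using M[of u] norm_ge_zero order_trans by blast
  then have "u \<noteq> 0 \<Longrightarrow> 0 \<le> M" by (simp add: zero_le_mult_iff)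
  with True show ?thesis by (cases "u = 0") (auto simp: bounded_clinearD(5)[OF T])
next
  case False
  have bound: "cmod (cinner (T u) v) \<le> M * ((norm u)\<^sup>2 + (norm v)\<^sup>2)" for v
  proof -
    have par: "(norm (a + b))\<^sup>2 + (norm (a - b))\<^sup>2 = 2 * (norm a)\<^sup>2 + 2 * (norm b)\<^sup>2" for a b :: 'h
      by (simp add: power2_norm_eq_inner inner_add_left inner_add_right inner_diff_left inner_diff_right inner_commute)
    have tri: "cmod (a - b + \<i> * c - \<i> * d) \<le> cmod a + cmod b + cmod c + cmod d" for a b c d
      using norm_triangle_ineq4[of a b] norm_triangle_ineq[of "a - b" "\<i> * c"] norm_triangle_ineq4[of "a - b + \<i> * c" "\<i> * d"]
      by (simp add: norm_mult)
    have "4 * cmod (cinner (T u) v) = cmod (4 * cinner (T u) v)" by (simp add: norm_mult)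
    also have "\<dots> \<le> M * (norm (u + v))\<^sup>2 + M * (norm (u - v))\<^sup>2 + M * (norm (u + \<i> *\<^sub>C v))\<^sup>2 + M * (norm (u - \<i> *\<^sub>C v))\<^sup>2"
      unfolding polarization[OF T] by (rule order_trans[OF tri]) (intro add_mono M)
    also have "\<dots> = M * ((norm (u + v))\<^sup>2 + (norm (u - v))\<^sup>2) + M * ((norm (u + \<i> *\<^sub>C v))\<^sup>2 + (norm (u - \<i> *\<^sub>C v))\<^sup>2)"
      by (simp add: algebra_simps)
    also have "\<dots> = 4 * (M * ((norm u)\<^sup>2 + (norm v)\<^sup>2))"
      unfolding par norm_scaleC by (simp add: algebra_simps)
    finally show ?thesis by simp
  qed
  \<comment> \<open>Scaling \<open>T u\<close> to the length of \<open>u\<close> balances the two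
    squares in \<open>bound\<close>; this is where the factor 2 comes from.\<close>
  define r where "r = norm u / norm (T u)"
  have r: "r > 0" using False by (simp add: r_def)
  have "cinner (T u) (complex_of_real r *\<^sub>C T u) = of_real (r * (norm (T u))\<^sup>2)"
    by (simp add: cinner_scaleC_right cinner_self)
  then have "r * (norm (T u))\<^sup>2 \<le> M * ((norm u)\<^sup>2 + (r * norm (T u))\<^sup>2)"
    using bound[of "complex_of_real r *\<^sub>C T u"] r by (simp add: norm_scaleC norm_mult norm_power)
  moreover have "r * norm (T u) = norm u" using False by (simp add: r_def)
  ultimately have "norm u * norm (T u) \<le> norm u * (2 * M * norm u)"
    by (simp add: power2_eq_square mult.assoc[symmetric]) (simp add: algebra_simps)
  then show ?thesis using False by simp
qed

lemma bounded_clinear_eqI: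
  assumes S: "bounded_clinear S" and T: "bounded_clinear T"
    and eq: "\<And>u. cinner (S u) u = cinner (T u) u"
  shows "S = T"
proof
  fix u
  have "bounded_clinear (\<lambda>u. S u - T u)"
    using S T unfolding bounded_clinear_def by (auto intro: bounded_linear_sub simp: scaleC_diff_right)
  from norm_le_numerical_radius[OF this, of 0 u] show "S u = T u"
    by (simp add: cinner_diff_left eq)
qed

lemma bounded_clinear_scaleC:
  assumes "bounded_clinear T" shows "bounded_clinear (\<lambda>u. c *\<^sub>C T u)"
proof -
  interpret bounded_linear T using assms by (simp add: bounded_clinear_def)
  have "bounded_linear (\<lambda>u. c *\<^sub>C T u)"
  proof (rule bounded_linear_intro[of _ "cmod c * onorm T"])
    show "norm (c *\<^sub>C T x) \<le> norm x * (cmod c * onorm T)" for x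
      using onorm[OF bounded_linear_axioms, of x] mult_left_mono[of "norm (T x)" "onorm T * norm x" "cmod c"]
      by (simp add: norm_scaleC algebra_simps)
    show "c *\<^sub>C T (r *\<^sub>R x) = r *\<^sub>R c *\<^sub>C T x" for r x
      unfolding scaleR unfolding scaleC_of_real[symmetric] scaleC_scaleC by (simp add: mult.commute)
  qed (simp add: add scaleC_add_right)
  then show ?thesis using assms by (simp add: bounded_clinear_def scaleC_scaleC mult.commute)
qed

lemma bounded_clinear_add:
  "bounded_clinear S \<Longrightarrow> bounded_clinear T \<Longrightarrow> bounded_clinear (\<lambda>u. S u + T u)"
  unfolding bounded_clinear_def using bounded_linear_add[of S T] by (simp add: scaleC_add_right)

lemma bounded_clinear_diff:
  "bounded_clinear S \<Longrightarrow> bounded_clinear T \<Longrightarrow> bounded_clinear (\<lambda>u. S u - T u)"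
  unfolding bounded_clinear_def using bounded_linear_sub[of S T] by (simp add: scaleC_diff_right)

section \<open>Projection-valued measures and spectral distributions\<close>

locale pvm =
  fixes E :: "real set \<Rightarrow> 'h::complex_hilbert \<Rightarrow> 'h"
  assumes pvm: "projection_valued_measure E"
begin

lemma proj: "S \<in> sets borel \<Longrightarrow> orthogonal_projection (E S)"
  using pvm by (simp add: projection_valued_measure_def)

lemma clinear: "S \<in> sets borel \<Longrightarrow> bounded_clinear (E S)"
  using proj by (simp add: orthogonal_projection_def)

lemma idem: "S \<in> sets borel \<Longrightarrow> E S (E S u) = E S u"
  using proj by (simp add: orthogonal_projection_def)

lemma sym: "S \<in> sets borel \<Longrightarrow> cinner (E S u) v = cinner u (E S v)"
  using proj unfolding orthogonal_projection_def by blast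

lemma UNIV_eq: "E UNIV u = u"
  using pvm by (simp add: projection_valued_measure_def)

lemma countable_sum: "range S \<subseteq> sets borel \<Longrightarrow> disjoint_family S \<Longrightarrow> (\<lambda>n. E (S n) u) sums E (\<Union>n. S n) u"
  using pvm unfolding projection_valued_measure_def by blast

lemma quad: "S \<in> sets borel \<Longrightarrow> cinner (E S u) u = of_real ((norm (E S u))\<^sup>2)"
  by (metis cinner_self idem sym)

lemma empty: "E {} u = 0"
proof -
  have "(\<lambda>n::nat. E {} u) sums E {} u"
    using countable_sum[of "\<lambda>_. {}" u] by (simp add: disjoint_family_on_def)
  then have "(\<lambda>n::nat. E {} u) \<longlonglongrightarrow> 0" by (intro summable_LIMSEQ_zero sums_summable)
  then show ?thesis by (simp add: LIMSEQ_const_iff)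
qed

lemma union:
  assumes "S \<in> sets borel" "T \<in> sets borel" "S \<inter> T = {}"
  shows "E (S \<union> T) u = E S u + E T u"
proof -
  have "(\<lambda>n. E (binaryset S T n) u) sums (E S u + E T u)"
    by (rule binaryset_sums) (simp add: empty)
  moreover have "(\<lambda>n. E (binaryset S T n) u) sums E (\<Union>n. binaryset S T n) u"
    using assms by (intro countable_sum) (auto simp: range_binaryset_eq disjoint_family_on_def binaryset_def)
  ultimately show ?thesis using sums_unique2 by (auto simp: UN_binaryset_eq)
qed

lemma norm_le: "S \<in> sets borel \<Longrightarrow> norm (E S u) \<le> norm u"
proof -
  assume S: "S \<in> sets borel"
  have "(norm (E S u))\<^sup>2 = cmod (cinner (E S u) u)" by (simp add: quad[OF S] norm_power)
  also have "\<dots> \<le> norm (E S u) * norm u" by (rule cmod_cinner_le)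
  finally show ?thesis by (cases "E S u = 0") (auto simp: power2_eq_square)
qed

text \<open>For \<open>v = E S u\<close>, additivity gives \<open>E (S \<union> T) v\<close> the
  squared length of \<open>v\<close> plus that of \<open>E T v\<close>, but a projection does not
  increase length. Multiplicativity of \<open>E\<close> follows from this.\<close>

lemma disjoint_zero:
  assumes "S \<in> sets borel" "T \<in> sets borel" "S \<inter> T = {}"
  shows "E T (E S u) = 0"
proof -
  let ?v = "E S u"
  have "cinner (E (S \<union> T) ?v) ?v = cinner (E S ?v) ?v + cinner (E T ?v) ?v"
    by (simp add: union[OF assms] cinner_add_left)
  then have "complex_of_real ((norm (E (S \<union> T) ?v))\<^sup>2) = of_real ((norm (E S ?v))\<^sup>2 + (norm (E T ?v))\<^sup>2)"
    using assms by (simp add: quad)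
  then have "(norm (E (S \<union> T) ?v))\<^sup>2 = (norm (E S ?v))\<^sup>2 + (norm (E T ?v))\<^sup>2"
    by (simp only: of_real_eq_iff)
  moreover have "(norm (E (S \<union> T) ?v))\<^sup>2 \<le> (norm ?v)\<^sup>2"
    using assms norm_le[of "S \<union> T" ?v] by (intro power_mono) auto
  ultimately show ?thesis by (simp add: idem[OF assms(1)])
qed

lemma mult:
  assumes S: "S \<in> sets borel" and T: "T \<in> sets borel"
  shows "E T (E S u) = E (T \<inter> S) u"
proof -
  have "E S u = E (T \<inter> S) u + E (S - T) u"
    using union[of "T \<inter> S" "S - T" u] S T by (auto simp: Int_commute Int_Diff_Un Un_Diff_Int)
  moreover have "E T u' = E (T \<inter> S) u' + E (T - S) u'" for u'
    using union[of "T \<inter> S" "T - S" u'] S T by (auto simp: Int_Diff_Un)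
  ultimately have "E T (E S u) = E T (E (T \<inter> S) u) + E T (E (S - T) u)"
    using bounded_clinearD(2)[OF clinear[OF T]] by simp
  also have "E T (E (S - T) u) = 0" by (rule disjoint_zero) (use S T in auto)
  also have "E T (E (T \<inter> S) u) = E (T \<inter> S) (E (T \<inter> S) u) + E (T - S) (E (T \<inter> S) u)"
    by fact
  also have "E (T - S) (E (T \<inter> S) u) = 0" by (rule disjoint_zero) (use S T in auto)
  finally show ?thesis using S T by (simp add: idem)
qed

abbreviation distr :: "'h \<Rightarrow> real measure" where "distr \<equiv> spectral_distr E"

lemma sets_distr [simp, measurable_cong]: "sets (distr u) = sets borel"
proof -
  have "sets (distr u) = sigma_sets UNIV (sets borel)"
    unfolding spectral_distr_def by (rule sets_measure_of) simp
  also have "\<dots> = sets borel" by (rule sets.sigma_sets_eq[of borel, unfolded space_borel])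
  finally show ?thesis .
qed

lemma space_distr [simp]: "space (distr u) = UNIV"
  unfolding spectral_distr_def by (rule space_measure_of) simp

lemma emeasure_distr:
  assumes "S \<in> sets borel"
  shows "emeasure (distr u) S = ennreal ((norm (E S u))\<^sup>2)"
proof -
  let ?\<mu> = "\<lambda>S. ennreal (Re (cinner (E S u) u))"
  have "countably_additive (sets borel) ?\<mu>"
  proof (rule countably_additiveI)
    fix A :: "nat \<Rightarrow> real set" assume A: "range A \<subseteq> sets borel" "disjoint_family A"
    have "(\<lambda>n. inner (E (A n) u) u) sums inner (E (\<Union>n. A n) u) u"
      using countable_sum[OF A] by (rule bounded_linear.sums[OF bounded_linear_inner_left])
    then have "(\<lambda>n. Re (cinner (E (A n) u) u)) sums Re (cinner (E (\<Union>n. A n) u) u)"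
      by (simp add: Re_cinner)
    then show "(\<Sum>n. ?\<mu> (A n)) = ?\<mu> (\<Union>n. A n)"
    proof (rule suminf_ennreal_eq[rotated])
      have "A n \<in> sets borel" for n using A(1) by blast
      then show "0 \<le> Re (cinner (E (A n) u) u)" for n by (simp add: quad)
    qed
  qed
  moreover have "positive (sets borel) ?\<mu>"
    by (simp add: positive_def empty)
  ultimately have "emeasure (measure_of UNIV (sets borel) ?\<mu>) S = ?\<mu> S"
    using assms sets.sigma_algebra_axioms[of "borel::real measure"] by (intro emeasure_measure_of_sigma) auto
  then show ?thesis using assms by (simp add: spectral_distr_def quad)
qed

lemma finite_measure_distr: "finite_measure (distr u)"
  by (rule finite_measureI) (simp add: emeasure_distr)

sublocale distr: finite_measure "distr u" for u
  by (rule finite_measure_distr)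

lemma measure_distr: "S \<in> sets borel \<Longrightarrow> measure (distr u) S = (norm (E S u))\<^sup>2"
  by (simp add: measure_def emeasure_distr)

lemma measure_distr_UNIV: "measure (distr u) UNIV = (norm u)\<^sup>2"
  by (simp add: measure_distr UNIV_eq)

section \<open>Existence of the functional calculus for bounded Borel functions\<close>

definition represents :: "('h \<Rightarrow> 'h) \<Rightarrow> (real \<Rightarrow> complex) \<Rightarrow> bool" where
  "represents T f \<longleftrightarrow> bounded_clinear T \<and> (\<forall>u. cinner (T u) u = (\<integral>k. f k \<partial>distr u))"

lemma fun_calc_eqI:
  assumes "represents T f" shows "fun_calc E f = T"
  unfolding fun_calc_def
proof (rule the_equality)
  show T: "bounded_clinear T \<and> (\<forall>u. cinner (T u) u = (\<integral>k. f k \<partial>distr u))"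
    using assms unfolding represents_def .
  fix S assume S: "bounded_clinear S \<and> (\<forall>u. cinner (S u) u = (\<integral>k. f k \<partial>distr u))"
  show "S = T" by (rule bounded_clinear_eqI) (simp_all only: S T)
qed

lemma represents_norm:
  assumes T: "represents T f" and M: "\<And>k. cmod (f k) \<le> M"
  shows "norm (T u) \<le> 2 * M * norm u"
proof (rule norm_le_numerical_radius)
  fix u
  have "cmod (\<integral>k. f k \<partial>distr u) \<le> (\<integral>k. M \<partial>distr u)"
  proof (cases "integrable (distr u) f")
    case True then show ?thesis
      by (intro order_trans[OF integral_norm_bound] integral_mono) (use M in auto)
  next
    \<comment> \<open>A non-integrable function has Bochner integral 0, so the bound persists
      because \<open>M\<close> is nonnegative.\<close>
    case False
    have "0 \<le> M" using M[of 0] norm_ge_zero order_trans by blast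
    with False show ?thesis by (simp add: not_integrable_integral_eq)
  qed
  then show "cmod (cinner (T u) u) \<le> M * (norm u)\<^sup>2"
    using T by (simp add: represents_def measure_distr_UNIV mult.commute)
qed (use T in \<open>simp add: represents_def\<close>)

lemma has_integral_indicator:
  fixes c :: complex
  assumes "S \<in> sets borel"
  shows "has_bochner_integral (distr u) (\<lambda>k. indicator S k *\<^sub>R c) (measure (distr u) S *\<^sub>R c)"
  using assms by (intro has_bochner_integral_indicator) (auto simp: emeasure_distr)

lemma represents_indicator:
  assumes "S \<in> sets borel"
  shows "represents (\<lambda>u. c *\<^sub>C E S u) (\<lambda>k. indicator S k *\<^sub>R c)"
proof -
  have "(\<integral>k. indicator S k *\<^sub>R c \<partial>distr u) = measure (distr u) S *\<^sub>R c" for u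
    using has_integral_indicator[OF assms] by (rule has_bochner_integral_integral_eq)
  then show ?thesis
    unfolding represents_def using assms
    by (auto intro: bounded_clinear_scaleC clinear simp: cinner_scaleC_left quad measure_distr scaleR_conv_of_real mult.commute)
qed

lemma represents_add:
  assumes "represents S f" "represents T g" "\<And>u. integrable (distr u) f" "\<And>u. integrable (distr u) g"
  shows "represents (\<lambda>u. S u + T u) (\<lambda>k. f k + g k)"
  unfolding represents_def
proof (intro conjI allI)
  have S: "bounded_clinear S" "cinner (S u) u = (\<integral>k. f k \<partial>distr u)" for u
    using assms(1) unfolding represents_def by blast+
  have T: "bounded_clinear T" "cinner (T u) u = (\<integral>k. g k \<partial>distr u)" for u
    using assms(2) unfolding represents_def by blast+
  show "bounded_clinear (\<lambda>u. S u + T u)" by (rule bounded_clinear_add[OF S(1) T(1)])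
  show "cinner (S u + T u) u = (\<integral>k. f k + g k \<partial>distr u)" for u
    unfolding cinner_add_left S(2) T(2) Bochner_Integration.integral_add[OF assms(3,4)] ..
qed

lemma represents_diff:
  assumes "represents S f" "represents T g" "\<And>u. integrable (distr u) f" "\<And>u. integrable (distr u) g"
  shows "represents (\<lambda>u. S u - T u) (\<lambda>k. f k - g k)"
  unfolding represents_def
proof (intro conjI allI)
  have S: "bounded_clinear S" "cinner (S u) u = (\<integral>k. f k \<partial>distr u)" for u
    using assms(1) unfolding represents_def by blast+
  have T: "bounded_clinear T" "cinner (T u) u = (\<integral>k. g k \<partial>distr u)" for u
    using assms(2) unfolding represents_def by blast+
  show "bounded_clinear (\<lambda>u. S u - T u)" by (rule bounded_clinear_diff[OF S(1) T(1)])
  show "cinner (S u - T u) u = (\<integral>k. f k - g k \<partial>distr u)" for u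
    unfolding cinner_diff_left S(2) T(2) Bochner_Integration.integral_diff[OF assms(3,4)] ..
qed

lemma represents_simple:
  assumes fin: "finite C" and S: "\<And>c. c \<in> C \<Longrightarrow> S c \<in> sets borel"
  shows "\<exists>T. represents T (\<lambda>k. \<Sum>c\<in>C. indicator (S c) k *\<^sub>R c)"
  using assms
proof (induction C rule: finite_induct)
  case empty
  have "represents (\<lambda>u. 0) (\<lambda>k. 0)"
    using scaleC_diff_right[of _ "0::'h" 0] by (simp add: represents_def bounded_clinear_def)
  then show ?case by auto
next
  case (insert c C)
  then obtain T where T: "represents T (\<lambda>k. \<Sum>c\<in>C. indicator (S c) k *\<^sub>R c)" by auto
  have int: "integrable (distr u) (\<lambda>k. indicator (S d) k *\<^sub>R d)" if "d \<in> insert c C" for d u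
    using has_integral_indicator[OF insert.prems[OF that], of u d] by (simp add: has_bochner_integral_iff)
  have "represents (\<lambda>u. c *\<^sub>C E (S c) u + T u)
      (\<lambda>k. indicator (S c) k *\<^sub>R c + (\<Sum>c\<in>C. indicator (S c) k *\<^sub>R c))"
  proof (rule represents_add[OF represents_indicator T])
    show "S c \<in> sets borel" by (rule insert.prems) simp
    show "integrable (distr u) (\<lambda>k. indicator (S c) k *\<^sub>R c)" for u by (rule int) simp
    show "integrable (distr u) (\<lambda>k. \<Sum>c\<in>C. indicator (S c) k *\<^sub>R c)" for u
      by (rule Bochner_Integration.integrable_sum, rule int) simp
  qed
  with insert.hyps have "represents (\<lambda>u. c *\<^sub>C E (S c) u + T u)
      (\<lambda>k. \<Sum>c\<in>insert c C. indicator (S c) k *\<^sub>R c)"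
    by (simp only: sum.insert not_False_eq_True)
  then show ?case by (rule exI[where x = "\<lambda>u. c *\<^sub>C E (S c) u + T u"])
qed

text \<open>Differences \<open>T n - T m\<close> represent \<open>f n - f m\<close>, so the
  numerical radius bound makes \<open>T n u\<close> a Cauchy sequence. Quadratic forms and integrals
  both pass to the limit, because the spectral distributions are finite.\<close>

lemma represents_uniform_limit:
  assumes T: "\<And>n. represents (T n) (f n)" and meas: "\<And>n. f n \<in> borel_measurable borel"
    and g: "g \<in> borel_measurable borel"
    and unif: "\<And>n k. cmod (f n k - g k) \<le> e n" and e: "e \<longlonglongrightarrow> 0" and bd: "\<And>k. cmod (g k) \<le> M"
  shows "\<exists>S. represents S g"
proof -
  have e0: "0 \<le> e n" for n by (rule order_trans[OF norm_ge_zero unif[of n 0]])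
  have g_int: "integrable (distr u) g" for u
    by (rule distr.integrable_const_bound[of _ M]) (use bd g in auto)
  have f_bd: "cmod (f n k) \<le> M + e n" for n k
    using norm_triangle_ineq[of "g k" "f n k - g k"] bd[of k] unif[of n k] by simp
  have f_int: "integrable (distr u) (f n)" for u n
    by (rule distr.integrable_const_bound[of _ "M + e n"]) (use f_bd meas in auto)
  have TT: "norm (T n u - T m u) \<le> 2 * (e n + e m) * norm u" for n m u
  proof (rule represents_norm[OF represents_diff[OF T T f_int f_int]])
    show "cmod (f n k - f m k) \<le> e n + e m" for k
      using norm_triangle_ineq4[of "f n k - g k" "f m k - g k"] unif[of n k] unif[of m k] by simp
  qed
  have "Cauchy (\<lambda>n. T n u)" for u
  proof (rule CauchyI)
    fix r :: real assume r: "r > 0"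
    define s where "s = r / (4 * (norm u + 1))"
    have nu: "norm u + 1 > 0" by (rule add_nonneg_pos) auto
    have s: "s > 0" using r nu by (simp add: s_def)
    obtain N where N: "\<And>n. n \<ge> N \<Longrightarrow> e n < s"
      using order_tendstoD(2)[OF e s] by (auto simp: eventually_sequentially)
    show "\<exists>N. \<forall>m\<ge>N. \<forall>n\<ge>N. norm (T m u - T n u) < r"
    proof (intro exI[of _ N] allI impI)
      fix m n assume "m \<ge> N" "n \<ge> N"
      then have "e m + e n \<le> 2 * s" using N[of m] N[of n] by simp
      then have "2 * (e m + e n) * norm u \<le> 4 * s * norm u" by (intro mult_right_mono) auto
      also have "\<dots> < 4 * s * (norm u + 1)" using s by simp
      also have "\<dots> = r" using nu by (simp add: s_def field_simps)
      finally show "norm (T m u - T n u) < r" using TT[of m u n] by simp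
    qed
  qed
  then have conv: "convergent (\<lambda>n. T n u)" for u by (rule Cauchy_convergent)
  define S where "S u = lim (\<lambda>n. T n u)" for u
  have S: "(\<lambda>n. T n u) \<longlonglongrightarrow> S u" for u
    using conv[of u] unfolding S_def by (rule convergent_LIMSEQ_iff[THEN iffD1])
  have Tb: "bounded_clinear (T n)" for n using T by (simp add: represents_def)
  have add: "S (u + v) = S u + S v" for u v
    using LIMSEQ_unique[OF S[of "u + v"]] tendsto_add[OF S[of u] S[of v]]
    by (simp add: bounded_clinearD(2)[OF Tb])
  have scaleC_lim: "(\<lambda>n. c *\<^sub>C X n) \<longlonglongrightarrow> c *\<^sub>C x" if "X \<longlonglongrightarrow> x" for c X and x :: 'h
  proof -
    have "(\<lambda>n. cmod c * norm (X n - x)) \<longlonglongrightarrow> cmod c * 0"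
      by (intro tendsto_intros) (use that in \<open>simp add: LIM_zero_iff tendsto_norm_zero\<close>)
    then have "(\<lambda>n. norm (c *\<^sub>C X n - c *\<^sub>C x)) \<longlonglongrightarrow> 0"
      by (simp add: norm_scaleC flip: scaleC_diff_right)
    then show ?thesis by (simp add: tendsto_norm_zero_iff LIM_zero_iff)
  qed
  have scale: "S (c *\<^sub>C u) = c *\<^sub>C S u" for c u
    using LIMSEQ_unique[OF S[of "c *\<^sub>C u"]] scaleC_lim[OF S[of u], of c]
    by (simp add: bounded_clinearD(3)[OF Tb])
  have bound: "norm (S u) \<le> norm u * (2 * M)" for u
  proof -
    have "norm (T n u) \<le> 2 * (M + e n) * norm u" for n
      by (rule represents_norm[OF T f_bd])
    moreover have "(\<lambda>n. 2 * (M + e n) * norm u) \<longlonglongrightarrow> 2 * (M + 0) * norm u"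
      by (intro tendsto_intros e)
    ultimately have "norm (S u) \<le> 2 * (M + 0) * norm u"
      by (intro LIMSEQ_le[OF tendsto_norm[OF S]]) auto
    then show ?thesis by (simp add: mult.commute)
  qed
  have "bounded_linear S"
    by (rule bounded_linear_intro[OF add _ bound]) (simp add: scale flip: scaleC_of_real)
  then have "bounded_clinear S" using scale by (simp add: bounded_clinear_def)
  moreover have "cinner (S u) u = (\<integral>k. g k \<partial>distr u)" for u
  proof (rule LIMSEQ_unique)
    show "(\<lambda>n. cinner (T n u) u) \<longlonglongrightarrow> cinner (S u) u"
    proof (rule LIM_zero_cancel, rule Lim_null_comparison)
      show "\<forall>\<^sub>F n in sequentially. norm (cinner (T n u) u - cinner (S u) u) \<le> norm (T n u - S u) * norm u"
        by (intro always_eventually allI) (simp add: cmod_cinner_le flip: cinner_diff_left)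
      show "(\<lambda>n. norm (T n u - S u) * norm u) \<longlonglongrightarrow> 0"
        using S[of u] by (intro tendsto_mult_left_zero tendsto_norm_zero) (simp add: LIM_zero_iff)
    qed
    have "(\<lambda>n. \<integral>k. f n k \<partial>distr u) \<longlonglongrightarrow> (\<integral>k. g k \<partial>distr u)"
    proof (rule LIM_zero_cancel, rule Lim_null_comparison)
      show "\<forall>\<^sub>F n in sequentially. norm ((\<integral>k. f n k \<partial>distr u) - (\<integral>k. g k \<partial>distr u)) \<le> e n * (norm u)\<^sup>2"
      proof (intro always_eventually allI)
        fix n
        have "cmod (\<integral>k. f n k - g k \<partial>distr u) \<le> (\<integral>k. e n \<partial>distr u)"
          by (intro order_trans[OF integral_norm_bound] integral_mono integrable_norm Bochner_Integration.integrable_diff f_int g_int)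
             (use unif in auto)
        then show "norm ((\<integral>k. f n k \<partial>distr u) - (\<integral>k. g k \<partial>distr u)) \<le> e n * (norm u)\<^sup>2"
          by (simp add: Bochner_Integration.integral_diff[OF f_int g_int] measure_distr_UNIV mult.commute)
      qed
      show "(\<lambda>n. e n * (norm u)\<^sup>2) \<longlonglongrightarrow> 0" using e by (rule tendsto_mult_left_zero)
    qed
    then show "(\<lambda>n. cinner (T n u) u) \<longlonglongrightarrow> (\<integral>k. g k \<partial>distr u)"
      using T by (simp add: represents_def)
  qed
  ultimately show ?thesis unfolding represents_def by blast
qed

definition quantize :: "nat \<Rightarrow> real \<Rightarrow> real" where
  "quantize n x = of_int \<lfloor>real (Suc n) * x\<rfloor> / real (Suc n)"

lemma quantize_close: "\<bar>quantize n x - x\<bar> \<le> 1 / real (Suc n)"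
proof -
  have "quantize n x - x = (of_int \<lfloor>real (Suc n) * x\<rfloor> - real (Suc n) * x) / real (Suc n)"
    by (simp add: quantize_def field_simps del: of_nat_Suc)
  moreover have "\<bar>of_int \<lfloor>real (Suc n) * x\<rfloor> - real (Suc n) * x\<bar> \<le> 1" by linarith
  ultimately show ?thesis by (simp add: divide_right_mono del: of_nat_Suc)
qed

lemma finite_quantize: "finite (quantize n ` {-M..M})"
proof -
  have "quantize n ` {-M..M} \<subseteq> (\<lambda>i. of_int i / real (Suc n)) ` {\<lfloor>real (Suc n) * (-M)\<rfloor>..\<lfloor>real (Suc n) * M\<rfloor>}"
    unfolding quantize_def
  proof (intro image_subsetI image_eqI[OF refl])
    fix x assume x: "x \<in> {-M..M}"
    have "real (Suc n) * (-M) \<le> real (Suc n) * x" "real (Suc n) * x \<le> real (Suc n) * M"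
      using x by (intro mult_left_mono; simp)+
    then show "\<lfloor>real (Suc n) * x\<rfloor> \<in> {\<lfloor>real (Suc n) * (-M)\<rfloor>..\<lfloor>real (Suc n) * M\<rfloor>}"
      unfolding atLeastAtMost_iff by (intro conjI floor_mono)
  qed
  then show ?thesis by (rule finite_subset) auto
qed

text \<open>Rounding real and imaginary parts to the grid of mesh \<open>1 / (n + 1)\<close> gives
  simple functions, with finite range because \<open>g\<close> is bounded, that approximate
  \<open>g\<close> uniformly within \<open>2 / (n + 1)\<close>.\<close>

lemma represents_bounded:
  assumes g: "g \<in> borel_measurable borel" and bd: "\<And>k. cmod (g k) \<le> M"
  shows "\<exists>S. represents S g"
proof -
  define f where "f n k = Complex (quantize n (Re (g k))) (quantize n (Im (g k)))" for n k
  have meas: "f n \<in> borel_measurable borel" for n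
    using g unfolding f_def quantize_def Complex_eq by measurable
  have fin: "finite (range (f n))" for n
  proof -
    have "range (f n) \<subseteq> (\<lambda>(x, y). Complex x y) ` (quantize n ` {-M..M} \<times> quantize n ` {-M..M})"
    proof
      fix z assume "z \<in> range (f n)"
      then obtain k where "z = f n k" by auto
      moreover have "Re (g k) \<in> {-M..M}" "Im (g k) \<in> {-M..M}"
        using bd[of k] abs_Re_le_cmod[of "g k"] abs_Im_le_cmod[of "g k"] by auto
      ultimately show "z \<in> (\<lambda>(x, y). Complex x y) ` (quantize n ` {-M..M} \<times> quantize n ` {-M..M})"
        by (auto simp: f_def)
    qed
    then show ?thesis by (rule finite_subset) (use finite_quantize in auto)
  qed
  have "f n k = (\<Sum>c\<in>range (f n). indicator (f n -` {c}) k *\<^sub>R c)" for n k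
  proof -
    have "(\<Sum>c\<in>range (f n). indicator (f n -` {c}) k *\<^sub>R c) = (\<Sum>c\<in>{f n k}. indicator (f n -` {c}) k *\<^sub>R c)"
      by (rule sum.mono_neutral_right[OF fin]) (auto simp: indicator_def)
    then show ?thesis by simp
  qed
  then have feq: "f n = (\<lambda>k. \<Sum>c\<in>range (f n). indicator (f n -` {c}) k *\<^sub>R c)" for n by (rule ext)
  have "\<exists>T. represents T (f n)" for n
  proof -
    have "\<exists>T. represents T (\<lambda>k. \<Sum>c\<in>range (f n). indicator (f n -` {c}) k *\<^sub>R c)"
      using measurable_sets[OF meas[of n], of "{_}"] by (intro represents_simple fin) simp
    then show ?thesis by (subst feq)
  qed
  then obtain T where T: "\<And>n. represents (T n) (f n)" by metis
  show ?thesis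
  proof (rule represents_uniform_limit[OF T meas g _ _ bd])
    show "cmod (f n k - g k) \<le> 2 / real (Suc n)" for n k
      using cmod_le[of "f n k - g k"] quantize_close[of n "Re (g k)"] quantize_close[of n "Im (g k)"]
      by (simp add: f_def)
    show "(\<lambda>n. 2 / real (Suc n)) \<longlonglongrightarrow> 0"
      using tendsto_mult_right_zero[OF LIMSEQ_inverse_real_of_nat, of 2] by (simp add: divide_inverse)
  qed
qed

lemma represents_fun_calc:
  assumes "g \<in> borel_measurable borel" "\<And>k. cmod (g k) \<le> M"
  shows "represents (fun_calc E g) g"
  using represents_bounded[OF assms] fun_calc_eqI by metis

lemma weakly_annihilates_iff:
  assumes holo: "\<gamma> holomorphic_on upper_half_plane" and bdd: "bounded (\<gamma> ` upper_half_plane)"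
  shows "weakly_annihilates \<gamma> E \<longleftrightarrow>
    (\<forall>u. ((\<lambda>\<epsilon>. \<integral>k. Im (\<gamma> (Complex k \<epsilon>)) \<partial>distr u) \<longlongrightarrow> 0) (at_right 0))"
proof -
  obtain M where M: "\<And>z. z \<in> upper_half_plane \<Longrightarrow> cmod (\<gamma> z) \<le> M"
    using bdd by (auto simp: bounded_iff)
  define f where "f \<epsilon> k = \<gamma> (Complex k \<epsilon>)" for \<epsilon> k
  define T where "T \<epsilon> u = fun_calc E (\<lambda>k. \<gamma> (Complex k \<epsilon>)) u - fun_calc E (\<lambda>k. conj_reflect \<gamma> (Complex k (- \<epsilon>))) u" for \<epsilon> u
  have T: "bounded_clinear (T \<epsilon>)" "cinner (T \<epsilon> u) u = 2 * \<i> * of_real (\<integral>k. Im (\<gamma> (Complex k \<epsilon>)) \<partial>distr u)"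
    if \<epsilon>: "\<epsilon> > 0" for \<epsilon> u
  proof -
    \<comment> \<open>Hence the difference of the two operators has the symbol
      \<open>2 * \<i> * Im \<gamma>\<close>, and its quadratic form is an integral of
      \<open>Im \<gamma>\<close>.\<close>
    have cr: "conj_reflect \<gamma> (Complex k (- \<epsilon>)) = cnj (f \<epsilon> k)" for k
      by (simp add: conj_reflect_def f_def complex_cnj)
    have "continuous_on UNIV (\<lambda>k. \<gamma> (of_real k + \<i> * of_real \<epsilon>))"
      by (rule continuous_on_compose2[OF holomorphic_on_imp_continuous_on[OF holo]])
         (use \<epsilon> in \<open>auto intro!: continuous_intros simp: upper_half_plane_def\<close>)
    then have "continuous_on UNIV (f \<epsilon>)" by (simp add: f_def[abs_def] Complex_eq)
    then have fm: "f \<epsilon> \<in> borel_measurable borel" by (rule borel_measurable_continuous_onI)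
    have cm: "(\<lambda>k. cnj (f \<epsilon> k)) \<in> borel_measurable borel"
      using measurable_compose[OF fm borel_measurable_continuous_onI[of cnj]] by (simp add: continuous_on_cnj)
    have fb: "cmod (f \<epsilon> k) \<le> M" for k using \<epsilon> by (auto simp: f_def upper_half_plane_def intro!: M)
    have cb: "cmod (cnj (f \<epsilon> k)) \<le> M" for k using fb by simp
    have fi: "integrable (distr u) (f \<epsilon>)" for u
      by (rule distr.integrable_const_bound[of _ M]) (use fb fm in auto)
    have cI: "integrable (distr u) (\<lambda>k. cnj (f \<epsilon> k))" for u
      using fi by simp
    have "represents (T \<epsilon>) (\<lambda>k. f \<epsilon> k - cnj (f \<epsilon> k))"
      using represents_diff[OF represents_fun_calc[OF fm fb] represents_fun_calc[OF cm cb] fi cI]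
      unfolding T_def cr by (simp add: f_def[abs_def])
    also have "(\<lambda>k. f \<epsilon> k - cnj (f \<epsilon> k)) = (\<lambda>k. 2 * \<i> * of_real (Im (f \<epsilon> k)))"
      by (simp add: complex_diff_cnj mult_ac)
    finally show "bounded_clinear (T \<epsilon>)" "cinner (T \<epsilon> u) u = 2 * \<i> * of_real (\<integral>k. Im (\<gamma> (Complex k \<epsilon>)) \<partial>distr u)"
      by (auto simp: represents_def f_def)
  qed
  have pos: "\<forall>\<^sub>F \<epsilon> in at_right (0::real). \<epsilon> > 0" by (rule eventually_at_right_less)
  have quad: "((\<lambda>\<epsilon>. cinner (T \<epsilon> u) u) \<longlongrightarrow> 0) (at_right 0) \<longleftrightarrow>
      ((\<lambda>\<epsilon>. \<integral>k. Im (\<gamma> (Complex k \<epsilon>)) \<partial>distr u) \<longlongrightarrow> 0) (at_right 0)" for u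
  proof -
    have "((\<lambda>\<epsilon>. cinner (T \<epsilon> u) u) \<longlongrightarrow> 0) (at_right 0) \<longleftrightarrow>
       ((\<lambda>\<epsilon>. 2 * \<i> * complex_of_real (\<integral>k. Im (\<gamma> (Complex k \<epsilon>)) \<partial>distr u)) \<longlongrightarrow> 0) (at_right 0)"
      by (rule filterlim_cong[OF refl refl]) (use pos in eventually_elim, simp add: T)
    also have "\<dots> \<longleftrightarrow> ((\<lambda>\<epsilon>. complex_of_real (\<integral>k. Im (\<gamma> (Complex k \<epsilon>)) \<partial>distr u)) \<longlongrightarrow> of_real 0) (at_right 0)"
      using tendsto_mult_left_iff[of "2 * \<i>" _ 0] by simp
    finally show ?thesis by (simp only: tendsto_of_real_iff)
  qed
  have "(\<forall>u v. ((\<lambda>\<epsilon>. cinner (T \<epsilon> u) v) \<longlongrightarrow> 0) (at_right 0)) \<longleftrightarrow> (\<forall>u. ((\<lambda>\<epsilon>. cinner (T \<epsilon> u) u) \<longlongrightarrow> 0) (at_right 0))"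
  proof (intro iffI allI)
    fix u v assume *: "\<forall>u. ((\<lambda>\<epsilon>. cinner (T \<epsilon> u) u) \<longlongrightarrow> 0) (at_right 0)"
    have "((\<lambda>\<epsilon>. (cinner (T \<epsilon> (u + v)) (u + v) - cinner (T \<epsilon> (u - v)) (u - v)
      + \<i> * cinner (T \<epsilon> (u + \<i> *\<^sub>C v)) (u + \<i> *\<^sub>C v) - \<i> * cinner (T \<epsilon> (u - \<i> *\<^sub>C v)) (u - \<i> *\<^sub>C v)) / 4)
      \<longlongrightarrow> (0 - 0 + \<i> * 0 - \<i> * 0) / 4) (at_right 0)"
      by (intro tendsto_intros *[rule_format]) simp
    then have "((\<lambda>\<epsilon>. cinner (T \<epsilon> u) v) \<longlongrightarrow> (0 - 0 + \<i> * 0 - \<i> * 0) / 4) (at_right 0)"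
    proof (rule Lim_transform_eventually)
      show "\<forall>\<^sub>F \<epsilon> in at_right 0. (cinner (T \<epsilon> (u + v)) (u + v) - cinner (T \<epsilon> (u - v)) (u - v)
        + \<i> * cinner (T \<epsilon> (u + \<i> *\<^sub>C v)) (u + \<i> *\<^sub>C v) - \<i> * cinner (T \<epsilon> (u - \<i> *\<^sub>C v)) (u - \<i> *\<^sub>C v)) / 4 = cinner (T \<epsilon> u) v"
        using pos by eventually_elim (simp add: polarization[OF T(1), symmetric])
    qed
    then show "((\<lambda>\<epsilon>. cinner (T \<epsilon> u) v) \<longlongrightarrow> 0) (at_right 0)" by simp
  qed auto
  then show ?thesis unfolding weakly_annihilates_def T_def[symmetric] by (simp add: quad)
qed

end

section \<open>Weak annihilation and singular spectrum\<close>

lemma nontangential_limit_const: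
  assumes "\<And>z. z \<in> upper_half_plane \<Longrightarrow> \<gamma> z = c"
  shows "nontangential_limit \<gamma> t c"
  unfolding nontangential_limit_def
proof (intro allI impI)
  fix a :: real
  show "(\<gamma> \<longlongrightarrow> c) (at (complex_of_real t) within {z. 0 < Im z \<and> \<bar>Re z - t\<bar> < a * Im z})"
    by (rule Lim_transform_eventually[OF tendsto_const])
       (auto simp: eventually_at_filter upper_half_plane_def assms)
qed

text \<open>A constant would be its own boundary value everywhere. Real or not, it contradicts one
  of the two conditions on a half-line of positive measure.\<close>

lemma not_constant_if_boundary_value:
  assumes right: "AE k in lebesgue. l0 < k \<longrightarrow> boundary_value \<gamma> k \<in> \<real>"
    and left: "AE k in lebesgue. k < l0 \<longrightarrow> boundary_value \<gamma> k \<notin> \<real>"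
  shows "\<not> \<gamma> constant_on upper_half_plane"
proof
  assume "\<gamma> constant_on upper_half_plane"
  then obtain c where "\<And>z. z \<in> upper_half_plane \<Longrightarrow> \<gamma> z = c" by (auto simp: constant_on_def)
  then have bv: "boundary_value \<gamma> k = c" for k
    by (intro boundary_value_eqI nontangential_limit_const)
  show False
  proof (cases "c \<in> \<real>")
    case True
    have "AE k in lebesgue. k \<in> {l0..}"
      using left by eventually_elim (use True in \<open>auto simp: bv\<close>)
    then have "l0 - 1 \<in> {l0..}" by (rule mem_closed_if_AE_lebesgue[rotated]) simp
    then show False by simp
  next
    case False
    have "AE k in lebesgue. k \<in> {..l0}"
      using right by eventually_elim (use False in \<open>auto simp: bv\<close>)
    then have "l0 + 1 \<in> {..l0}" by (rule mem_closed_if_AE_lebesgue[rotated]) simp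
    then show False by simp
  qed
qed

text \<open>The exhaustion step of the Lebesgue decomposition: take a countable union of
  \<open>K\<close>-null sets whose \<open>M\<close>-measures approach the supremum. A disjoint
  \<open>K\<close>-null set of positive \<open>M\<close>-measure would push the union beyond that
  supremum.\<close>

lemma (in finite_measure) exists_maximal_null_set:
  assumes sets_M: "sets K \<subseteq> sets M"
  obtains N where "N \<in> null_sets K" "\<And>S. S \<in> null_sets K \<Longrightarrow> S \<inter> N = {} \<Longrightarrow> measure M S = 0"
proof -
  have bdd: "bdd_above (measure M ` null_sets K)"
    by (rule bdd_aboveI[of _ "measure M (space M)"]) (auto intro: bounded_measure)
  define c where "c = (SUP N\<in>null_sets K. measure M N)"
  have "\<exists>N\<in>null_sets K. c - inverse (real (Suc n)) < measure M N" for n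
  proof -
    have "c - inverse (real (Suc n)) < c" by simp
    then show ?thesis
      unfolding c_def by (subst (asm) less_cSUP_iff[OF _ bdd]) auto
  qed
  then obtain F where F: "\<And>n. F n \<in> null_sets K" "\<And>n. c - inverse (real (Suc n)) < measure M (F n)"
    by metis
  define N where "N = (\<Union>n. F n)"
  have N: "N \<in> null_sets K" unfolding N_def by (intro null_sets_UN F)
  have meas: "S \<in> sets M" if "S \<in> null_sets K" for S using that sets_M by auto
  have "c \<le> measure M N"
  proof (rule LIMSEQ_le_const2)
    show "(\<lambda>n. c - inverse (real (Suc n))) \<longlonglongrightarrow> c"
      using tendsto_diff[OF tendsto_const LIMSEQ_inverse_real_of_nat, of c] by simp
    have "measure M (F n) \<le> measure M N" for n
      by (rule finite_measure_mono) (auto simp: N_def intro: meas[OF N, unfolded N_def])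
    then show "\<exists>k. \<forall>n\<ge>k. c - inverse (real (Suc n)) \<le> measure M N"
      using F(2) by (meson less_imp_le order_trans)
  qed
  show ?thesis
  proof (rule that[OF N])
    fix S assume S: "S \<in> null_sets K" "S \<inter> N = {}"
    have "measure M S + measure M N = measure M (S \<union> N)"
      using finite_measure_Union[OF meas[OF S(1)] meas[OF N] S(2)] by simp
    also have "\<dots> \<le> c" unfolding c_def using S(1) N by (intro cSUP_upper bdd) auto
    finally show "measure M S = 0" using \<open>c \<le> measure M N\<close> measure_nonneg[of M S] by linarith
  qed
qed

lemma vertical_line_measurable:
  assumes holo: "\<gamma> holomorphic_on upper_half_plane" and e: "0 < e"
  shows "(\<lambda>k. Im (\<gamma> (Complex k e))) \<in> borel_measurable borel"
proof (rule borel_measurable_continuous_onI)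
  have "continuous_on UNIV (\<lambda>k. \<gamma> (of_real k + \<i> * of_real e))"
    by (rule continuous_on_compose2[OF holomorphic_on_imp_continuous_on[OF holo]])
       (use e in \<open>auto intro!: continuous_intros simp: upper_half_plane_def\<close>)
  then show "continuous_on UNIV (\<lambda>k. Im (\<gamma> (Complex k e)))"
    unfolding Complex_eq by (rule continuous_on_Im)
qed

context pvm begin

text \<open>Multiplicativity of \<open>E\<close> makes projecting the vector the same as restricting
  its measure. This localizes statements about all vectors to arbitrary Borel sets.\<close>

lemma distr_proj:
  assumes S: "S \<in> sets borel"
  shows "distr (E S u) = density (distr u) (\<lambda>k. ennreal (indicator S k))"
proof (rule measure_eqI)
  fix B assume "B \<in> sets (distr (E S u))"
  then have B: "B \<in> sets borel" by simp
  have "(\<integral>\<^sup>+k. ennreal (indicator S k) * indicator B k \<partial>distr u) = (\<integral>\<^sup>+k. indicator (B \<inter> S) k \<partial>distr u)"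
    by (intro nn_integral_cong) (auto simp: indicator_def)
  then show "emeasure (distr (E S u)) B = emeasure (density (distr u) (\<lambda>k. ennreal (indicator S k))) B"
    using S B by (simp add: emeasure_density emeasure_distr mult)
qed simp

lemma integral_distr_proj:
  fixes f :: "real \<Rightarrow> real"
  assumes S: "S \<in> sets borel" and f: "f \<in> borel_measurable borel"
  shows "(\<integral>k. f k \<partial>distr (E S u)) = (\<integral>k. indicator S k * f k \<partial>distr u)"
proof -
  have fm: "f \<in> borel_measurable (distr u)" using f by (simp add: measurable_cong_sets[OF sets_distr refl])
  have "(\<integral>k. f k \<partial>distr (E S u)) = (\<integral>k. indicator S k *\<^sub>R f k \<partial>distr u)"
    unfolding distr_proj[OF S] using S fm by (intro integral_density) auto
  then show ?thesis by simp
qed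

lemma AE_distr_notin:
  assumes "S \<in> sets borel" "E S u = 0"
  shows "AE k in distr u. k \<notin> S"
  using assms by (intro AE_not_in) (simp add: null_sets_def emeasure_distr)

lemma dominated_boundary_integral:
  assumes holo: "\<gamma> holomorphic_on upper_half_plane" and bdd: "bounded (\<gamma> ` upper_half_plane)"
    and lim: "AE k in distr u. ((\<lambda>\<epsilon>. Im (\<gamma> (Complex k \<epsilon>))) \<longlongrightarrow> g k) (at_right 0)"
    and g: "g \<in> borel_measurable borel" and S: "S \<in> sets borel"
  shows "((\<lambda>\<epsilon>. \<integral>k. indicator S k * Im (\<gamma> (Complex k \<epsilon>)) \<partial>distr u) \<longlongrightarrow> (\<integral>k. indicator S k * g k \<partial>distr u)) (at_right 0)"
proof (rule tendsto_at_right_sequentially[of 0 1])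
  fix s :: "nat \<Rightarrow> real" assume s: "\<And>n. 0 < s n" "s \<longlonglongrightarrow> 0"
  have s_right: "filterlim s (at_right 0) sequentially"
    unfolding filterlim_at using s(2) less_imp_neq[OF s(1), symmetric] s(1) by auto
  obtain M where M: "\<And>z. z \<in> upper_half_plane \<Longrightarrow> cmod (\<gamma> z) \<le> M"
    using bdd by (auto simp: bounded_iff)
  have meas: "(\<lambda>k. Im (\<gamma> (Complex k (s n)))) \<in> borel_measurable borel" for n
    by (rule vertical_line_measurable[OF holo s(1)])
  have Mb: "\<bar>Im (\<gamma> (Complex k (s n)))\<bar> \<le> M" for k n
    using order_trans[OF abs_Im_le_cmod M[of "Complex k (s n)"]] s(1) by (simp add: upper_half_plane_def)
  show "(\<lambda>n. \<integral>k. indicator S k * Im (\<gamma> (Complex k (s n))) \<partial>distr u) \<longlonglongrightarrow> (\<integral>k. indicator S k * g k \<partial>distr u)"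
  proof (rule integral_dominated_convergence[where w = "\<lambda>_. M"])
    show "(\<lambda>k. indicator S k * g k) \<in> borel_measurable (distr u)"
      using g S by (simp add: measurable_cong_sets[OF sets_distr refl])
    show "(\<lambda>k. indicator S k * Im (\<gamma> (Complex k (s n)))) \<in> borel_measurable (distr u)" for n
      using meas[of n] S unfolding measurable_cong_sets[OF sets_distr refl]
      by (intro borel_measurable_times borel_measurable_indicator)
    show "AE k in distr u. (\<lambda>n. indicator S k * Im (\<gamma> (Complex k (s n)))) \<longlonglongrightarrow> indicator S k * g k"
      using lim by eventually_elim (intro tendsto_intros filterlim_compose[OF _ s_right])
    show "AE k in distr u. norm (indicator S k * Im (\<gamma> (Complex k (s n)))) \<le> M" for n
    proof (rule AE_I2)
      fix k show "norm (indicator S k * Im (\<gamma> (Complex k (s n)))) \<le> M"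
        using Mb[of k n] order_trans[OF abs_ge_zero Mb[of k n]] by (simp add: indicator_def)
    qed
  qed simp
qed simp

lemma singular_if_weakly_annihilates:
  assumes holo: "\<gamma> holomorphic_on upper_half_plane" and bdd: "bounded (\<gamma> ` upper_half_plane)"
    and left: "AE k in lebesgue. k < l0 \<longrightarrow> boundary_value \<gamma> k \<notin> \<real>"
    and wa: "weakly_annihilates \<gamma> E"
  shows "purely_singular_left E l0"
proof -
  have L: "{..<l0} \<in> sets borel" by simp
  define s where "s n = inverse (real (Suc n))" for n
  have s0: "s n > 0" for n by (simp add: s_def)
  have s_right: "filterlim s (at_right 0) sequentially"
    unfolding filterlim_at using LIMSEQ_inverse_real_of_nat less_imp_neq[OF s0, symmetric] s0
    by (auto simp: s_def[abs_def])
  \<comment> \<open>A Borel version of \<open>Im (boundary_value \<gamma> k)\<close>: spectral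
    distributions live on the Borel sets, and a limit along a sequence of continuous functions is
    Borel measurable.\<close>
  define g where "g k = lim (\<lambda>n. Im (\<gamma> (Complex k (s n))))" for k
  have g: "g \<in> borel_measurable borel"
    unfolding g_def by (intro borel_measurable_lim_metric vertical_line_measurable holo s0)
  have "u = 0" if range: "u \<in> range (E {..<l0})" and ac: "u \<in> ac_subspace E" for u
  proof -
    have "E {..<l0} u = u" using range idem[OF L] by auto
    then have "E {l0..} u = 0"
    proof -
      have "{..<l0} \<inter> {l0..} = {}" by auto
      from disjoint_zero[OF L _ this, of u] \<open>E {..<l0} u = u\<close> show ?thesis by simp
    qed
    from AE_distr_notin[OF _ this] have supp: "AE k in distr u. k < l0"
      by (simp add: not_le)
    have "AE k in lebesgue. ((\<lambda>\<epsilon>. Im (\<gamma> (Complex k \<epsilon>))) \<longlongrightarrow> g k) (at_right 0) \<and> (k < l0 \<longrightarrow> g k \<noteq> 0)"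
      using AE_boundary_value[OF holo bdd] left
    proof eventually_elim
      case (elim k)
      have lim: "((\<lambda>\<epsilon>. Im (\<gamma> (Complex k \<epsilon>))) \<longlongrightarrow> Im (boundary_value \<gamma> k)) (at_right 0)"
        by (rule tendsto_Im[OF nontangential_limit_vertical[OF elim(1)]])
      from limI[OF filterlim_compose[OF this s_right]]
      have "g k = Im (boundary_value \<gamma> k)" by (simp add: g_def)
      with lim elim(2) show ?case by (simp add: complex_is_Real_iff)
    qed
    then have "AE k in lborel. ((\<lambda>\<epsilon>. Im (\<gamma> (Complex k \<epsilon>))) \<longlongrightarrow> g k) (at_right 0) \<and> (k < l0 \<longrightarrow> g k \<noteq> 0)"
      by (simp only: AE_completion_iff)
    then have AE: "AE k in distr u. ((\<lambda>\<epsilon>. Im (\<gamma> (Complex k \<epsilon>))) \<longlongrightarrow> g k) (at_right 0) \<and> (k < l0 \<longrightarrow> g k \<noteq> 0)"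
      by (rule absolutely_continuous_AE[rotated 2]) (use ac in \<open>simp_all add: ac_subspace_def\<close>)
    then have lim: "AE k in distr u. ((\<lambda>\<epsilon>. Im (\<gamma> (Complex k \<epsilon>))) \<longlongrightarrow> g k) (at_right 0)"
      by eventually_elim simp
    \<comment> \<open>Annihilation for the vector \<open>E S u\<close> is compared with dominated
      convergence on \<open>S\<close>, so the signed measure with density \<open>g\<close> vanishes
      on every Borel set.\<close>
    have zero: "(\<integral>k. indicator S k * g k \<partial>distr u) = 0" if S: "S \<in> sets borel" for S
    proof (rule tendsto_unique[OF _ dominated_boundary_integral[OF holo bdd lim g S]])
      have "((\<lambda>\<epsilon>. \<integral>k. Im (\<gamma> (Complex k \<epsilon>)) \<partial>distr (E S u)) \<longlongrightarrow> 0) (at_right 0)"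
        using wa unfolding weakly_annihilates_iff[OF holo bdd] by blast
      then show "((\<lambda>\<epsilon>. \<integral>k. indicator S k * Im (\<gamma> (Complex k \<epsilon>)) \<partial>distr u) \<longlongrightarrow> 0) (at_right 0)"
      proof (rule Lim_transform_eventually)
        show "\<forall>\<^sub>F \<epsilon> in at_right 0. (\<integral>k. Im (\<gamma> (Complex k \<epsilon>)) \<partial>distr (E S u)) = (\<integral>k. indicator S k * Im (\<gamma> (Complex k \<epsilon>)) \<partial>distr u)"
          using eventually_at_right_less[of "0::real"]
          by eventually_elim (rule integral_distr_proj[OF S vertical_line_measurable[OF holo]])
      qed
    qed simp
    obtain M where M: "\<And>z. z \<in> upper_half_plane \<Longrightarrow> cmod (\<gamma> z) \<le> M"
      using bdd by (auto simp: bounded_iff)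
    have gM: "AE k in distr u. \<bar>g k\<bar> \<le> M"
      using lim
    proof eventually_elim
      case (elim k)
      show ?case
      proof (rule tendsto_upperbound[OF tendsto_rabs[OF elim]])
        show "\<forall>\<^sub>F \<epsilon> in at_right 0. \<bar>Im (\<gamma> (Complex k \<epsilon>))\<bar> \<le> M"
          using eventually_at_right_less[of "0::real"]
          by eventually_elim (rule order_trans[OF abs_Im_le_cmod M], simp add: upper_half_plane_def)
      qed simp
    qed
    \<comment> \<open>Used with \<open>a = 1\<close> on the set where \<open>g\<close> is positive
      and with \<open>a = - 1\<close> where it is negative; a function of constant sign with
      integral 0 vanishes almost everywhere.\<close>
    have null: "AE k in distr u. indicator S k * g k = 0"
      if S: "S \<in> sets borel" and sgn: "(\<forall>k\<in>S. 0 \<le> a * g k)" and a: "a \<noteq> 0" for S a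
    proof -
      have "(\<integral>k. a * (indicator S k * g k) \<partial>distr u) = 0" using zero[OF S] by simp
      moreover have "integrable (distr u) (\<lambda>k. a * (indicator S k * g k))"
      proof (intro integrable_mult_right distr.integrable_const_bound[of _ M])
        show "AE k in distr u. norm (indicator S k * g k) \<le> M"
          using gM by eventually_elim (auto simp: indicator_def)
        show "(\<lambda>k. indicator S k * g k) \<in> borel_measurable (distr u)"
          using g S by (simp add: measurable_cong_sets[OF sets_distr refl])
      qed
      moreover have "AE k in distr u. 0 \<le> a * (indicator S k * g k)"
        using sgn by (intro AE_I2) (auto simp: indicator_def)
      ultimately have "AE k in distr u. a * (indicator S k * g k) = 0"
        using integral_nonneg_eq_0_iff_AE by blast
      then show ?thesis by eventually_elim (use a in simp)
    qed
    have "{k. 0 < g k} \<in> sets borel" "{k. g k < 0} \<in> sets borel"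
      using g by measurable
    from null[OF this(1), of 1] null[OF this(2), of "- 1"]
    have "AE k in distr u. indicator {k. 0 < g k} k * g k = 0" "AE k in distr u. indicator {k. g k < 0} k * g k = 0"
      by auto
    with AE supp have "AE k in distr u. False"
    proof eventually_elim
      case (elim k)
      then show ?case by (cases "g k" "0::real" rule: linorder_cases) auto
    qed
    then have "measure (distr u) UNIV = 0"
      by (auto simp: AE_iff_measurable[of UNIV] measure_def)
    then show "u = 0" by (simp add: measure_distr_UNIV)
  qed
  moreover have "0 \<in> range (E {..<l0})"
    using bounded_clinearD(5)[OF clinear[OF L]] by (metis rangeI)
  moreover have "0 \<in> ac_subspace E"
    by (auto simp: ac_subspace_def absolutely_continuous_def null_sets_def emeasure_distr bounded_clinearD(5)[OF clinear])
  ultimately show ?thesis unfolding purely_singular_left_def by blast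
qed

text \<open>Exhaustion gives each vector of a countable dense set its own maximal null set, and the
  union \<open>N0\<close> is still null. A null set disjoint from \<open>N0\<close> has a projection
  that kills the dense set, hence everything by continuity. So what remains to the left of
  \<open>l0\<close> off \<open>N0\<close> is absolutely continuous, and singularity forces it to be
  0.\<close>

lemma exists_null_support:
  assumes separable: "\<exists>X::'h set. countable X \<and> closure X = UNIV"
    and sing: "purely_singular_left E l0"
  obtains N where "N \<in> null_sets lborel" "N \<subseteq> {..<l0}" "\<And>u. E ({..<l0} - N) u = 0"
proof -
  obtain X :: "'h set" where X: "countable X" "closure X = UNIV" using separable by blast
  have "\<exists>N. N \<in> null_sets lborel \<and> (\<forall>S. S \<in> null_sets lborel \<longrightarrow> S \<inter> N = {} \<longrightarrow> E S x = 0)" for x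
  proof -
    obtain N where N: "N \<in> null_sets lborel"
      "\<And>S. S \<in> null_sets lborel \<Longrightarrow> S \<inter> N = {} \<Longrightarrow> measure (distr x) S = 0"
      using distr.exists_maximal_null_set[of lborel x] by auto
    have "E S x = 0" if "S \<in> null_sets lborel" "S \<inter> N = {}" for S
      using N(2)[OF that] that(1) by (auto simp: measure_distr null_sets_def)
    with N(1) show ?thesis by blast
  qed
  then obtain F where F: "\<And>x. F x \<in> null_sets lborel"
    "\<And>x S. S \<in> null_sets lborel \<Longrightarrow> S \<inter> F x = {} \<Longrightarrow> E S x = 0" by metis
  define N0 where "N0 = (\<Union>x\<in>X. F x)"
  have N0: "N0 \<in> null_sets lborel" unfolding N0_def by (intro null_sets_UN' X F)
  have zero: "E S u = 0" if S: "S \<in> null_sets lborel" "S \<inter> N0 = {}" for S u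
  proof -
    have Sb: "S \<in> sets borel" using S(1) by auto
    have "closed {u. E S u = 0}"
      by (intro closed_Collect_eq continuous_intros linear_continuous_on bounded_clinearD(1) clinear Sb)
    moreover have "X \<subseteq> {u. E S u = 0}" using F(2)[OF S(1)] S(2) by (auto simp: N0_def)
    ultimately have "closure X \<subseteq> {u. E S u = 0}" by (intro closure_minimal)
    then show ?thesis using X by auto
  qed
  define N where "N = N0 \<inter> {..<l0}"
  have N: "N \<in> null_sets lborel" unfolding N_def by (intro null_set_Int2 N0) simp
  have Nb: "N \<in> sets borel" using N by auto
  have "E ({..<l0} - N) u = 0" for u
  proof -
    let ?w = "E ({..<l0} - N) u"
    have D: "{..<l0} - N \<in> sets borel" using Nb by simp
    have "E {..<l0} ?w = ?w"
      by (subst mult[OF D]) (auto intro!: arg_cong[of _ _ "\<lambda>S. E S u"])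
    then have "?w \<in> range (E {..<l0})" by (metis rangeI)
    \<comment> \<open>A null set meets \<open>{..<l0} - N\<close> in a null set disjoint from
      \<open>N0\<close>, whose projection vanishes.\<close>
    moreover have "?w \<in> ac_subspace E"
      unfolding ac_subspace_def absolutely_continuous_def
    proof (intro CollectI subsetI)
      fix S :: "real set" assume S: "S \<in> null_sets lborel"
      then have Sb: "S \<in> sets borel" by auto
      have "S \<inter> ({..<l0} - N) \<in> null_sets lborel" using S D by (intro null_set_Int2) auto
      then have "E (S \<inter> ({..<l0} - N)) u = 0" by (rule zero) (auto simp: N_def)
      then show "S \<in> null_sets (distr ?w)"
        using Sb D by (simp add: null_sets_def emeasure_distr mult)
    qed
    ultimately show ?thesis using sing by (auto simp: purely_singular_left_def)
  qed
  with N show ?thesis by (intro that[of N]) (auto simp: N_def)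
qed

lemma weakly_annihilates_if_vanishing:
  assumes holo: "\<gamma> holomorphic_on upper_half_plane" and bdd: "bounded (\<gamma> ` upper_half_plane)"
    and S: "S \<in> sets borel" "\<And>u. E S u = 0"
    and lim: "\<And>k. k \<notin> S \<Longrightarrow> ((\<lambda>\<epsilon>. Im (\<gamma> (Complex k \<epsilon>))) \<longlongrightarrow> 0) (at_right 0)"
  shows "weakly_annihilates \<gamma> E"
  unfolding weakly_annihilates_iff[OF holo bdd]
proof
  fix u
  have "AE k in distr u. ((\<lambda>\<epsilon>. Im (\<gamma> (Complex k \<epsilon>))) \<longlongrightarrow> 0) (at_right 0)"
    using AE_distr_notin[OF S] by eventually_elim (rule lim)
  from dominated_boundary_integral[OF holo bdd this, of UNIV]
  show "((\<lambda>\<epsilon>. \<integral>k. Im (\<gamma> (Complex k \<epsilon>)) \<partial>distr u) \<longlongrightarrow> 0) (at_right 0)" by simp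
qed

end

theorem theorem3p1:
  fixes D :: "'h::complex_hilbert set"
    and A :: "'h \<Rightarrow> 'h"
    and E :: "real set \<Rightarrow> 'h \<Rightarrow> 'h"
    and l0 :: real
    and \<Delta> :: "real set"
  assumes separable: "\<exists>X::'h set. countable X \<and> closure X = UNIV"
    and sa: "self_adjoint_op D A"
    and spectral: "is_spectral_measure D A E"
    and gap: "open \<Delta>" "l0 \<in> \<Delta>" "complex_of_real ` \<Delta> \<subseteq> resolvent_set D A"
  shows "purely_singular_left E l0 \<longleftrightarrow>
    (\<exists>\<gamma> :: complex \<Rightarrow> complex.
       bounded_outer \<gamma> \<and> \<not> \<gamma> constant_on upper_half_plane \<and>
       (AE k in lebesgue. l0 < k \<longrightarrow> boundary_value \<gamma> k \<in> \<real>) \<and>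
       (AE k in lebesgue. k < l0 \<longrightarrow> boundary_value \<gamma> k \<notin> \<real>) \<and>
       weakly_annihilates \<gamma> E)"
proof -
  interpret pvm E using spectral by unfold_locales (simp add: is_spectral_measure_def)
  show ?thesis
  proof
    assume sing: "purely_singular_left E l0"
    obtain N where N: "N \<in> null_sets lborel" "N \<subseteq> {..<l0}"
      "\<And>u. E ({..<l0} - N) u = 0"
      by (rule exists_null_support[OF separable sing]) (rule that)
    obtain \<gamma> where \<gamma>: "bounded_outer \<gamma>"
      "AE k in lebesgue. l0 < k \<longrightarrow> boundary_value \<gamma> k \<in> \<real>"
      "AE k in lebesgue. k < l0 \<longrightarrow> boundary_value \<gamma> k \<notin> \<real>"
      "\<And>k. k \<in> N \<or> l0 \<le> k \<Longrightarrow> ((\<lambda>e. Im (\<gamma> (Complex k e))) \<longlongrightarrow> 0) (at_right 0)"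
      by (rule exists_outer_function[OF N(1,2)]) (rule that)
    have "weakly_annihilates \<gamma> E"
    proof (rule weakly_annihilates_if_vanishing)
      show "\<gamma> holomorphic_on upper_half_plane" "bounded (\<gamma> ` upper_half_plane)"
        using \<gamma>(1) by (auto simp: bounded_outer_def)
      show "{..<l0} - N \<in> sets borel" using N(1) by auto
      show "E ({..<l0} - N) u = 0" for u by (rule N(3))
      \<comment> \<open>The complement of \<open>{..<l0} - N\<close> consists of \<open>N\<close>
        and \<open>[l0, \<infinity>)\<close>, exactly where \<gamma> has vanishing imaginary
        limits.\<close>
      show "((\<lambda>e. Im (\<gamma> (Complex k e))) \<longlongrightarrow> 0) (at_right 0)" if "k \<notin> {..<l0} - N" for k
        using that by (intro \<gamma>(4)) auto
    qed
    with \<gamma> not_constant_if_boundary_value[OF \<gamma>(2,3)]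
    show "\<exists>\<gamma>. bounded_outer \<gamma> \<and> \<not> \<gamma> constant_on upper_half_plane \<and>
       (AE k in lebesgue. l0 < k \<longrightarrow> boundary_value \<gamma> k \<in> \<real>) \<and>
       (AE k in lebesgue. k < l0 \<longrightarrow> boundary_value \<gamma> k \<notin> \<real>) \<and> weakly_annihilates \<gamma> E"
      by blast
  next
    assume "\<exists>\<gamma>. bounded_outer \<gamma> \<and> \<not> \<gamma> constant_on upper_half_plane \<and>
       (AE k in lebesgue. l0 < k \<longrightarrow> boundary_value \<gamma> k \<in> \<real>) \<and>
       (AE k in lebesgue. k < l0 \<longrightarrow> boundary_value \<gamma> k \<notin> \<real>) \<and> weakly_annihilates \<gamma> E"
    then show "purely_singular_left E l0"
      by (auto simp: bounded_outer_def intro: singular_if_weakly_annihilates)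
  qed
qed

end
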